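(* Assume the Riemann Hypothesis. Let $a<b$ be positive integers with $a\nmid b$. Let $\alpha(a,b)$ be a real number with $0<\alpha(a,b)<\frac1{a+b}$ such that $\Delta(a,b;x)\ll x^{\alpha(a,b)+\varepsilon}$ for every $\varepsilon>0$, and suppose $\alpha(a,b)<\frac1{2b}$. Then for every $\varepsilon>0$, $$\sum_{n\le x}f_{(a,b)}(n)=\frac{\zeta(\frac ba)}{\zeta(\frac{2b}a)}x^{\frac1a}+\frac{\zeta(\frac ab)}{\zeta(2)}x^{\frac1b}+O\!\left(x^{\frac{1-a\alpha(a,b)}{a+2b-4ab\,\alpha(a,b)}+\varepsilon}\right).$$
   Context: $\zeta$ is the Riemann zeta-function. $R_{a,b}$ is the set of all positive integers $n$ such that each exponent in the prime factorization of $n$ is either a multiple of $a$ or of the form $at+b$ with an integer $t\ge0$ (with $1\in R_{a,b}$), and $f_{(a,b)}$ is the characteristic function of $R_{a,b}$ (generalized square-full integers). Let $d(a,b;n)$ be the number of pairs of positive integers $(m_1,m_2)$ with $m_1^am_2^b=n$; the error term $\Delta(a,b;x)$ is defined by $\sum_{n\le x}d(a,b;n)=\zeta(b/a)x^{1/a}+\zeta(a/b)x^{1/b}+\Delta(a,b;x)$. Implied constants depend only on $a,b,\alpha(a,b),\varepsilon$. *)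

theory Defs
  imports
    "HOL-Complex_Analysis.Complex_Analysis"
    "HOL-Computational_Algebra.Primes"
    "HOL-Library.Landau_Symbols"
begin

text \<open>
  The Riemann zeta function is the analytic continuation of the Dirichlet series
  $\sum_{n\ge 1} n^{-s}$ to the complex plane without the point $1$; it is unique by the
  identity theorem. The value at the pole is the convention that makes the description definite.
\<close>

definition is_zeta :: "(complex \<Rightarrow> complex) \<Rightarrow> bool" where
  "is_zeta f \<longleftrightarrow>
     f holomorphic_on (- {1}) \<and>
     (\<forall>s. Re s > 1 \<longrightarrow> (\<lambda>n. of_nat (Suc n) powr (- s)) sums f s) \<and>
     f 1 = 0"

definition zeta :: "complex \<Rightarrow> complex" where
  "zeta = (THE f. is_zeta f)"

text \<open>On the real axis the zeta function takes real values, so no information is lost by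
  taking the real part.\<close>

definition zeta_real :: "real \<Rightarrow> real" where
  "zeta_real x = Re (zeta (of_real x))"

definition Riemann_Hypothesis :: bool where
  "Riemann_Hypothesis \<longleftrightarrow> (\<forall>s. 0 < Re s \<and> Re s < 1 \<and> zeta s = 0 \<longrightarrow> Re s = 1 / 2)"

definition gen_square_full :: "nat \<Rightarrow> nat \<Rightarrow> nat set" where
  "gen_square_full a b =
     {n. n > 0 \<and> (\<forall>p. prime p \<and> p dvd n \<longrightarrow>
        a dvd multiplicity p n \<or> (\<exists>t. multiplicity p n = a * t + b))}"

definition gen_square_full_char :: "nat \<Rightarrow> nat \<Rightarrow> nat \<Rightarrow> real" where
  "gen_square_full_char a b = indicator (gen_square_full a b)"

definition div_count :: "nat \<Rightarrow> nat \<Rightarrow> nat \<Rightarrow> nat" where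
  "div_count a b n = card {(m1, m2). m1 > 0 \<and> m2 > 0 \<and> m1 ^ a * m2 ^ b = n}"

definition div_error :: "nat \<Rightarrow> nat \<Rightarrow> real \<Rightarrow> real" where
  "div_error a b x =
     (\<Sum>n | 0 < n \<and> real n \<le> x. real (div_count a b n))
       - (zeta_real (real b / real a) * x powr (1 / real a)
          + zeta_real (real a / real b) * x powr (1 / real b))"

end

(*
  The Dirichlet series of the characteristic function is zeta(as) zeta(bs) / zeta(2bs), so that
  its summatory function is the sum of mu(m) over all triples with m1^a m2^b m^(2b) <= x.
  Split the triples at m = Y.  For m <= Y use the hypothesis on the error term of the divisor
  problem.  The triples with m > Y are counted by a contour integral of
  zeta(as) zeta(bs) f_Y(2bs), where f_Y(w) = sum_{m > Y} mu(m) m^(-w); the line of integration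
  is moved to Re s = (1/2 + delta)/a, where Re (2bs) > 1.  Under the Riemann hypothesis
  zeta(s) and 1/zeta(s) are O(|t|^epsilon) for Re s >= 1/2 + delta, hence
  f_Y(w) << Y^(1/2 - Re w + epsilon) |Im w|^epsilon.
  The residues at 1/a and 1/b complete the main terms, and Y = x^eta with
  eta = (1 - 2 a alpha) / (a + 2b - 4 a b alpha) balances the two errors.  If b > 2a, the pole at
  1/b is not crossed, and the missing part of the second main term is itself small enough.
*)
theory Submission
  imports Defs "HOL-Number_Theory.Prime_Powers" "HOL-Computational_Algebra.Squarefree"
begin

text \<open>The obstacle is the sharp cut-off: Perron's integral converges only conditionally, and
  truncating it brings errors from integers close to x. A summatory function is constant on [N, N +
  1), so averaging over this interval loses nothing at integers N, and the averaged kernel is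
  O(N^(\<sigma>+\<theta>) |t|^(-1-\<theta>)) for 0 < \<theta> \<le> 1. Whole vertical lines can then
  be used at the price of N^\<epsilon>. Passing from N to real x costs O(1), as 1/a and 1/b are
  below 1.

  The same contour shift serves twice: for 1/zeta(s + it), which bounds the sums of mu(m) m^(-it)
  with explicit dependence on t and hence f_Y by partial summation, and for the series over the
  triples.

  The exponent \<eta> solves \<alpha> + \<eta> (1 - 2b\<alpha>) = 1/(2a) - \<eta> (b/a - 1/2). The
  left side comes from summing (x/m^(2b))^\<alpha> over m \<le> Y, where 2b\<alpha> < 1 enters; the
  right side comes from the line Re s = 1/(2a).

  As a does not divide b, a \<ge> 2 and b \<noteq> 2a. So all series converge absolutely on Re s =
  1, and the shifted line can avoid the pole at 1/b.\<close>

no_notation Infinite_Set_Sum.abs_summable_on (infix \<open>abs'_summable'_on\<close> 50)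

section \<open>The Riemann zeta function\<close>

abbreviation re_gt :: "real \<Rightarrow> complex set" where
  "re_gt c \<equiv> {s. Re s > c}"

lemma open_re_gt: "open (re_gt c)"
  by (rule open_halfspace_Re_gt)

lemma convex_re_gt: "convex (re_gt c)"
  by (rule convex_halfspace_Re_gt)

lemma norm_nat_powr: "n > 0 \<Longrightarrow> norm (of_nat n powr s :: complex) = real n powr Re s"
  using norm_powr_real_powr[of "of_nat n" s] by simp

lemma of_nat_nonpos_Reals_iff [simp]: "(of_nat n :: complex) \<in> \<real>\<^sub>\<le>\<^sub>0 \<longleftrightarrow> n = 0"
  by (auto simp: complex_nonpos_Reals_iff)

lemma of_nat_Suc_not_nonpos [simp]: "(1 + of_nat n :: complex) \<notin> \<real>\<^sub>\<le>\<^sub>0"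
  by (auto simp: complex_nonpos_Reals_iff)

text \<open>Falling factorial of 1 - s: the k-th derivative of x^(1-s) is
  \<open>pw_coeff k s\<close> times x^(1-s-k).\<close>

definition pw_coeff :: "nat \<Rightarrow> complex \<Rightarrow> complex" where
  "pw_coeff k s = (\<Prod>j<k. 1 - s - of_nat j)"

text \<open>Error at x = n + 2 of the Taylor polynomial of degree K of x^(1-s) about x = n + 1. It
  decays like n^(-Re s - K), so a larger K moves the region of convergence of its sum over n to the
  left.\<close>

definition zeta_rem :: "nat \<Rightarrow> nat \<Rightarrow> complex \<Rightarrow> complex" where
  "zeta_rem K n s = of_nat (Suc (Suc n)) powr (1 - s)
     - (\<Sum>k\<le>K. pw_coeff k s / fact k * of_nat (Suc n) powr (1 - s - of_nat k))"

lemma pw_coeff_0 [simp]: "pw_coeff 0 s = 1"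
  and pw_coeff_Suc: "pw_coeff (Suc k) s = pw_coeff k s * (1 - s - of_nat k)"
  by (simp_all add: pw_coeff_def)

lemma holomorphic_pw_coeff [holomorphic_intros]:
  "(\<lambda>s. pw_coeff k s) holomorphic_on A"
  unfolding pw_coeff_def by (intro holomorphic_intros)

lemma holomorphic_zeta_rem [holomorphic_intros]: "zeta_rem K n holomorphic_on A"
  unfolding zeta_rem_def [abs_def] by (intro holomorphic_intros) (simp_all)

text \<open>Taylor's theorem on the segment from n + 1 to n + 2. The derivative of order K + 1 has
  exponent 1 - s - (K + 1), whose real part is nonpositive by assumption, so its norm is largest at
  the left end point.\<close>

lemma norm_zeta_rem_le:
  assumes "Re s + real K \<ge> 0"
  shows "norm (zeta_rem K n s) \<le> norm (pw_coeff (Suc K) s) * real (Suc n) powr (- (Re s + real K))"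
proof -
  define S where "S = closed_segment (of_nat (Suc n)) (of_nat (Suc (Suc n)) :: complex)"
  define f where "f = (\<lambda>k x. pw_coeff k s * x powr (1 - s - of_nat k))"
  have S: "\<exists>y. x = of_real y \<and> real (Suc n) \<le> y" if "x \<in> S" for x
  proof -
    have "x \<in> of_real ` closed_segment (real (Suc n)) (real (Suc (Suc n)))"
      using that unfolding S_def
      by (metis closed_segment_of_real of_real_of_nat_eq)
    thus ?thesis by (auto simp: closed_segment_eq_real_ivl)
  qed
  have "norm (f 0 (of_nat (Suc (Suc n))) -
          (\<Sum>i\<le>K. f i (of_nat (Suc n)) * (of_nat (Suc (Suc n)) - of_nat (Suc n)) ^ i / fact i))
        \<le> (norm (pw_coeff (Suc K) s) * real (Suc n) powr (- (Re s + real K)))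
           * norm (of_nat (Suc (Suc n)) - of_nat (Suc n) :: complex) ^ Suc K / fact K"
  proof (rule complex_Taylor[where S = S])
    show "(f i has_field_derivative f (Suc i) x) (at x within S)" if "x \<in> S" for i x
    proof -
      obtain y where y: "x = of_real y" "y \<ge> real (Suc n)" using S[OF \<open>x \<in> S\<close>] by blast
      hence "x \<notin> \<real>\<^sub>\<le>\<^sub>0" by (auto simp: complex_nonpos_Reals_iff)
      hence "((\<lambda>x. pw_coeff i s * x powr (1 - s - of_nat i)) has_field_derivative
          pw_coeff i s * ((1 - s - of_nat i) * x powr (1 - s - of_nat i - 1))) (at x within S)"
        by (intro DERIV_cmult has_field_derivative_at_within[OF has_field_derivative_powr])
      moreover have "1 - s - of_nat (Suc i) = 1 - s - of_nat i - 1" by simp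
      ultimately show ?thesis unfolding f_def by (simp only: pw_coeff_Suc mult.assoc)
    qed
    show "norm (f (Suc K) x) \<le> norm (pw_coeff (Suc K) s) * real (Suc n) powr (- (Re s + real K))"
      if "x \<in> S" for x
    proof -
      obtain y where y: "x = of_real y" "y \<ge> real (Suc n)" using S[OF \<open>x \<in> S\<close>] by blast
      have "norm (x powr (1 - s - of_nat (Suc K))) = y powr (- (Re s + real K))"
        using y by (subst norm_powr_real_powr) (auto simp: algebra_simps)
      also have "\<dots> \<le> real (Suc n) powr (- (Re s + real K))"
        using assms y by (intro powr_mono2') auto
      finally show ?thesis by (auto simp: f_def norm_mult intro!: mult_left_mono)
    qed
  qed (auto simp: S_def)
  also have "\<dots> \<le> norm (pw_coeff (Suc K) s) * real (Suc n) powr (- (Re s + real K))"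
    using divide_left_mono[of 1 "fact K" "norm (pw_coeff (Suc K) s) * real (Suc n) powr (- (Re s + real K))"]
    by simp
  also have "f 0 (of_nat (Suc (Suc n))) -
          (\<Sum>i\<le>K. f i (of_nat (Suc n)) * (of_nat (Suc (Suc n)) - of_nat (Suc n)) ^ i / fact i)
        = zeta_rem K n s"
    by (simp add: f_def zeta_rem_def)
  finally show ?thesis .
qed

lemma summable_Suc_powr: "x > 1 \<Longrightarrow> summable (\<lambda>n. real (Suc n) powr (- x))"
  using summable_Suc_iff[of "\<lambda>n. real n powr (-x)"] summable_real_powr_iff[of "-x"] by simp

lemma holomorphic_suminf_zeta_rem:
  "(\<lambda>s. \<Sum>n. zeta_rem K n s) holomorphic_on re_gt (1 - real K)"
proof (rule holomorphic_uniform_sequence[where f = "\<lambda>N s. \<Sum>n<N. zeta_rem K n s"])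
  fix x assume x: "x \<in> re_gt (1 - real K)"
  \<comment> \<open>Half the distance from x to the boundary line; r is then the smallest real part
    on the closed disc, which makes the majorant uniform there.\<close>
  define d where "d = (Re x - (1 - real K)) / 2"
  define r where "r = (Re x + (1 - real K)) / 2"
  have d: "d > 0" using x by (simp add: d_def)
  have re: "Re s \<ge> r" if "s \<in> cball x d" for s
  proof -
    have "Re (x - s) \<le> d"
      using that complex_Re_le_cmod[of "x - s"] by (simp add: dist_norm)
    moreover have "r = Re x - d" by (simp add: d_def r_def field_simps)
    ultimately show ?thesis by simp
  qed
  have r: "r > 1 - real K" using x by (simp add: r_def)
  have "compact ((\<lambda>s. pw_coeff (Suc K) s) ` cball x d)"
    by (intro compact_continuous_image holomorphic_on_imp_continuous_on holomorphic_intros compact_cball)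
  then obtain B where B: "\<And>s. s \<in> cball x d \<Longrightarrow> norm (pw_coeff (Suc K) s) \<le> B"
    using compact_imp_bounded bounded_iff by (metis imageI)
  have "uniform_limit (cball x d) (\<lambda>N s. \<Sum>n<N. zeta_rem K n s) (\<lambda>s. \<Sum>n. zeta_rem K n s) sequentially"
  proof (rule Weierstrass_m_test)
    show "norm (zeta_rem K n s) \<le> B * real (Suc n) powr (- (r + real K))" if s: "s \<in> cball x d" for n s
    proof -
      have "norm (zeta_rem K n s) \<le> norm (pw_coeff (Suc K) s) * real (Suc n) powr (- (Re s + real K))"
        using re[OF s] r by (intro norm_zeta_rem_le) auto
      also have "\<dots> \<le> B * real (Suc n) powr (- (r + real K))"
        using B[OF s] re[OF s] by (intro mult_mono powr_mono) (auto intro: order_trans[OF norm_ge_zero])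
      finally show ?thesis .
    qed
    show "summable (\<lambda>n. B * real (Suc n) powr (- (r + real K)))"
      using r by (intro summable_mult summable_Suc_powr) auto
  qed
  moreover have "cball x d \<subseteq> re_gt (1 - real K)"
    using re r by fastforce
  ultimately show "\<exists>d>0. cball x d \<subseteq> re_gt (1 - real K) \<and>
     uniform_limit (cball x d) (\<lambda>N s. \<Sum>n<N. zeta_rem K n s) (\<lambda>s. \<Sum>n. zeta_rem K n s) sequentially"
    using d by blast
qed (intro holomorphic_intros open_re_gt)+

lemma summable_zeta: "Re s > 1 \<Longrightarrow> summable (\<lambda>n. of_nat (Suc n) powr (- s) :: complex)"
  by (rule summable_norm_cancel) (use summable_Suc_powr[of "Re s"] in \<open>simp add: norm_powr_real_powr\<close>)

text \<open>The Taylor term k = 0 combines with (n+2)^(1-s) to a telescoping series with sum -1; the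
  other terms are zeta series at s, s + 1, ..., s + K - 1.\<close>

lemma suminf_zeta_rem:
  assumes "Re s > 1"
  shows "(\<Sum>n. zeta_rem K n s) =
     - 1 - (\<Sum>k=1..K. pw_coeff k s / fact k * (\<Sum>n. of_nat (Suc n) powr (- (s + of_nat k - 1))))"
proof -
  have "(\<lambda>n. of_nat (Suc n) powr (1 - s) :: complex) \<longlonglongrightarrow> 0"
    using assms by (intro tendsto_neg_powr_complex_of_nat filterlim_Suc) auto
  from telescope_sums[OF this]
  have 1: "(\<lambda>n. of_nat (Suc (Suc n)) powr (1 - s) - of_nat (Suc n) powr (1 - s)) sums (-1)" by simp
  have 2: "(\<lambda>n. \<Sum>k=1..K. pw_coeff k s / fact k * of_nat (Suc n) powr (- (s + of_nat k - 1)))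
     sums (\<Sum>k=1..K. pw_coeff k s / fact k * (\<Sum>n. of_nat (Suc n) powr (- (s + of_nat k - 1))))"
    by (intro sums_sum sums_mult summable_sums summable_zeta) (use assms in auto)
  have "zeta_rem K n s = (of_nat (Suc (Suc n)) powr (1 - s) - of_nat (Suc n) powr (1 - s)) -
     (\<Sum>k=1..K. pw_coeff k s / fact k * of_nat (Suc n) powr (- (s + of_nat k - 1)))" for n
  proof -
    have "(\<Sum>k\<le>K. pw_coeff k s / fact k * of_nat (Suc n) powr (1 - s - of_nat k)) =
       of_nat (Suc n) powr (1 - s) + (\<Sum>k=1..K. pw_coeff k s / fact k * of_nat (Suc n) powr (1 - s - of_nat k))"
      unfolding atMost_atLeast0 by (subst sum.atLeast_Suc_atMost) auto
    thus ?thesis by (simp add: zeta_rem_def algebra_simps)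
  qed
  with sums_diff[OF 1 2] show ?thesis by (simp add: sums_iff)
qed

text \<open>For \<open>Re s > 1\<close>, telescoping \<open>(n+1)\<^bsup>1-s\<^esup> - n\<^bsup>1-s\<^esup>\<close> and expanding \<open>(n+1)\<^bsup>1-s\<^esup>\<close> at
  \<open>n\<close> expresses \<open>(s - 1) zeta s\<close> through \<open>zeta (s + 1), \<dots>, zeta (s + K - 1)\<close> and a series that
  converges for \<open>Re s > 1 - K\<close>; this gives the continuation strip by strip.\<close>

lemma zeta_strip_continuation:
  "\<exists>Z. Z holomorphic_on re_gt (- real K) \<and>
       (\<forall>s. Re s > 1 \<longrightarrow> Z s = (s - 1) * (\<Sum>n. of_nat (Suc n) powr (- s)))"
proof (induction K)
  case 0
  show ?case
  proof (intro exI conjI allI impI)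
    show "(\<lambda>s. 1 + (\<Sum>n. zeta_rem 1 n s)) holomorphic_on re_gt (- real 0)"
      using holomorphic_suminf_zeta_rem[of 1] by (intro holomorphic_intros) simp
    show "1 + (\<Sum>n. zeta_rem 1 n s) = (s - 1) * (\<Sum>n. of_nat (Suc n) powr (- s))"
      if "Re s > 1" for s
      using that by (simp add: suminf_zeta_rem pw_coeff_Suc algebra_simps)
  qed
next
  case (Suc K)
  then obtain Z where Z: "Z holomorphic_on re_gt (- real K)"
    "\<And>s. Re s > 1 \<Longrightarrow> Z s = (s - 1) * (\<Sum>n. of_nat (Suc n) powr (- s))" by blast
  \<comment> \<open>The remainder series of order K + 2 converges for Re s > -(K + 1). The last
    factor of \<open>pw_coeff k s\<close> is -(s + k - 2); it is moved into Z, where it cancels the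
    pole of the zeta series at s + k - 1. This is why \<open>pw_coeff (k - 1)\<close>
    appears.\<close>
  define W where "W = (\<lambda>s. 1 + (\<Sum>n. zeta_rem (K + 2) n s)
      - (\<Sum>k=2..K+2. pw_coeff (k - 1) s / fact k * Z (s + of_nat k - 1)))"
  show ?case
  proof (intro exI conjI allI impI)
    have "(\<lambda>s. Z (s + of_nat k - 1)) holomorphic_on re_gt (- real (Suc K))" if "k \<ge> 2" for k
    proof -
      have "(Z \<circ> (\<lambda>s. s + of_nat k - 1)) holomorphic_on re_gt (- real (Suc K))"
        using that by (intro holomorphic_on_compose_gen[OF _ Z(1)] holomorphic_intros) auto
      thus ?thesis by (simp add: o_def)
    qed
    thus "W holomorphic_on re_gt (- real (Suc K))"
      using holomorphic_suminf_zeta_rem[of "K + 2"]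
      unfolding W_def by (intro holomorphic_intros) (auto simp: algebra_simps)
    fix s :: complex assume s: "Re s > 1"
    have "(\<Sum>k=1..K+2. pw_coeff k s / fact k * (\<Sum>n. of_nat (Suc n) powr (- (s + of_nat k - 1)))) =
      (1 - s) * (\<Sum>n. of_nat (Suc n) powr (- s)) +
      (\<Sum>k=2..K+2. pw_coeff k s / fact k * (\<Sum>n. of_nat (Suc n) powr (- (s + of_nat k - 1))))"
      by (subst sum.atLeast_Suc_atMost) (auto simp: pw_coeff_Suc numeral_2_eq_2)
    also have "(\<Sum>k=2..K+2. pw_coeff k s / fact k * (\<Sum>n. of_nat (Suc n) powr (- (s + of_nat k - 1))))
      = - (\<Sum>k=2..K+2. pw_coeff (k - 1) s / fact k * Z (s + of_nat k - 1))"
      unfolding sum_negf [symmetric]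
    proof (rule sum.cong)
      fix k :: nat assume k: "k \<in> {2..K+2}"
      then obtain j where j: "k = Suc j" "j \<ge> 1" by (cases k) auto
      have alg: "v = x * S \<Longrightarrow> q = - (p * x) \<Longrightarrow> q / F * S = - (p / F * v)" for v x S q p F :: complex
        by simp
      have "Z (s + of_nat k - 1) = (s + of_nat k - 1 - 1) * (\<Sum>n. of_nat (Suc n) powr (- (s + of_nat k - 1)))"
        by (rule Z(2)) (use s j in auto)
      moreover have "pw_coeff k s = - (pw_coeff (k - 1) s * (s + of_nat k - 1 - 1))"
        by (simp add: j(1) pw_coeff_Suc algebra_simps)
      ultimately show "pw_coeff k s / fact k * (\<Sum>n. of_nat (Suc n) powr (- (s + of_nat k - 1))) =
         - (pw_coeff (k - 1) s / fact k * Z (s + of_nat k - 1))"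
        by (rule alg)
    qed auto
    finally have *: "(\<Sum>k=1..K+2. pw_coeff k s / fact k * (\<Sum>n. of_nat (Suc n) powr (- (s + of_nat k - 1)))) =
      (1 - s) * (\<Sum>n. of_nat (Suc n) powr (- s)) +
      - (\<Sum>k=2..K+2. pw_coeff (k - 1) s / fact k * Z (s + of_nat k - 1))" .
    have alg: "v = -1 - x \<Longrightarrow> x = (1 - s) * y + - z \<Longrightarrow> 1 + v - z = (s - 1) * y" for v x y z
      by (simp add: algebra_simps)
    show "W s = (s - 1) * (\<Sum>n. of_nat (Suc n) powr (- s))"
      unfolding W_def by (rule alg[OF suminf_zeta_rem[OF s] *])
  qed
qed

section \<open>Uniqueness and existence of the zeta function\<close>

lemma is_zeta_unique:
  assumes "is_zeta f" "is_zeta g"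
  shows "f = g"
proof
  fix s
  show "f s = g s"
  proof (cases "s = 1")
    case False
    show ?thesis
    proof (rule analytic_continuation_open[where f = f and g = g and s = "re_gt 1" and s' = "- {1}"])
      show "re_gt 1 \<noteq> {}" by (auto intro!: exI[of _ 2])
      show "connected (- {1::complex})" by (rule connected_punctured_universe) simp
      show "f z = g z" if "z \<in> re_gt 1" for z
        using assms that unfolding is_zeta_def by (auto intro: sums_unique2)
    qed (use assms False in \<open>auto simp: is_zeta_def open_re_gt\<close>)
  qed (use assms in \<open>auto simp: is_zeta_def\<close>)
qed

lemma zeta_entire:
  "\<exists>Z. Z holomorphic_on UNIV \<and>
       (\<forall>s. Re s > 1 \<longrightarrow> Z s = (s - 1) * (\<Sum>n. of_nat (Suc n) powr (- s)))"
proof -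
  obtain Z where Z: "\<And>K. Z K holomorphic_on re_gt (- real K)"
    "\<And>K s. Re s > 1 \<Longrightarrow> Z K s = (s - 1) * (\<Sum>n. of_nat (Suc n) powr (- s))"
    using zeta_strip_continuation by metis
  have eq: "Z j s = Z k s" if "Re s > - real j" "j \<le> k" for j k s
  proof (rule analytic_continuation_open[where f = "Z j" and g = "Z k" and s = "re_gt 1" and s' = "re_gt (- real j)"])
    show "re_gt 1 \<noteq> {}" by (auto intro!: exI[of _ 2])
    show "Z k holomorphic_on re_gt (- real j)"
      by (rule holomorphic_on_subset[OF Z(1)[of k]]) (use that in auto)
  qed (use that Z in \<open>auto simp: open_re_gt convex_re_gt convex_connected\<close>)
  \<comment> \<open>By \<open>eq\<close> any K with Re s > -K gives the same value; letting K depend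
    on s merely turns the strip functions into one total function.\<close>
  define W where "W = (\<lambda>s. Z (nat \<lceil>\<bar>Re s\<bar> + 1\<rceil>) s)"
  have W: "W s = Z k s" if "Re s > - real k" for k s
  proof -
    have "Re s > - real (nat \<lceil>\<bar>Re s\<bar> + 1\<rceil>)" by linarith
    with that show ?thesis
      unfolding W_def by (metis eq nle_le)
  qed
  show ?thesis
  proof (intro exI conjI allI impI)
    show "W holomorphic_on UNIV"
      unfolding holomorphic_on_def
    proof
      fix s :: complex
      obtain k where k: "Re s > - real k" by (metis minus_less_iff reals_Archimedean2)
      have "Z k field_differentiable (at s)"
        using Z(1)[of k] k open_re_gt by (auto intro: holomorphic_on_imp_differentiable_at)
      moreover have "eventually (\<lambda>w. w \<in> re_gt (- real k)) (nhds s)"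
        using k by (intro eventually_nhds_in_open open_re_gt) auto
      hence "eventually (\<lambda>w. Z k w = W w) (nhds s)"
        by eventually_elim (simp add: W)
      ultimately show "W field_differentiable (at s within UNIV)"
        unfolding field_differentiable_def by (metis DERIV_cong_ev)
    qed
    show "W s = (s - 1) * (\<Sum>n. of_nat (Suc n) powr (- s))" if "Re s > 1" for s
      using W[of 0 s] Z(2)[of s 0] that by simp
  qed
qed

lemma is_zeta_zeta: "is_zeta zeta"
proof -
  obtain Z where Z: "Z holomorphic_on UNIV"
    "\<And>s. Re s > 1 \<Longrightarrow> Z s = (s - 1) * (\<Sum>n. of_nat (Suc n) powr (- s))"
    using zeta_entire by blast
  define f where "f = (\<lambda>s::complex. if s = 1 then 0 else Z s / (s - 1))"
  have "(\<lambda>s. Z s / (s - 1)) holomorphic_on - {1}"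
    by (intro holomorphic_intros holomorphic_on_subset[OF Z(1)]) auto
  hence "f holomorphic_on - {1}"
    by (rule holomorphic_transform) (auto simp: f_def)
  moreover have "(\<lambda>n. of_nat (Suc n) powr (- s)) sums f s" if "Re s > 1" for s
    using summable_sums[OF summable_zeta[OF that]] that Z(2)[OF that] by (auto simp: f_def)
  ultimately have "is_zeta f" by (auto simp: is_zeta_def f_def)
  thus ?thesis unfolding zeta_def using is_zeta_unique by (metis theI[of is_zeta f])
qed

lemma zeta_sums: "Re s > 1 \<Longrightarrow> (\<lambda>n. of_nat (Suc n) powr (- s)) sums zeta s"
  and holomorphic_zeta: "zeta holomorphic_on - {1}"
  using is_zeta_zeta by (auto simp: is_zeta_def)

text \<open>Zeta with its simple pole removed. The value at 1 is the residue; it needs a separate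
  case because \<open>zeta 1\<close> is 0 by convention.\<close>

definition zeta_reg :: "complex \<Rightarrow> complex" where
  "zeta_reg s = (if s = 1 then 1 else (s - 1) * zeta s)"

lemma zeta_reg_1 [simp]: "zeta_reg 1 = 1"
  by (simp add: zeta_reg_def)

lemma zeta_conv_zeta_reg: "s \<noteq> 1 \<Longrightarrow> zeta s = zeta_reg s / (s - 1)"
  by (simp add: zeta_reg_def)

text \<open>The case K = 1 of \<open>suminf_zeta_rem\<close>, extended to Re s > 0 by analytic
  continuation. At s = 1 every remainder vanishes, in accordance with the removable value 1.\<close>

lemma zeta_reg_eq:
  assumes "Re s > 0"
  shows "zeta_reg s = 1 + (\<Sum>n. zeta_rem 1 n s)"
proof (cases "s = 1")
  case True
  have "zeta_rem 1 n 1 = 0" for n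
  proof -
    have "of_nat (Suc n) \<noteq> (0::complex)" "of_nat (Suc (Suc n)) \<noteq> (0::complex)"
      by (simp_all only: of_nat_eq_0_iff)
    thus ?thesis by (simp add: zeta_rem_def pw_coeff_Suc del: of_nat_Suc)
  qed
  thus ?thesis using True by simp
next
  case False
  have "(s - 1) * zeta s = 1 + (\<Sum>n. zeta_rem 1 n s)"
  proof (rule analytic_continuation_open[where f = "\<lambda>s. (s - 1) * zeta s" and s = "re_gt 1" and s' = "re_gt 0 - {1}"])
    show "re_gt 1 \<noteq> {}" by (auto intro!: exI[of _ 2])
    show "connected (re_gt 0 - {1})"
      by (intro connected_open_delete open_re_gt convex_connected convex_re_gt) auto
    show "(\<lambda>s. (s - 1) * zeta s) holomorphic_on re_gt 0 - {1}"
      by (intro holomorphic_intros holomorphic_on_subset[OF holomorphic_zeta]) auto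
    have "(\<lambda>s. 1 + (\<Sum>n. zeta_rem 1 n s)) holomorphic_on re_gt 0"
      using holomorphic_suminf_zeta_rem[of 1] by (intro holomorphic_intros) simp
    thus "(\<lambda>s. 1 + (\<Sum>n. zeta_rem 1 n s)) holomorphic_on re_gt 0 - {1}"
      by (rule holomorphic_on_subset) auto
    show "(z - 1) * zeta z = 1 + (\<Sum>n. zeta_rem 1 n z)" if "z \<in> re_gt 1" for z
      using that zeta_sums[of z] by (simp add: suminf_zeta_rem pw_coeff_Suc sums_iff algebra_simps)
  qed (use assms False in \<open>auto simp: open_re_gt\<close>)
  with False show ?thesis by (simp add: zeta_reg_def)
qed

lemma holomorphic_zeta_reg: "zeta_reg holomorphic_on UNIV"
proof -
  have "zeta_reg holomorphic_on re_gt 0"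
    by (rule holomorphic_transform[of "\<lambda>s. 1 + (\<Sum>n. zeta_rem 1 n s)"])
       (use holomorphic_suminf_zeta_rem[of 1] in \<open>auto intro!: holomorphic_intros simp: zeta_reg_eq\<close>)
  moreover have "zeta_reg holomorphic_on - {1}"
    by (rule holomorphic_transform[of "\<lambda>s. (s - 1) * zeta s"])
       (auto intro!: holomorphic_intros holomorphic_zeta simp: zeta_reg_def)
  ultimately have "zeta_reg holomorphic_on re_gt 0 \<union> - {1}"
    by (intro holomorphic_on_Un open_re_gt) auto
  also have "re_gt 0 \<union> - {1} = UNIV" by auto
  finally show ?thesis .
qed

text \<open>Polynomial growth is all that is needed: it is the a priori bound that the
  Borel-Caratheodory theorem converts into a bound for log zeta. For Re s \<ge> 1/2 the remainders
  with K = 1 are summable uniformly, and \<open>pw_coeff 2 s\<close> is quadratic in s.\<close>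

lemma norm_zeta_reg_le:
  "\<exists>C>0. \<forall>s. Re s \<ge> 1/2 \<longrightarrow> norm (zeta_reg s) \<le> C * (1 + norm s) ^ 2"
proof (intro exI conjI allI impI)
  define C where "C = (\<Sum>n. real (Suc n) powr (- (3/2)))"
  have sm: "summable (\<lambda>n. real (Suc n) powr (- (3/2)))" by (rule summable_Suc_powr) auto
  have "C \<ge> 0" unfolding C_def by (intro suminf_nonneg sm) auto
  thus "1 + C > 0" by simp
  fix s :: complex assume s: "Re s \<ge> 1/2"
  have "norm (\<Sum>n. zeta_rem 1 n s) \<le> (\<Sum>n. norm (pw_coeff 2 s) * real (Suc n) powr (- (3/2)))"
  proof (rule norm_suminf_le)
    show "summable (\<lambda>n. norm (pw_coeff 2 s) * real (Suc n) powr (- (3/2)))"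
      by (intro summable_mult sm)
    show "norm (zeta_rem 1 n s) \<le> norm (pw_coeff 2 s) * real (Suc n) powr (- (3/2))" for n
      by (rule order_trans[OF norm_zeta_rem_le])
         (use s in \<open>auto intro!: mult_left_mono powr_mono simp: numeral_2_eq_2\<close>)
  qed
  also have "\<dots> = norm (pw_coeff 2 s) * C"
    unfolding C_def by (intro suminf_mult sm)
  also have "norm (pw_coeff 2 s) = norm (1 - s) * norm s"
    by (simp add: numeral_2_eq_2 pw_coeff_Suc norm_mult)
  also have "\<dots> \<le> (1 + norm s) * (1 + norm s)"
    using norm_triangle_ineq4[of 1 s] by (intro mult_mono) auto
  finally have *: "norm (\<Sum>n. zeta_rem 1 n s) \<le> (1 + norm s) ^ 2 * C"
    using \<open>C \<ge> 0\<close> by (simp add: power2_eq_square mult_right_mono)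
  have "norm (zeta_reg s) \<le> 1 + (1 + norm s) ^ 2 * C"
    using s * norm_triangle_ineq[of 1 "\<Sum>n. zeta_rem 1 n s"] by (simp add: zeta_reg_eq)
  moreover have "1 \<le> (1 + norm s) ^ 2" by (simp add: power2_eq_square algebra_simps)
  ultimately have "norm (zeta_reg s) \<le> (1 + norm s) ^ 2 + (1 + norm s) ^ 2 * C" by linarith
  thus "norm (zeta_reg s) \<le> (1 + C) * (1 + norm s) ^ 2" by (simp only: distrib_right mult_1 mult.commute)
qed

section \<open>Dirichlet series and non-vanishing on the line Re s = 1\<close>

lemma has_sum_imp_abs_summable_complex:
  fixes f :: "_ \<Rightarrow> complex"
  shows "(f has_sum S) A \<Longrightarrow> f abs_summable_on A"
  using has_sum_imp_summable summable_on_iff_abs_summable_on_complex by blast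

lemma has_sum_times_complex:
  fixes f g :: "_ \<Rightarrow> complex"
  assumes f: "(f has_sum F) A" and g: "(g has_sum G) B"
  shows "((\<lambda>(x, y). f x * g y) has_sum (F * G)) (A \<times> B)"
proof -
  have f': "f abs_summable_on A" and g': "g abs_summable_on B"
    using f g has_sum_imp_abs_summable_complex by blast+
  have "(\<lambda>(x, y). f x * g y) abs_summable_on A \<times> B"
    unfolding Infinite_Sum.abs_summable_on_Sigma_iff
    using f' g' by (auto simp: norm_mult infsum_cmult_right abs_mult
        intro!: summable_on_cmult_right summable_on_cmult_left)
  hence "(\<lambda>(x, y). f x * g y) summable_on A \<times> B"
    by (rule abs_summable_summable)
  thus ?thesis
    by (intro has_sum_SigmaI[where g = "\<lambda>x. f x * G"] has_sum_cmult_left[OF f])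
       (auto intro: has_sum_cmult_right[OF g])
qed

text \<open>Unconditional summability over pairs (d, e) permits regrouping by n = de.\<close>

lemma has_sum_dirichlet_prod:
  fixes f g :: "nat \<Rightarrow> complex"
  assumes f: "((\<lambda>n. f n * of_nat n powr (-s)) has_sum F) {0<..}"
    and g: "((\<lambda>n. g n * of_nat n powr (-s)) has_sum G) {0<..}"
  shows "((\<lambda>n. (\<Sum>d | d dvd n. f d * g (n div d)) * of_nat n powr (-s)) has_sum (F * G)) {0<..}"
proof -
  have "((\<lambda>(d, e). (f d * of_nat d powr (-s)) * (g e * of_nat e powr (-s))) has_sum (F * G)) ({0<..} \<times> {0<..})"
    by (rule has_sum_times_complex[OF f g])
  also have "?this \<longleftrightarrow> ((\<lambda>(n, d). f d * g (n div d) * of_nat n powr (-s)) has_sum (F * G))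
     (SIGMA n:{0<..}. {d. d dvd n})"
  proof (rule has_sum_reindex_bij_witness[where i = "\<lambda>(n, d). (d, n div d)" and j = "\<lambda>(d, e). (d * e, d)"])
    fix x :: "nat \<times> nat" assume "x \<in> {0<..} \<times> {0<..}"
    then obtain d e where x: "x = (d, e)" "d > 0" "e > 0" by auto
    have "of_nat (d * e) powr (-s) = of_nat d powr (-s) * (of_nat e powr (-s) :: complex)"
      using powr_times_real[of "of_nat d" "of_nat e" "-s"] by simp
    thus "(case case x of (d, e) \<Rightarrow> (d * e, d) of (n, d) \<Rightarrow> f d * g (n div d) * of_nat n powr (-s)) =
       (case x of (d, e) \<Rightarrow> (f d * of_nat d powr (-s)) * (g e * of_nat e powr (-s)))"
      using x by simp
  next
    fix x :: "nat \<times> nat" assume "x \<in> (SIGMA n:{0<..}. {d. d dvd n})"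
    then obtain n d where x: "x = (n, d)" "n > 0" "d dvd n" by auto
    thus "(\<lambda>(n, d). (d, n div d)) x \<in> {0<..} \<times> {0<..}"
      by (auto intro: dvd_pos_nat simp: dvd_div_eq_0_iff intro!: Nat.gr0I)
    show "(case case x of (n, d) \<Rightarrow> (d, n div d) of (d, e) \<Rightarrow> (d * e, d)) = x"
      using x by simp
  qed auto
  finally have *: "((\<lambda>(n, d). f d * g (n div d) * of_nat n powr (-s)) has_sum (F * G))
     (SIGMA n:{0<..}. {d. d dvd n})" .
  show ?thesis
  proof (rule has_sum_SigmaD[OF *])
    fix n :: nat assume "n \<in> {0<..}"
    hence "finite {d. d dvd n}" by simp
    thus "((\<lambda>y. case (n, y) of (n, d) \<Rightarrow> f d * g (n div d) * of_nat n powr (-s)) has_sum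
         (\<Sum>d | d dvd n. f d * g (n div d)) * of_nat n powr (-s)) {d. d dvd n}"
      by (intro has_sum_finiteI) (simp_all add: sum_distrib_right)
  qed
qed

lemma has_sum_Suc_iff:
  "((\<lambda>n. f (Suc n)) has_sum S) UNIV \<longleftrightarrow> (f has_sum S) {0<..}"
  by (rule has_sum_reindex_bij_witness[of _ "\<lambda>n. n - 1" Suc]) auto

lemma zeta_has_sum:
  assumes "Re s > 1"
  shows "((\<lambda>n. of_nat n powr (-s)) has_sum zeta s) {0<..}"
  unfolding has_sum_Suc_iff [symmetric]
  by (rule norm_summable_imp_has_sum)
     (use summable_Suc_powr[of "Re s"] zeta_sums[OF assms] assms in \<open>simp_all add: norm_powr_real_powr\<close>)

section \<open>The Moebius function and the series of 1/zeta\<close>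

definition moebius_mu :: "nat \<Rightarrow> real" where
  "moebius_mu n = (if squarefree n then (-1) ^ card (prime_factors n) else 0)"

lemma abs_moebius_mu_le: "\<bar>moebius_mu n\<bar> \<le> 1"
  by (simp add: moebius_mu_def)

text \<open>Only squarefree divisors contribute; they correspond to the subsets of the set P of
  primes dividing n, so the sum is the expansion of the product of -1 + 1 over P.\<close>

lemma sum_moebius_mu:
  assumes "n > 0"
  shows "(\<Sum>d | d dvd n. moebius_mu d) = (if n = 1 then 1 else 0)"
proof -
  define P where "P = prime_factors n"
  have P: "finite P" "\<And>p. p \<in> P \<Longrightarrow> prime p" by (auto simp: P_def)
  have mult: "multiplicity p (\<Prod>S) = (if p \<in> S then 1 else 0)" if "S \<subseteq> P" "prime p" for S p
  proof -
    have "multiplicity p (\<Prod>q\<in>S. q ^ 1) = (if p \<in> S then 1 else 0)"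
      by (rule multiplicity_prod_prime_powers) (use that P finite_subset[of S P] in auto)
    thus ?thesis by simp
  qed
  have pos: "\<Prod>S > 0" if "S \<subseteq> P" for S
    using that P(2) by (intro prod_pos) (auto dest!: subsetD intro: prime_gt_0_nat)
  have pf: "prime_factors (\<Prod>S) = S" if "S \<subseteq> P" for S
    using that P(2) mult[OF that] pos[OF that]
    by (auto simp: prime_factors_multiplicity split: if_splits)
  have sqf: "squarefree (\<Prod>S)" if "S \<subseteq> P" for S
    using mult[OF that] pos[OF that] by (subst squarefree_factorial_semiring'') auto
  have "(\<Sum>d | d dvd n. moebius_mu d) = (\<Sum>d | d dvd n \<and> squarefree d. (-1) ^ card (prime_factors d))"
    using assms by (intro sum.mono_neutral_cong_right) (auto simp: moebius_mu_def)
  also have "\<dots> = (\<Sum>S\<in>Pow P. (-1) ^ card S)"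
  proof (rule sum.reindex_bij_witness[of _ "\<lambda>S. \<Prod>S" prime_factors])
    fix d assume d: "d \<in> {d. d dvd n \<and> squarefree d}"
    hence d0: "d > 0" using assms by (auto intro: Nat.gr0I)
    show "prime_factors d \<in> Pow P"
      using d assms unfolding P_def by (auto dest: dvd_prime_factors[rotated])
    have "d = (\<Prod>p\<in>prime_factors d. p ^ multiplicity p d)"
      using d0 by (intro prime_factorization_nat) auto
    also have "\<dots> = \<Prod>(prime_factors d)"
      using d d0 by (intro prod.cong) (auto simp: squarefree_factorial_semiring')
    finally show "\<Prod>(prime_factors d) = d" by simp
  next
    fix S assume S: "S \<in> Pow P"
    have "\<Prod>S dvd n"
    proof (rule multiplicity_le_imp_dvd)
      show "\<Prod>S \<noteq> 0" using pos[of S] S by auto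
      fix p :: nat assume p: "prime p"
      show "multiplicity p (\<Prod>S) \<le> multiplicity p n"
        using mult[OF _ p, of S] S by (auto simp: P_def prime_factors_multiplicity)
    qed
    thus "\<Prod>S \<in> {d. d dvd n \<and> squarefree d}" using sqf S by auto
  qed (auto simp: pf)
  also have "\<dots> = (\<Prod>p\<in>P. (-1) + 1)"
    by (subst prod_add[OF P(1)]) simp
  also have "\<dots> = (if n = 1 then 1 else 0)"
    using P(1) assms by (auto simp: P_def prime_factorization_empty_iff card_gt_0_iff)
  finally show ?thesis .
qed

lemma summable_on_powr_pos:
  assumes "x > 1"
  shows "(\<lambda>n. real n powr (-x)) summable_on {0<..}"
proof -
  have "(\<lambda>n. of_nat n powr (- of_real x) :: complex) abs_summable_on {0<..}"
    by (rule has_sum_imp_abs_summable_complex[OF zeta_has_sum[of "of_real x"]]) (use assms in auto)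
  thus ?thesis
    by (rule summable_on_cong[THEN iffD1, rotated]) (simp add: norm_nat_powr)
qed

lemma moebius_mu_summable:
  assumes "Re s > 1"
  shows "(\<lambda>n. of_real (moebius_mu n) * of_nat n powr (-s)) summable_on (A \<inter> {0<..})"
proof -
  have "(\<lambda>n. of_real (moebius_mu n) * of_nat n powr (-s)) abs_summable_on {0<..}"
    by (rule Infinite_Sum.abs_summable_on_comparison_test'[OF summable_on_powr_pos[OF assms]])
       (auto simp: norm_mult norm_nat_powr intro!: mult_left_le_one_le abs_moebius_mu_le)
  from abs_summable_summable[OF this] show ?thesis
    by (rule summable_on_subset_banach) auto
qed

text \<open>By \<open>sum_moebius_mu\<close> the product of the Moebius series and the zeta series
  is 1, which gives the nonvanishing and the value at once.\<close>

lemma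
  assumes "Re s > 1"
  shows zeta_nonzero_gt_1: "zeta s \<noteq> 0"
    and moebius_mu_has_sum:
      "((\<lambda>n. of_real (moebius_mu n) * of_nat n powr (-s)) has_sum (1 / zeta s)) {0<..}"
proof -
  obtain M where M: "((\<lambda>n. of_real (moebius_mu n) * of_nat n powr (-s)) has_sum M) {0<..}"
    using moebius_mu_summable[OF assms, of UNIV] by (auto simp: summable_on_def)
  have "((\<lambda>n. (\<Sum>d | d dvd n. of_real (moebius_mu d) * 1) * of_nat n powr (-s)) has_sum (M * zeta s)) {0<..}"
    by (rule has_sum_dirichlet_prod) (use M zeta_has_sum[OF assms] in simp_all)
  also have "?this \<longleftrightarrow> ((\<lambda>n::nat. if n = 1 then 1 else 0) has_sum (M * zeta s)) {0<..}"
    by (rule has_sum_cong) (auto simp: sum_moebius_mu simp flip: of_real_sum)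
  finally have "((\<lambda>n::nat. if n = 1 then 1 else 0) has_sum (M * zeta s)) {0<..}" .
  moreover have "((\<lambda>n::nat. if n = 1 then 1 else 0 :: complex) has_sum 1) {0<..}"
    by (rule has_sum_finite_neutralI[of "{1}"]) auto
  ultimately have eq: "M * zeta s = 1" by (rule has_sum_unique)
  thus nz: "zeta s \<noteq> 0" by auto
  hence "M = 1 / zeta s" using eq by (simp add: field_simps)
  thus "((\<lambda>n. of_real (moebius_mu n) * of_nat n powr (-s)) has_sum (1 / zeta s)) {0<..}"
    using M by simp
qed

section \<open>The logarithmic derivative of zeta\<close>

lemma deriv_zeta_sums:
  assumes "Re s > 1"
  shows "(\<lambda>n. of_real (ln (real (Suc n))) * of_nat (Suc n) powr (-s)) sums (- deriv zeta s)"
proof -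
  have "\<exists>g'. \<forall>x\<in>re_gt 1. (zeta has_field_derivative g' x) (at x) \<and>
     (\<lambda>N. \<Sum>n<N. - of_real (ln (real (Suc n))) * of_nat (Suc n) powr (-x)) \<longlonglongrightarrow> g' x"
  proof (rule has_complex_derivative_uniform_sequence[where f = "\<lambda>N x. \<Sum>n<N. of_nat (Suc n) powr (-x)"])
    show "((\<lambda>x. \<Sum>n<N. of_nat (Suc n) powr (-x)) has_field_derivative
       (\<Sum>n<N. - of_real (ln (real (Suc n))) * of_nat (Suc n) powr (-x))) (at x)" for N and x :: complex
    proof (rule DERIV_sum)
      fix n
      have "((\<lambda>x. exp (-x * of_real (ln (real (Suc n))))) has_field_derivative
         - of_real (ln (real (Suc n))) * exp (-x * of_real (ln (real (Suc n))))) (at x)"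
        by (auto intro!: derivative_eq_intros)
      moreover have "of_nat (Suc n) powr (-x) = exp (-x * of_real (ln (real (Suc n))))" for x :: complex
      proof -
        have "Ln (of_nat (Suc n)) = of_real (ln (real (Suc n)))"
          by (metis Ln_of_real of_nat_0_less_iff of_real_of_nat_eq zero_less_Suc)
        thus ?thesis by (simp add: powr_def del: of_nat_Suc)
      qed
      ultimately show "((\<lambda>x. of_nat (Suc n) powr (-x)) has_field_derivative
          - of_real (ln (real (Suc n))) * of_nat (Suc n) powr (-x)) (at x)" by (simp only:)
    qed
  next
    fix x :: complex assume x: "x \<in> re_gt 1"
    define d where "d = (Re x - 1) / 2"
    have d: "d > 0" using x by (simp add: d_def)
    have re: "Re w \<ge> 1 + d" if "w \<in> cball x d" for w
    proof -
      have "Re (x - w) \<le> d"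
        using that complex_Re_le_cmod[of "x - w"] by (simp add: dist_norm)
      moreover have "1 + d = Re x - d" by (simp add: d_def field_simps)
      ultimately show ?thesis by simp
    qed
    have "uniform_limit (cball x d) (\<lambda>N w. \<Sum>n<N. of_nat (Suc n) powr (-w)) (\<lambda>w. \<Sum>n. of_nat (Suc n) powr (-w)) sequentially"
    proof (rule Weierstrass_m_test)
      show "norm (of_nat (Suc n) powr (-w)) \<le> real (Suc n) powr (-(1+d))" if "w \<in> cball x d" for n w
        using re[OF that] by (simp add: norm_nat_powr powr_mono del: of_nat_Suc)
      show "summable (\<lambda>n. real (Suc n) powr (-(1+d)))"
        using d by (intro summable_Suc_powr) auto
    qed
    also have "?this \<longleftrightarrow> uniform_limit (cball x d) (\<lambda>N w. \<Sum>n<N. of_nat (Suc n) powr (-w)) zeta sequentially"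
    proof (rule uniform_limit_cong')
      fix w assume "w \<in> cball x d"
      hence "Re w > 1" using re d by fastforce
      thus "(\<Sum>n. of_nat (Suc n) powr (-w)) = zeta w"
        using zeta_sums[of w] by (simp add: sums_iff)
    qed auto
    finally show "\<exists>d>0. cball x d \<subseteq> re_gt 1 \<and>
       uniform_limit (cball x d) (\<lambda>N w. \<Sum>n<N. of_nat (Suc n) powr (-w)) zeta sequentially"
      using d re by fastforce
  qed (rule open_re_gt)
  then obtain g' where g': "(zeta has_field_derivative g') (at s)"
     "(\<lambda>N. \<Sum>n<N. - of_real (ln (real (Suc n))) * of_nat (Suc n) powr (-s)) \<longlonglongrightarrow> g'"
    using assms by blast
  hence "(\<lambda>n. - of_real (ln (real (Suc n))) * of_nat (Suc n) powr (-s)) sums deriv zeta s"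
    by (simp add: sums_def DERIV_imp_deriv)
  from sums_minus[OF this] show ?thesis by simp
qed

text \<open>At the real point Re s the terms are the norms of the terms at s; convergence there
  therefore gives absolute convergence at s.\<close>

lemma deriv_zeta_has_sum:
  assumes "Re s > 1"
  shows "((\<lambda>n. of_real (ln (real n)) * of_nat n powr (-s)) has_sum (- deriv zeta s)) {0<..}"
proof -
  have "summable (\<lambda>n. of_real (ln (real (Suc n))) * of_nat (Suc n) powr (- of_real (Re s)) :: complex)"
    using deriv_zeta_sums[of "of_real (Re s)"] assms by (auto simp: sums_iff)
  from summable_Re[OF this]
  have "summable (\<lambda>n. ln (real (Suc n)) * Re (of_nat (Suc n) powr (- of_real (Re s))))" by simp
  also have "(\<lambda>n. ln (real (Suc n)) * Re (of_nat (Suc n) powr (- of_real (Re s)))) =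
     (\<lambda>n. norm (of_real (ln (real (Suc n))) * of_nat (Suc n) powr (-s)))"
  proof
    fix n
    have "of_nat (Suc n) powr (- of_real (Re s)) = complex_of_real (real (Suc n) powr (- Re s))"
      by (metis of_nat_0_le_iff of_real_minus of_real_of_nat_eq powr_of_real)
    thus "ln (real (Suc n)) * Re (of_nat (Suc n) powr (- of_real (Re s))) =
      norm (of_real (ln (real (Suc n))) * of_nat (Suc n) powr (-s))"
      by (simp add: norm_mult norm_nat_powr del: of_nat_Suc)
  qed
  finally show ?thesis
    unfolding has_sum_Suc_iff [symmetric]
    by (intro norm_summable_imp_has_sum deriv_zeta_sums assms)
qed

text \<open>The convolution of the Mangoldt function with 1 is ln, so this series times zeta is the
  series of -zeta'. Absolute convergence is inherited from the series with ln.\<close>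

lemma mangoldt_has_sum:
  assumes "Re s > 1"
  shows "((\<lambda>n. mangoldt n * of_nat n powr (-s)) has_sum (- deriv zeta s / zeta s)) {0<..}"
proof -
  have "(\<lambda>n. of_real (ln (real n)) * of_nat n powr (-s)) abs_summable_on {0<..}"
    by (rule has_sum_imp_abs_summable_complex[OF deriv_zeta_has_sum[OF assms]])
  hence "(\<lambda>n. mangoldt n * of_nat n powr (-s)) abs_summable_on {0<..}"
  proof (rule Infinite_Sum.abs_summable_on_comparison_test')
    fix n :: nat assume n: "n \<in> {0<..}"
    have "norm (mangoldt n * of_nat n powr (-s)) = mangoldt n * norm (of_nat n powr (-s))"
      by (simp add: norm_mult)
    also have "\<dots> \<le> ln (real n) * norm (of_nat n powr (-s))"
      using n mangoldt_le[of n] by (intro mult_right_mono) auto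
    also have "\<dots> = norm (of_real (ln (real n)) * of_nat n powr (-s))"
      using n by (simp add: norm_mult)
    finally show "norm (mangoldt n * of_nat n powr (-s)) \<le> norm (of_real (ln (real n)) * of_nat n powr (-s))" .
  qed
  hence "(\<lambda>n. mangoldt n * of_nat n powr (-s)) summable_on {0<..}"
    by (rule abs_summable_summable)
  then obtain M where M: "((\<lambda>n. mangoldt n * of_nat n powr (-s)) has_sum M) {0<..}"
    unfolding summable_on_def by blast
  have "((\<lambda>n. (\<Sum>d | d dvd n. mangoldt d * 1) * of_nat n powr (-s)) has_sum (M * zeta s)) {0<..}"
    by (rule has_sum_dirichlet_prod) (use M zeta_has_sum[OF assms] in simp_all)
  also have "?this \<longleftrightarrow> ((\<lambda>n. of_real (ln (real n)) * of_nat n powr (-s)) has_sum (M * zeta s)) {0<..}"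
    by (rule has_sum_cong) (auto simp: mangoldt_sum)
  finally have "M * zeta s = - deriv zeta s"
    using deriv_zeta_has_sum[OF assms] has_sum_unique by blast
  hence "M = - deriv zeta s / zeta s"
    using zeta_nonzero_gt_1[OF assms] by (simp add: field_simps)
  thus ?thesis using M by simp
qed

text \<open>Here k is the order of the zero of f at z: near z, f is (s - z)^k times a nonvanishing
  factor. The point w ensures that f is not identically zero.\<close>

lemma tendsto_mult_log_deriv:
  assumes f: "f holomorphic_on UNIV" and w: "f w \<noteq> 0"
  obtains k :: nat where "((\<lambda>s. (s - z) * (deriv f s / f s)) \<longlongrightarrow> of_nat k) (at z)" "f z = 0 \<Longrightarrow> k > 0"
proof (cases "f z = 0")
  case False
  have "isCont f z" "isCont (deriv f) z"
    using holomorphic_on_imp_continuous_on[OF f]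
      holomorphic_on_imp_continuous_on[OF holomorphic_deriv[OF f open_UNIV]]
    by (simp_all add: continuous_on_eq_continuous_at)
  hence "((\<lambda>s. (s - z) * (deriv f s / f s)) \<longlongrightarrow> (z - z) * (deriv f z / f z)) (at z)"
    using False by (intro tendsto_intros) (auto simp: isCont_def)
  with that[of 0] False show ?thesis by simp
next
  case True
  have "\<not> f constant_on UNIV" using True w by (metis UNIV_I constant_on_def)
  then obtain g r n where g: "0 < n" "0 < r" "g holomorphic_on ball z r"
    "\<And>s. s \<in> ball z r \<Longrightarrow> f s = (s - z) ^ n * g s" "\<And>s. s \<in> ball z r \<Longrightarrow> g s \<noteq> 0"
    using holomorphic_factor_zero_nonconstant[OF f open_UNIV connected_UNIV UNIV_I True] by metis
  have "((\<lambda>s. of_nat n + (s - z) * (deriv g s / g s)) \<longlongrightarrow> of_nat n + (z - z) * (deriv g z / g z)) (at z)"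
  proof (intro tendsto_intros)
    have "isCont g z" "isCont (deriv g) z"
      using holomorphic_on_imp_continuous_on[OF g(3)] g(2)
        holomorphic_on_imp_continuous_on[OF holomorphic_deriv[OF g(3) open_ball]]
      by (simp_all add: continuous_on_eq_continuous_at)
    thus "g \<midarrow>z\<rightarrow> g z" "deriv g \<midarrow>z\<rightarrow> deriv g z" by (auto simp: isCont_def)
  qed (use g in auto)
  moreover have "eventually (\<lambda>s. of_nat n + (s - z) * (deriv g s / g s) = (s - z) * (deriv f s / f s)) (at z)"
  proof -
    have "eventually (\<lambda>s. s \<in> ball z r - {z}) (at z)"
      by (rule eventually_at_in_open) (use g(2) in auto)
    thus ?thesis
    proof eventually_elim
      case (elim s)
      have "(g has_field_derivative deriv g s) (at s)"
        using elim g(3) by (intro holomorphic_derivI[of _ "ball z r"]) auto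
      hence "((\<lambda>s. (s - z) ^ n * g s) has_field_derivative
          of_nat n * (s - z) ^ (n - 1) * g s + deriv g s * (s - z) ^ n) (at s)"
        by (auto intro!: derivative_eq_intros)
      hence "(f has_field_derivative of_nat n * (s - z) ^ (n - 1) * g s + deriv g s * (s - z) ^ n) (at s)"
        by (rule has_field_derivative_transform_within_open[where S = "ball z r"])
           (use elim in \<open>auto simp: g(4)\<close>)
      hence d: "deriv f s = of_nat n * (s - z) ^ (n - 1) * g s + deriv g s * (s - z) ^ n"
        by (rule DERIV_imp_deriv)
      obtain m where m: "n = Suc m" using g(1) by (cases n) auto
      have nz: "s - z \<noteq> 0" "g s \<noteq> 0" and fs: "f s = (s - z) ^ n * g s" using elim g by auto
      show ?case unfolding d fs m using nz by (simp add: field_simps)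
    qed
  qed
  ultimately have "((\<lambda>s. (s - z) * (deriv f s / f s)) \<longlongrightarrow> of_nat n + (z - z) * (deriv g z / g z)) (at z)"
    by (rule Lim_transform_eventually)
  hence "((\<lambda>s. (s - z) * (deriv f s / f s)) \<longlongrightarrow> of_nat n) (at z)" by simp
  with that[of n] g show ?thesis by simp
qed

lemma log_deriv_zeta:
  assumes "Re s > 1"
  shows "- deriv zeta s / zeta s = 1 / (s - 1) - deriv zeta_reg s / zeta_reg s"
proof -
  have s1: "s \<noteq> 1" using assms by auto
  have "(zeta has_field_derivative deriv zeta s) (at s)"
    using s1 by (intro holomorphic_derivI[OF holomorphic_zeta]) auto
  hence "((\<lambda>s. (s - 1) * zeta s) has_field_derivative (zeta s + (s - 1) * deriv zeta s)) (at s)"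
    by (auto intro!: derivative_eq_intros)
  hence "(zeta_reg has_field_derivative (zeta s + (s - 1) * deriv zeta s)) (at s)"
    by (rule has_field_derivative_transform_within_open[where S = "- {1}"])
       (use s1 in \<open>auto simp: zeta_reg_def\<close>)
  hence "deriv zeta_reg s = zeta s + (s - 1) * deriv zeta s" by (rule DERIV_imp_deriv)
  hence "deriv zeta_reg s / zeta_reg s = 1 / (s - 1) + deriv zeta s / zeta s"
    using s1 zeta_nonzero_gt_1[OF assms] by (simp add: zeta_reg_def add_divide_distrib)
  thus ?thesis by simp
qed

text \<open>The Mangoldt function is nonnegative and 3 + 4 cos y + cos 2y = 2 (1 + cos y)^2.\<close>

lemma three_four_one:
  assumes "x > 1"
  shows "0 \<le> 3 * Re (- deriv zeta (of_real x) / zeta (of_real x))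
     + 4 * Re (- deriv zeta (Complex x t) / zeta (Complex x t))
     + Re (- deriv zeta (Complex x (2 * t)) / zeta (Complex x (2 * t)))"
proof -
  have re: "Re (mangoldt n * of_nat n powr (- Complex x u)) = mangoldt n * real n powr (-x) * cos (u * ln (real n))"
    if n: "n > 0" for n u
  proof -
    have "Ln (of_nat n) = of_real (ln (real n))"
      using n by (metis Ln_of_real of_nat_0_less_iff of_real_of_nat_eq)
    hence "of_nat n powr (- Complex x u) = exp (- Complex x u * of_real (ln (real n)))"
      using n by (simp add: powr_def)
    hence "Re (of_nat n powr (- Complex x u)) = real n powr (-x) * cos (u * ln (real n))"
      using n by (simp add: Re_exp powr_def)
    moreover have "mangoldt n = complex_of_real (mangoldt n)" by simp
    ultimately show ?thesis by (metis Re_complex_of_real mult.assoc times_complex.sel(1) Im_complex_of_real mult_zero_left diff_zero)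
  qed
  have hs: "((\<lambda>n. mangoldt n * real n powr (-x) * cos (u * ln (real n))) has_sum
      Re (- deriv zeta (Complex x u) / zeta (Complex x u))) {0<..}" for u
  proof -
    have "((\<lambda>n. Re (mangoldt n * of_nat n powr (- Complex x u))) has_sum
      Re (- deriv zeta (Complex x u) / zeta (Complex x u))) {0<..}"
      by (intro has_sum_Re mangoldt_has_sum) (use assms in auto)
    also have "?this \<longleftrightarrow> ?thesis" by (intro has_sum_cong re) auto
    finally show ?thesis .
  qed
  have "((\<lambda>n. 3 * (mangoldt n * real n powr (-x) * cos (0 * ln (real n)))
     + 4 * (mangoldt n * real n powr (-x) * cos (t * ln (real n)))
     + mangoldt n * real n powr (-x) * cos (2 * t * ln (real n))) has_sum
     (3 * Re (- deriv zeta (Complex x 0) / zeta (Complex x 0))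
     + 4 * Re (- deriv zeta (Complex x t) / zeta (Complex x t))
     + Re (- deriv zeta (Complex x (2 * t)) / zeta (Complex x (2 * t))))) {0<..}"
    by (intro has_sum_add has_sum_cmult_right hs)
  moreover have "0 \<le> 3 * (mangoldt n * real n powr (-x) * cos (0 * ln (real n)))
     + 4 * (mangoldt n * real n powr (-x) * cos (t * ln (real n)))
     + mangoldt n * real n powr (-x) * cos (2 * t * ln (real n))" for n
  proof -
    define c where "c = cos (t * ln (real n))"
    have dc: "cos (2 * t * ln (real n)) = 2 * c ^ 2 - 1"
      using cos_double_cos[of "t * ln (real n)"] by (simp add: c_def mult.assoc)
    have "3 * (mangoldt n * real n powr (-x) * cos (0 * ln (real n)))
     + 4 * (mangoldt n * real n powr (-x) * cos (t * ln (real n)))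
     + mangoldt n * real n powr (-x) * cos (2 * t * ln (real n)) =
       mangoldt n * real n powr (-x) * (2 * (1 + c) ^ 2)"
      unfolding dc c_def [symmetric] by (simp add: algebra_simps power2_eq_square)
    thus ?thesis by (simp add: mangoldt_nonneg)
  qed
  ultimately have "0 \<le> 3 * Re (- deriv zeta (Complex x 0) / zeta (Complex x 0))
     + 4 * Re (- deriv zeta (Complex x t) / zeta (Complex x t))
     + Re (- deriv zeta (Complex x (2 * t)) / zeta (Complex x (2 * t)))"
    by (rule has_sum_nonneg) 
  thus ?thesis by (simp add: Complex_eq)
qed

text \<open>\<open>Riemann_Hypothesis\<close> says nothing about the line Re s = 1. If 1 + it were a
  zero of order k \<ge> 1, multiplying \<open>three_four_one\<close> by x - 1 and letting x tend to
  1 from the right would give 3(1 - k0) - 4k - j \<ge> 0 with natural numbers k0 and j, which is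
  impossible.\<close>

lemma zeta_reg_nonzero_1:
  "zeta_reg (Complex 1 t) \<noteq> 0"
proof
  assume zero: "zeta_reg (Complex 1 t) = 0"
  hence t: "t \<noteq> 0" by (auto simp: Complex_eq)
  have nz: "zeta_reg 1 \<noteq> 0" by simp
  obtain k0 where k0: "((\<lambda>s. (s - 1) * (deriv zeta_reg s / zeta_reg s)) \<longlongrightarrow> of_nat k0) (at 1)"
    using tendsto_mult_log_deriv[OF holomorphic_zeta_reg nz] by metis
  obtain k where k: "((\<lambda>s. (s - Complex 1 t) * (deriv zeta_reg s / zeta_reg s)) \<longlongrightarrow> of_nat k) (at (Complex 1 t))" "k > 0"
    using tendsto_mult_log_deriv[OF holomorphic_zeta_reg nz] zero by metis
  obtain j where j: "((\<lambda>s. (s - Complex 1 (2*t)) * (deriv zeta_reg s / zeta_reg s)) \<longlongrightarrow> of_nat j) (at (Complex 1 (2*t)))"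
    using tendsto_mult_log_deriv[OF holomorphic_zeta_reg nz] by metis
  have fl: "filterlim (\<lambda>x. Complex x u) (at (Complex 1 u)) (at_right 1)" for u
  proof -
    have "((\<lambda>x. Complex x u) \<longlongrightarrow> Complex 1 u) (at_right 1)"
      unfolding Complex_eq by (intro tendsto_intros)
    thus ?thesis
      by (auto simp: filterlim_at eventually_at_filter intro!: eventually_at_right_less[THEN eventually_mono])
  qed
  \<comment> \<open>-zeta'/zeta has residue 1 at s = 1, which is the contribution for u = 0, and a
    zero of \<open>zeta_reg\<close> of order m contributes -m.\<close>
  have lim: "((\<lambda>x. (x - 1) * Re (- deriv zeta (Complex x u) / zeta (Complex x u))) \<longlongrightarrow> (if u = 0 then 1 else 0) - real m) (at_right 1)"
    if m: "((\<lambda>s. (s - Complex 1 u) * (deriv zeta_reg s / zeta_reg s)) \<longlongrightarrow> of_nat m) (at (Complex 1 u))" for u m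
  proof -
    have 1: "((\<lambda>x. (Complex x u - Complex 1 u) * (deriv zeta_reg (Complex x u) / zeta_reg (Complex x u))) \<longlongrightarrow> of_nat m) (at_right 1)"
      using filterlim_compose[OF m fl] .
    have 2: "((\<lambda>x. (Complex x u - Complex 1 u) / (Complex x u - 1)) \<longlongrightarrow> (if u = 0 then 1 else 0)) (at_right 1)"
    proof (cases "u = 0")
      case True
      have "eventually (\<lambda>x. (Complex x u - Complex 1 u) / (Complex x u - 1) = 1) (at_right 1)"
        using eventually_at_right_less[of "1::real"]
        by eventually_elim (use True in \<open>auto simp: Complex_eq\<close>)
      thus ?thesis using True by (simp add: tendsto_eventually)
    next
      case False
      have "((\<lambda>x. (Complex x u - Complex 1 u) / (Complex x u - 1)) \<longlongrightarrow> (Complex 1 u - Complex 1 u) / (Complex 1 u - 1)) (at_right 1)"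
        unfolding Complex_eq by (intro tendsto_intros) (use False in auto)
      thus ?thesis using False by simp
    qed
    have "((\<lambda>x. Re ((Complex x u - Complex 1 u) / (Complex x u - 1) - (Complex x u - Complex 1 u) * (deriv zeta_reg (Complex x u) / zeta_reg (Complex x u))))
      \<longlongrightarrow> Re ((if u = 0 then 1 else 0) - of_nat m)) (at_right 1)"
      by (intro tendsto_Re tendsto_diff 1 2)
    moreover have "eventually (\<lambda>x. Re ((Complex x u - Complex 1 u) / (Complex x u - 1) - (Complex x u - Complex 1 u) * (deriv zeta_reg (Complex x u) / zeta_reg (Complex x u)))
       = (x - 1) * Re (- deriv zeta (Complex x u) / zeta (Complex x u))) (at_right 1)"
      using eventually_at_right_less[of "1::real"]
    proof eventually_elim
      case (elim x)
      have e: "Complex x u - Complex 1 u = of_real (x - 1)" by (simp add: complex_eq_iff)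
      have "(Complex x u - Complex 1 u) / (Complex x u - 1) - (Complex x u - Complex 1 u) * (deriv zeta_reg (Complex x u) / zeta_reg (Complex x u))
        = of_real (x - 1) * (- deriv zeta (Complex x u) / zeta (Complex x u))"
        unfolding e using elim by (subst log_deriv_zeta) (auto simp: algebra_simps)
      thus ?case by (simp only: scaleR_conv_of_real [symmetric] scaleR_complex.simps)
    qed
    ultimately show ?thesis by (auto intro: Lim_transform_eventually)
  qed
  have "((\<lambda>x. 3 * ((x - 1) * Re (- deriv zeta (Complex x 0) / zeta (Complex x 0)))
     + 4 * ((x - 1) * Re (- deriv zeta (Complex x t) / zeta (Complex x t)))
     + (x - 1) * Re (- deriv zeta (Complex x (2 * t)) / zeta (Complex x (2 * t)))) \<longlongrightarrow>
     3 * ((if (0::real) = 0 then 1 else 0) - real k0) + 4 * ((if t = 0 then 1 else 0) - real k)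
     + ((if 2 * t = 0 then 1 else 0) - real j)) (at_right 1)"
    using k0 by (intro tendsto_intros lim k(1) j) (simp add: Complex_eq)
  moreover have "eventually (\<lambda>x. 0 \<le> 3 * ((x - 1) * Re (- deriv zeta (Complex x 0) / zeta (Complex x 0)))
     + 4 * ((x - 1) * Re (- deriv zeta (Complex x t) / zeta (Complex x t)))
     + (x - 1) * Re (- deriv zeta (Complex x (2 * t)) / zeta (Complex x (2 * t)))) (at_right 1)"
    using eventually_at_right_less[of "1::real"]
  proof eventually_elim
    case (elim x)
    have "0 \<le> (x - 1) * (3 * Re (- deriv zeta (of_real x) / zeta (of_real x))
     + 4 * Re (- deriv zeta (Complex x t) / zeta (Complex x t))
     + Re (- deriv zeta (Complex x (2 * t)) / zeta (Complex x (2 * t))))"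
      using elim three_four_one[of x t] by (intro mult_nonneg_nonneg) auto
    moreover have "complex_of_real x = Complex x 0" by (simp add: Complex_eq)
    ultimately show ?case by (simp only: distrib_left mult.left_commute)
  qed
  ultimately have "0 \<le> 3 * ((if (0::real) = 0 then 1 else 0) - real k0) + 4 * ((if t = 0 then 1 else 0) - real k)
     + ((if 2 * t = 0 then 1 else 0) - real j)"
    by (intro tendsto_lowerbound) auto
  thus False using t k(2) by auto
qed

lemma zeta_reg_nonzero:
  assumes "Riemann_Hypothesis" "Re s > 1 / 2"
  shows "zeta_reg s \<noteq> 0"
proof -
  consider "Re s > 1" | "Re s = 1" | "Re s < 1" by linarith
  thus ?thesis
  proof cases
    case 1
    thus ?thesis using zeta_nonzero_gt_1[of s] by (auto simp: zeta_reg_def)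
  next
    case 2
    thus ?thesis using zeta_reg_nonzero_1[of "Im s"] by (metis complex_surj)
  next
    case 3
    moreover have "Re s > 0" "Re s \<noteq> 1 / 2" using assms(2) by auto
    ultimately have "zeta s \<noteq> 0"
      using assms(1) unfolding Riemann_Hypothesis_def by blast
    thus ?thesis by (auto simp: zeta_reg_def)
  qed
qed

section \<open>Bounds for zeta under the Riemann hypothesis\<close>

text \<open>The map w -> w / (2A - w) sends the half-plane Re w < A into the unit disc and fixes 0,
  so Schwarz's lemma applies to its composition with the rescaled f. Solving |g| \<le> |u| |2A - g|
  for |g| gives the bound.\<close>

lemma Borel_Caratheodory:
  assumes f: "f holomorphic_on ball z0 R" and f0: "f z0 = 0"
    and A: "\<And>z. z \<in> ball z0 R \<Longrightarrow> Re (f z) < A"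
    and r: "0 \<le> r" "r < R" and z: "z \<in> cball z0 r"
  shows "norm (f z) \<le> 2 * A * r / (R - r)"
proof -
  have R: "R > 0" using r by linarith
  have A0: "A > 0" using A[of z0] R f0 by simp
  define g where "g = (\<lambda>u. f (z0 + of_real R * u))"
  have in_ball: "z0 + of_real R * u \<in> ball z0 R" if "u \<in> ball 0 1" for u
    using that R by (simp add: dist_norm norm_mult)
  have hg: "g holomorphic_on ball 0 1"
    unfolding g_def
    by (rule holomorphic_on_compose_gen[OF _ f, unfolded o_def])
       (use in_ball in \<open>auto intro!: holomorphic_intros\<close>)
  have Reg: "Re (g u) < A" if "u \<in> ball 0 1" for u
    using A in_ball[OF that] by (simp add: g_def)
  have nz: "2 * of_real A - g u \<noteq> 0" if "u \<in> ball 0 1" for u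
  proof
    assume "2 * of_real A - g u = 0"
    hence "Re (g u) = 2 * A" by (simp add: complex_eq_iff)
    with Reg[OF that] A0 show False by simp
  qed
  have less: "norm (g u) < norm (2 * of_real A - g u)" if "u \<in> ball 0 1" for u
  proof -
    have "A * Re (g u) < A * A" using Reg[OF that] A0 by simp
    moreover have "norm (2 * of_real A - g u) ^ 2 = (2 * A - Re (g u)) ^ 2 + Im (g u) ^ 2"
      unfolding cmod_power2 by simp
    moreover have "norm (g u) ^ 2 = Re (g u) ^ 2 + Im (g u) ^ 2" by (rule cmod_power2)
    moreover have "A * A > 0" using A0 by simp
    ultimately have "norm (g u) ^ 2 < norm (2 * of_real A - g u) ^ 2"
      by (simp add: power2_eq_square algebra_simps)
    thus ?thesis by (rule power2_less_imp_less) simp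
  qed
  define u where "u = (z - z0) / of_real R"
  define \<rho> where "\<rho> = norm (z - z0)"
  have \<rho>: "0 \<le> \<rho>" "\<rho> \<le> r" using z by (auto simp: \<rho>_def dist_norm norm_minus_commute)
  have nu: "norm u = \<rho> / R" using R by (simp add: u_def \<rho>_def norm_divide)
  have u1: "norm u < 1" using \<rho> r R by (simp add: nu)
  have "norm (g u / (2 * of_real A - g u)) \<le> norm u"
  proof (rule Schwarz_Lemma(1))
    show "(\<lambda>u. g u / (2 * of_real A - g u)) holomorphic_on ball 0 1"
      by (intro holomorphic_intros hg nz)
    show "g 0 / (2 * of_real A - g 0) = 0" using f0 by (simp add: g_def)
    show "norm (g u / (2 * of_real A - g u)) < 1" if "norm u < 1" for u
      using less[of u] nz[of u] that by (simp add: norm_divide)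
  qed (fact u1)
  hence "norm (g u) \<le> \<rho> / R * norm (2 * of_real A - g u)"
    using nz[of u] u1 by (simp add: norm_divide divide_le_eq nu)
  also have "\<dots> \<le> \<rho> / R * (2 * A + norm (g u))"
    using \<rho> R A0 norm_triangle_ineq4[of "2 * of_real A" "g u"] by (intro mult_left_mono) (auto simp: norm_mult)
  finally have "norm (g u) * (R - \<rho>) \<le> 2 * A * \<rho>"
    using R by (simp add: field_simps)
  moreover have "g u = f z" using R by (simp add: g_def u_def)
  ultimately have "norm (f z) \<le> 2 * A * \<rho> / (R - \<rho>)"
    using \<rho> r by (simp add: le_divide_eq)
  also have "\<dots> \<le> 2 * A * r / (R - r)"
    using \<rho> r A0 by (intro frac_le mult_left_mono mult_nonneg_nonneg) auto
  finally show ?thesis .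
qed

text \<open>A substitute for Hadamard's three circles theorem: the first Taylor coefficients are
  controlled by the bound on the small disc, the remaining ones by the bound on the large disc.\<close>

lemma holomorphic_interpolation_bound:
  fixes r1 r2 R \<epsilon> B :: real
  assumes "0 < r1" "r1 < R" "0 < r2" "r2 < R" "\<epsilon> > 0" "B \<ge> 0"
  shows "\<exists>C\<ge>0. \<forall>z0 g L. g holomorphic_on ball z0 R \<longrightarrow> L \<ge> 0 \<longrightarrow>
     (\<forall>z\<in>ball z0 r1. norm (g z) \<le> B) \<longrightarrow> (\<forall>z\<in>ball z0 R. norm (g z) \<le> B * L) \<longrightarrow>
     (\<forall>z\<in>cball z0 r2. norm (g z) \<le> C + \<epsilon> * L)"
proof -
  \<comment> \<open>Radii for Cauchy's inequalities: p lies inside the small disc, q strictly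
    between r2 and R, so that on the disc of radius r2 the second bound decays geometrically with
    ratio \<theta>.\<close>
  define p where "p = r1 / 2"
  define q where "q = (r2 + R) / 2"
  have p: "p > 0" "p < r1" "p < R" using assms by (auto simp: p_def)
  have q: "q > 0" "q < R" "r2 < q" using assms by (auto simp: q_def)
  define \<theta> where "\<theta> = r2 / q"
  have \<theta>: "0 < \<theta>" "\<theta> < 1" using q assms by (auto simp: \<theta>_def)
  have "(\<lambda>N. B * \<theta> ^ N / (1 - \<theta>)) \<longlonglongrightarrow> B * 0 / (1 - \<theta>)"
    using \<theta> by (intro tendsto_intros LIMSEQ_power_zero) auto
  hence "eventually (\<lambda>N. B * \<theta> ^ N / (1 - \<theta>) < \<epsilon>) sequentially"
    using assms(5) by (intro order_tendstoD) auto
  \<comment> \<open>From index N on, the geometric tail costs at most \<epsilon> L. Since N depends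
    neither on the centre nor on g or L, the constant C from the first N terms is uniform.\<close>
  then obtain N where N: "B * \<theta> ^ N / (1 - \<theta>) < \<epsilon>"
    using eventually_happens' sequentially_bot by blast
  define C where "C = (\<Sum>n<N. B * (r2 / p) ^ n)"
  show ?thesis
  proof (intro exI[of _ C] conjI allI impI ballI)
    show "C \<ge> 0" unfolding C_def using assms p by (intro sum_nonneg) auto
    fix z0 g L z
    assume g: "g holomorphic_on ball z0 R" and L: "(L::real) \<ge> 0"
      and B1: "\<forall>z\<in>ball z0 r1. norm (g z) \<le> B" and B2: "\<forall>z\<in>ball z0 R. norm (g z) \<le> B * L"
      and z: "z \<in> cball z0 r2"
    define a where "a = (\<lambda>n. (deriv ^^ n) g z0 / fact n)"
    have coeff: "norm (a n) \<le> M / s ^ n" if s: "0 < s" "s < R" and M: "\<And>x. norm (z0 - x) = s \<Longrightarrow> norm (g x) \<le> M" for s M n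
    proof -
      have "norm ((deriv ^^ n) g z0) \<le> fact n * M / s ^ n"
      proof (rule Cauchy_inequality)
        show "g holomorphic_on ball z0 s" by (rule holomorphic_on_subset[OF g]) (use s in auto)
        show "continuous_on (cball z0 s) g"
          by (intro holomorphic_on_imp_continuous_on holomorphic_on_subset[OF g]) (use s in auto)
      qed (use s M in auto)
      thus ?thesis by (simp add: a_def norm_divide divide_le_eq mult_ac)
    qed
    have a1: "norm (a n) \<le> B / p ^ n" for n
      by (rule coeff) (use p B1 in \<open>auto simp: dist_norm\<close>)
    have a2: "norm (a n) \<le> B * L / q ^ n" for n
      by (rule coeff) (use q B2 in \<open>auto simp: dist_norm\<close>)
    have nz: "norm (z - z0) \<le> r2" using z by (simp add: dist_norm norm_minus_commute)
    have sums: "(\<lambda>n. a n * (z - z0) ^ n) sums g z"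
      unfolding a_def by (rule holomorphic_power_series[OF g]) (use z assms in auto)
    have t1: "norm (a n * (z - z0) ^ n) \<le> B * (r2 / p) ^ n" for n
    proof -
      have "norm (a n * (z - z0) ^ n) \<le> B / p ^ n * r2 ^ n"
        unfolding norm_mult norm_power
        by (intro mult_mono power_mono a1 nz) (use p assms in auto)
      thus ?thesis by (simp add: power_divide)
    qed
    have t2: "norm (a n * (z - z0) ^ n) \<le> B * L * \<theta> ^ n" for n
    proof -
      have "norm (a n * (z - z0) ^ n) \<le> B * L / q ^ n * r2 ^ n"
        unfolding norm_mult norm_power
        by (intro mult_mono power_mono a2 nz) (use q L assms in auto)
      thus ?thesis by (simp add: power_divide \<theta>_def)
    qed
    have g_split: "g z = (\<Sum>n. a (n + N) * (z - z0) ^ (n + N)) + (\<Sum>n<N. a n * (z - z0) ^ n)"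
      using suminf_split_initial_segment[of "\<lambda>n. a n * (z - z0) ^ n" N] sums by (simp add: sums_iff)
    have geo: "(\<lambda>n. B * L * \<theta> ^ N * \<theta> ^ n) sums (B * L * \<theta> ^ N * (1 / (1 - \<theta>)))"
      using \<theta> by (intro sums_mult geometric_sums) auto
    have "norm (\<Sum>n. a (n + N) * (z - z0) ^ (n + N)) \<le> (\<Sum>n. B * L * \<theta> ^ N * \<theta> ^ n)"
    proof (rule norm_suminf_le)
      show "norm (a (n + N) * (z - z0) ^ (n + N)) \<le> B * L * \<theta> ^ N * \<theta> ^ n" for n
        using t2[of "n + N"] by (simp only: power_add mult_ac)
    qed (use geo in \<open>simp add: sums_iff\<close>)
    also have "\<dots> = (B * \<theta> ^ N / (1 - \<theta>)) * L"
      using geo by (simp add: sums_iff)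
    also have "\<dots> \<le> \<epsilon> * L" using N L by (intro mult_right_mono) auto
    finally have "norm (\<Sum>n. a (n + N) * (z - z0) ^ (n + N)) \<le> \<epsilon> * L" .
    moreover have "norm (\<Sum>n<N. a n * (z - z0) ^ n) \<le> C"
      unfolding C_def by (rule sum_norm_le) (rule t1)
    ultimately show "norm (g z) \<le> C + \<epsilon> * L"
      unfolding g_split using norm_triangle_ineq
      by (smt (verit))
  qed
qed

lemma compact_norm_bound:
  fixes f :: "complex \<Rightarrow> complex"
  assumes "compact S" "f holomorphic_on S"
  obtains B where "\<And>z. z \<in> S \<Longrightarrow> norm (f z) \<le> B"
  using compact_imp_bounded[OF compact_continuous_image[OF holomorphic_on_imp_continuous_on[OF assms(2)] assms(1)]]
  unfolding bounded_iff by blast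

lemma zeta_bound_gt_1:
  assumes "x > 1"
  obtains K where "K \<ge> 1" "\<And>s. Re s \<ge> x \<Longrightarrow> norm (zeta s) \<le> K"
    "\<And>s. Re s \<ge> x \<Longrightarrow> norm (1 / zeta s) \<le> K"
proof -
  define K where "K = (\<Sum>\<^sub>\<infinity>n\<in>{0<..}. real n powr (-x))"
  have hs: "((\<lambda>n. real n powr (-x)) has_sum K) {0<..}"
    unfolding K_def using summable_on_powr_pos[OF assms] by (rule has_sum_infsum)
  have le: "norm (of_nat n powr (-s)) \<le> real n powr (-x)" if "Re s \<ge> x" "n \<in> {0<..}" for n and s :: complex
    using that by (auto simp: norm_nat_powr intro!: powr_mono)
  have 1: "norm (zeta s) \<le> K" if "Re s \<ge> x" for s
    by (rule norm_infsum_le[OF zeta_has_sum hs]) (use le that assms in auto)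
  have 2: "norm (1 / zeta s) \<le> K" if "Re s \<ge> x" for s
  proof (rule norm_infsum_le[OF moebius_mu_has_sum hs])
    show "norm (of_real (moebius_mu n) * of_nat n powr (-s)) \<le> real n powr (-x)" if "n \<in> {0<..}" for n
    proof -
      have "\<bar>moebius_mu n\<bar> * norm (of_nat n powr (-s)) \<le> 1 * real n powr (-x)"
        by (intro mult_mono abs_moebius_mu_le le \<open>Re s \<ge> x\<close> that) auto
      thus ?thesis by (simp add: norm_mult)
    qed
  qed (use that assms in auto)
  \<comment> \<open>Both norms are at most K, so 1 \<le> K^2. This makes ln K nonnegative in later
    bounds.\<close>
  have "1 = norm (zeta (of_real x) * (1 / zeta (of_real x)))"
    using zeta_nonzero_gt_1[of "of_real x"] assms by simp
  also have "\<dots> \<le> K * K"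
    unfolding norm_mult by (intro mult_mono 1 2) (auto intro: order_trans[OF norm_ge_zero 1[of "of_real x"]])
  finally have "K \<ge> 1"
    using mult_left_mono[of K 1 K] order_trans[OF norm_ge_zero 1[of "of_real x"]] by fastforce
  thus ?thesis using that 1 2 by blast
qed

text \<open>On the disc of radius 3/2 about 2 + it the Riemann hypothesis provides a holomorphic
  logarithm of zeta; |t| \<ge> 2 keeps the pole outside. The logarithm, normalized at the centre, is
  bounded on a small disc and O(ln |t|) on a large one, and interpolation lowers the constant to
  \<epsilon> on the disc of radius 3/2 - \<delta>. The form with some w avoids choosing a
  branch.\<close>

lemma zeta_log_bound:
  assumes RH: Riemann_Hypothesis and \<delta>: "0 < \<delta>" "\<delta> < 1 / 2" and \<epsilon>: "\<epsilon> > 0"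
  shows "\<exists>C\<ge>0. \<forall>s. 1/2 + \<delta> \<le> Re s \<longrightarrow> Re s \<le> 2 \<longrightarrow> \<bar>Im s\<bar> \<ge> 2 \<longrightarrow>
    (\<exists>w. exp w = zeta s \<and> norm w \<le> C + \<epsilon> * ln (5 + \<bar>Im s\<bar>))"
proof -
  obtain K where K: "K \<ge> 1" "\<And>s. Re s \<ge> 5/4 \<Longrightarrow> norm (zeta s) \<le> K"
    "\<And>s. Re s \<ge> 5/4 \<Longrightarrow> norm (1 / zeta s) \<le> K"
    using zeta_bound_gt_1[of "5/4"] by auto
  obtain Cz where Cz: "Cz > 0" "\<And>s. Re s \<ge> 1/2 \<Longrightarrow> norm (zeta_reg s) \<le> Cz * (1 + norm s) ^ 2"
    using norm_zeta_reg_le by blast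
  \<comment> \<open>A1 exceeds the bound 2 ln K for the real part on the disc of radius 3/4, and M L
    the one on the disc of radius 3/2. B is what Borel-Caratheodory makes of them: 2 A1 (1/2) / (3/4
    - 1/2) = 4 A1, and at most 2 M (3/2) / (\<delta>/2) = 6 M / \<delta>.\<close>
  define A1 where "A1 = 2 * ln K + 1"
  define M where "M = ln (2 * Cz + 1) + 3 + ln K"
  have A1: "A1 > 0" unfolding A1_def using ln_ge_zero[OF K(1)] by linarith
  have M: "M > 0" unfolding M_def using ln_ge_zero[OF K(1)] ln_gt_zero[of "2 * Cz + 1"] Cz(1) by linarith
  define B where "B = max (4 * A1) (6 * M / \<delta>)"
  obtain C where C: "C \<ge> 0" "\<And>z0 g L z. g holomorphic_on ball z0 (3/2 - \<delta>/2) \<Longrightarrow> L \<ge> 0 \<Longrightarrow>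
     (\<And>z. z\<in>ball z0 (1/2) \<Longrightarrow> norm (g z) \<le> B) \<Longrightarrow> (\<And>z. z\<in>ball z0 (3/2 - \<delta>/2) \<Longrightarrow> norm (g z) \<le> B * L) \<Longrightarrow>
     z\<in>cball z0 (3/2 - \<delta>) \<Longrightarrow> norm (g z) \<le> C + \<epsilon> * L"
    using holomorphic_interpolation_bound[of "1/2" "3/2 - \<delta>/2" "3/2 - \<delta>" \<epsilon> B] \<delta> \<epsilon> A1
    by (auto simp: B_def le_max_iff_disj)
  show ?thesis
  proof (intro exI[of _ "C + ln K + pi"] conjI allI impI)
    show "C + ln K + pi \<ge> 0" using C(1) K(1) ln_ge_zero[of K] pi_ge_zero by linarith
    fix s assume s: "1/2 + \<delta> \<le> Re s" "Re s \<le> 2" "\<bar>Im s\<bar> \<ge> 2"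
    define t where "t = Im s"
    define z where "z = Complex 2 t"
    \<comment> \<open>5 + |t| bounds 1 + |w| on the disc of radius 3/2; as it also exceeds e,
      constants can be absorbed into multiples of L.\<close>
    define L where "L = ln (5 + \<bar>t\<bar>)"
    have "exp 1 \<le> 5 + \<bar>t\<bar>" using exp_le by linarith
    hence "ln (exp 1) \<le> L" unfolding L_def by (subst ln_le_cancel_iff) auto
    hence L: "L \<ge> 1" by simp
    have ball: "Re w > 1/2 \<and> w \<noteq> 1 \<and> norm w \<le> 4 + \<bar>t\<bar> \<and> norm (w - 1) \<ge> 1/2" if "w \<in> ball z (3/2)" for w
    proof -
      have d: "norm (w - z) < 3/2" using that by (simp add: dist_norm norm_minus_commute)
      have "\<bar>Re (w - z)\<bar> < 3/2" "\<bar>Im (w - z)\<bar> < 3/2"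
        using abs_Re_le_cmod[of "w - z"] abs_Im_le_cmod[of "w - z"] d by linarith+
      moreover have "Re (w - z) = Re w - 2" "Im (w - z) = Im w - Im s" by (simp_all add: z_def t_def)
      ultimately have "Re w > 1/2" "\<bar>Im w\<bar> > 1/2" using s(3) by linarith+
      moreover have "norm (w - 1) \<ge> \<bar>Im (w - 1)\<bar>" by (rule abs_Im_le_cmod)
      moreover have "norm w \<le> norm z + norm (w - z)" by (metis norm_triangle_sub)
      moreover have "norm z \<le> 2 + \<bar>t\<bar>" unfolding z_def using cmod_le[of "Complex 2 t"] by simp
      ultimately show ?thesis using d by auto
    qed
    have zpos: "Re w > 5/4" if "w \<in> ball z (3/4)" for w
      using that abs_Re_le_cmod[of "w - z"] by (auto simp: z_def dist_norm norm_minus_commute)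
    have nz: "zeta w \<noteq> 0" if "w \<in> ball z (3/2)" for w
      using zeta_reg_nonzero[OF RH, of w] ball[OF that] by (auto simp: zeta_reg_def)
    obtain g where g: "g holomorphic_on ball z (3/2)" "\<And>w. w \<in> ball z (3/2) \<Longrightarrow> exp (g w) = zeta w"
    proof (rule holomorphic_logarithm_exists[of "ball z (3/2)" zeta z])
      show "zeta holomorphic_on ball z (3/2)"
        by (rule holomorphic_on_subset[OF holomorphic_zeta]) (use ball in auto)
    qed (use nz in auto)
    \<comment> \<open>Borel-Caratheodory needs the value 0 at the centre. The value removed is
      restored at the end by \<open>Ln (zeta z)\<close>, of norm at most ln K + pi.\<close>
    define f where "f = (\<lambda>w. g w - g z)"
    have zin: "z \<in> ball z (3/2)" by simp
    have fexp: "exp (f w) = zeta w / zeta z" if "w \<in> ball z (3/2)" for w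
      using g(2)[OF that] g(2)[OF zin] by (simp add: f_def exp_diff)
    have hf: "f holomorphic_on S" if "S \<subseteq> ball z (3/2)" for S
      unfolding f_def by (intro holomorphic_intros holomorphic_on_subset[OF g(1) that])
    have Kz: "norm (1 / zeta z) \<le> K" "norm (zeta z) \<le> K" using K(2,3)[of z] by (auto simp: z_def)
    have Ref: "Re (f w) \<le> ln X + ln K" if w: "w \<in> ball z (3/2)" "norm (zeta w) \<le> X" for w X
    proof -
      have X: "X > 0" using nz[OF w(1)] w(2) by (meson less_le_trans zero_less_norm_iff)
      have "exp (Re (f w)) = norm (zeta w) * norm (1 / zeta z)"
        using fexp[OF w(1)] norm_exp_eq_Re[of "f w"] by (simp add: norm_divide)
      also have "\<dots> \<le> X * K" using w(2) Kz X by (intro mult_mono) auto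
      finally have "ln (exp (Re (f w))) \<le> ln (X * K)" by (subst ln_le_cancel_iff) (use X K(1) in auto)
      thus ?thesis using X K(1) by (simp add: ln_mult)
    qed
    have small: "norm (f w) \<le> B" if "w \<in> ball z (1/2)" for w
    proof -
      have A: "Re (f w) < A1" if "w \<in> ball z (3/4)" for w
        using Ref[of w K] that zpos[OF that] K(2)[of w] unfolding A1_def by auto
      have "f z = 0" by (simp add: f_def)
      moreover have "f holomorphic_on ball z (3/4)" by (rule hf) auto
      ultimately have "norm (f w) \<le> 2 * A1 * (1/2) / (3/4 - 1/2)"
        using Borel_Caratheodory[of f z "3/4" A1 "1/2" w] A that by auto
      thus ?thesis by (simp add: B_def)
    qed
    have large: "norm (f w) \<le> B * L" if "w \<in> ball z (3/2 - \<delta>/2)" for w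
    proof -
      have A: "Re (f w) < M * L" if w: "w \<in> ball z (3/2)" for w
      proof -
        note b = ball[OF w]
        have "norm (zeta w) = norm (zeta_reg w) / norm (w - 1)"
          using b by (simp add: zeta_conv_zeta_reg norm_divide)
        also have "\<dots> \<le> (Cz * (5 + \<bar>t\<bar>) ^ 2) / (1/2)"
        proof (rule frac_le)
          have "norm (zeta_reg w) \<le> Cz * (1 + norm w) ^ 2" using Cz(2) b by simp
          also have "\<dots> \<le> Cz * (5 + \<bar>t\<bar>) ^ 2" using b Cz(1) by (intro mult_left_mono power_mono) auto
          finally show "norm (zeta_reg w) \<le> Cz * (5 + \<bar>t\<bar>) ^ 2" .
        qed (use b Cz(1) in auto)
        also have "\<dots> \<le> (2 * Cz + 1) * (5 + \<bar>t\<bar>) ^ 2" by (simp add: algebra_simps)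
        finally have "Re (f w) \<le> ln ((2 * Cz + 1) * (5 + \<bar>t\<bar>) ^ 2) + ln K" by (rule Ref[OF w])
        also have "ln ((2 * Cz + 1) * (5 + \<bar>t\<bar>) ^ 2) = ln (2 * Cz + 1) + 2 * L"
          using Cz(1) by (subst ln_mult) (auto simp: L_def ln_realpow)
        also have "ln (2 * Cz + 1) + 2 * L + ln K < (ln (2 * Cz + 1) + ln K) * 1 + 3 * L" using L by simp
        also have "\<dots> \<le> (ln (2 * Cz + 1) + ln K) * L + 3 * L"
          using L K(1) Cz(1) ln_ge_zero[of K] ln_gt_zero[of "2 * Cz + 1"]
          by (intro add_mono mult_left_mono) auto
        also have "\<dots> = M * L" by (simp add: M_def algebra_simps)
        finally show "Re (f w) < M * L" .
      qed
      have "f z = 0" by (simp add: f_def)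
      moreover have "f holomorphic_on ball z (3/2)" by (rule hf) auto
      ultimately have "norm (f w) \<le> 2 * (M * L) * (3/2 - \<delta>/2) / (3/2 - (3/2 - \<delta>/2))"
        using Borel_Caratheodory[of f z "3/2" "M * L" "3/2 - \<delta>/2" w] A that \<delta> by auto
      also have "\<dots> \<le> 2 * (M * L) * (3/2) / (\<delta>/2)"
        using M L \<delta> by (intro frac_le mult_left_mono mult_nonneg_nonneg) auto
      also have "\<dots> = (6 * M / \<delta>) * L" using \<delta> by (simp add: field_simps)
      also have "\<dots> \<le> B * L" using L by (intro mult_right_mono) (auto simp: B_def)
      finally show ?thesis .
    qed
    have sin: "s \<in> cball z (3/2 - \<delta>)"
    proof -
      have "z - s = of_real (2 - Re s)" by (simp add: z_def t_def complex_eq_iff)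
      hence "norm (z - s) = 2 - Re s" using s by (metis abs_of_nonneg diff_ge_0_iff_ge norm_of_real)
      thus ?thesis using s by (simp add: dist_norm)
    qed
    have fs: "norm (f s) \<le> C + \<epsilon> * L"
      by (rule C(2)[of f z L s]) (use sin L small large \<delta> in \<open>auto intro!: hf\<close>)
    have sb: "s \<in> ball z (3/2)" using sin \<delta> by auto
    have "norm (Ln (zeta z)) \<le> \<bar>Re (Ln (zeta z))\<bar> + \<bar>Im (Ln (zeta z))\<bar>" by (rule cmod_le)
    also have "\<bar>Im (Ln (zeta z))\<bar> \<le> pi"
      using mpi_less_Im_Ln[of "zeta z"] Im_Ln_le_pi[of "zeta z"] nz[OF zin] by linarith
    also have "\<bar>Re (Ln (zeta z))\<bar> \<le> ln K"
    proof -
      have "ln (norm (zeta z)) \<le> ln K" using Kz nz[OF zin] K(1) by (subst ln_le_cancel_iff) auto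
      moreover have "ln (norm (1 / zeta z)) \<le> ln K" using Kz nz[OF zin] K(1) by (subst ln_le_cancel_iff) auto
      moreover have "ln (norm (1 / zeta z)) = - ln (norm (zeta z))"
        using nz[OF zin] by (simp add: norm_divide ln_div)
      ultimately show ?thesis using nz[OF zin] by simp
    qed
    finally have Ln: "norm (Ln (zeta z)) \<le> ln K + pi" by simp
    show "\<exists>w. exp w = zeta s \<and> norm w \<le> C + ln K + pi + \<epsilon> * ln (5 + \<bar>Im s\<bar>)"
    proof (intro exI conjI)
      show "exp (f s + Ln (zeta z)) = zeta s"
        using fexp[OF sb] nz[OF zin] by (simp add: exp_add)
      show "norm (f s + Ln (zeta z)) \<le> C + ln K + pi + \<epsilon> * ln (5 + \<bar>Im s\<bar>)"
        using fs Ln norm_triangle_ineq[of "f s" "Ln (zeta z)"] by (simp add: L_def t_def)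
    qed
  qed
qed

text \<open>With exp w = zeta s, the norm of w controls both exp w and exp (-w), hence zeta and its
  inverse together.\<close>

lemma zeta_powr_bound:
  assumes RH: Riemann_Hypothesis and \<delta>: "0 < \<delta>" "\<delta> < 1 / 2" and \<epsilon>: "\<epsilon> > 0"
  shows "\<exists>C>0. \<forall>s. 1/2 + \<delta> \<le> Re s \<longrightarrow> \<bar>Im s\<bar> \<ge> 2 \<longrightarrow>
    norm (zeta s) \<le> C * (1 + \<bar>Im s\<bar>) powr \<epsilon> \<and> norm (1 / zeta s) \<le> C * (1 + \<bar>Im s\<bar>) powr \<epsilon>"
proof -
  obtain K where K: "K \<ge> 1" "\<And>s. Re s \<ge> 2 \<Longrightarrow> norm (zeta s) \<le> K"
    "\<And>s. Re s \<ge> 2 \<Longrightarrow> norm (1 / zeta s) \<le> K"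
    using zeta_bound_gt_1[of 2] by auto
  obtain C where C: "C \<ge> 0" "\<And>s. 1/2 + \<delta> \<le> Re s \<Longrightarrow> Re s \<le> 2 \<Longrightarrow> \<bar>Im s\<bar> \<ge> 2 \<Longrightarrow>
    \<exists>w. exp w = zeta s \<and> norm w \<le> C + \<epsilon> * ln (5 + \<bar>Im s\<bar>)"
    using zeta_log_bound[OF assms] by blast
  define D where "D = max K (exp C * 5 powr \<epsilon>)"
  have D: "D > 0" using K(1) by (simp add: D_def)
  show ?thesis
  proof (intro exI[of _ D] conjI allI impI)
    fix s assume s: "1/2 + \<delta> \<le> Re s" "\<bar>Im s\<bar> \<ge> 2"
    have "norm (zeta s) \<le> D * (1 + \<bar>Im s\<bar>) powr \<epsilon> \<and> norm (1 / zeta s) \<le> D * (1 + \<bar>Im s\<bar>) powr \<epsilon>"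
    proof (cases "Re s \<le> 2")
      case True
      then obtain w where w: "exp w = zeta s" "norm w \<le> C + \<epsilon> * ln (5 + \<bar>Im s\<bar>)"
        using C(2) s by blast
      have "exp (norm w) \<le> exp C * exp (\<epsilon> * ln (5 + \<bar>Im s\<bar>))"
        using w(2) by (simp flip: exp_add)
      also have "exp (\<epsilon> * ln (5 + \<bar>Im s\<bar>)) = (5 + \<bar>Im s\<bar>) powr \<epsilon>" by (simp add: powr_def)
      also have "\<dots> \<le> (5 * (1 + \<bar>Im s\<bar>)) powr \<epsilon>" using \<epsilon> by (intro powr_mono2) auto
      also have "exp C * \<dots> = exp C * 5 powr \<epsilon> * (1 + \<bar>Im s\<bar>) powr \<epsilon>" by (subst powr_mult) auto
      also have "\<dots> \<le> D * (1 + \<bar>Im s\<bar>) powr \<epsilon>" by (intro mult_right_mono) (auto simp: D_def)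
      finally have *: "exp (norm w) \<le> D * (1 + \<bar>Im s\<bar>) powr \<epsilon>" by simp
      have "norm (zeta s) \<le> exp (norm w)"
        using w(1) norm_exp_eq_Re[of w] complex_Re_le_cmod[of w] by auto
      moreover have "1 / zeta s = exp (- w)"
        by (simp add: w(1) [symmetric] exp_minus inverse_eq_divide)
      hence "norm (1 / zeta s) \<le> exp (norm w)"
        using complex_Re_le_cmod[of "-w"] by simp
      ultimately show ?thesis using * by simp
    next
      case False
      have "K * 1 \<le> D * (1 + \<bar>Im s\<bar>) powr \<epsilon>"
        using K(1) \<epsilon> by (intro mult_mono ge_one_powr_ge_zero) (auto simp: D_def)
      thus ?thesis using K(2)[of s] K(3)[of s] False by linarith
    qed
    thus "norm (zeta s) \<le> D * (1 + \<bar>Im s\<bar>) powr \<epsilon>" "norm (1 / zeta s) \<le> D * (1 + \<bar>Im s\<bar>) powr \<epsilon>"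
      by auto
  qed (fact D)
qed

text \<open>In contrast to \<open>1 / zeta s\<close>, this is holomorphic at \<open>s = 1\<close>.\<close>

definition zeta_inv :: "complex \<Rightarrow> complex" where
  "zeta_inv s = (s - 1) / zeta_reg s"

lemma zeta_inv_eq: "s \<noteq> 1 \<Longrightarrow> zeta_inv s = 1 / zeta s"
  by (simp add: zeta_inv_def zeta_reg_def)

lemma holomorphic_zeta_inv:
  assumes Riemann_Hypothesis
  shows "zeta_inv holomorphic_on re_gt (1/2)"
  unfolding zeta_inv_def [abs_def]
  by (intro holomorphic_intros holomorphic_on_subset[OF holomorphic_zeta_reg])
     (use zeta_reg_nonzero[OF assms] in auto)

lemma zeta_inv_bound:
  assumes RH: Riemann_Hypothesis and \<delta>: "0 < \<delta>" "\<delta> < 1 / 2" and \<epsilon>: "\<epsilon> > 0"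
  shows "\<exists>C>0. \<forall>s. 1/2 + \<delta> \<le> Re s \<longrightarrow> norm (zeta_inv s) \<le> C * (1 + \<bar>Im s\<bar>) powr \<epsilon>"
proof -
  obtain K where K: "K \<ge> 1" "\<And>s. Re s \<ge> 2 \<Longrightarrow> norm (zeta s) \<le> K"
    "\<And>s. Re s \<ge> 2 \<Longrightarrow> norm (1 / zeta s) \<le> K"
    using zeta_bound_gt_1[of 2] by auto
  obtain C where C: "C > 0" "\<And>s. 1/2 + \<delta> \<le> Re s \<Longrightarrow> \<bar>Im s\<bar> \<ge> 2 \<Longrightarrow> norm (1 / zeta s) \<le> C * (1 + \<bar>Im s\<bar>) powr \<epsilon>"
    using zeta_powr_bound[OF assms] by blast
  \<comment> \<open>The part of the half-plane that is left after |Im s| \<ge> 2 and Re s \<ge> 2 is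
    compact; it contains s = 1, where \<open>zeta_inv\<close> is still holomorphic.\<close>
  have "zeta_inv holomorphic_on cbox (Complex (1/2 + \<delta>) (-2)) (Complex 2 2)"
    by (rule holomorphic_on_subset[OF holomorphic_zeta_inv[OF RH]])
       (use \<delta> in \<open>auto simp: in_cbox_complex_iff\<close>)
  from compact_norm_bound[OF compact_cbox this]
  obtain B where B: "\<And>s. s \<in> cbox (Complex (1/2 + \<delta>) (-2)) (Complex 2 2) \<Longrightarrow> norm (zeta_inv s) \<le> B"
    by blast
  define D where "D = max C (max K B)"
  have D0: "D > 0" using C(1) by (simp add: D_def)
  show ?thesis
  proof (intro exI[of _ D] conjI allI impI)
    show "D > 0" by (fact D0)
    fix s assume s: "1/2 + \<delta> \<le> Re s"
    have p: "1 \<le> (1 + \<bar>Im s\<bar>) powr \<epsilon>" using \<epsilon> by (intro ge_one_powr_ge_zero) auto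
    have le: "norm (zeta_inv s) \<le> D * (1 + \<bar>Im s\<bar>) powr \<epsilon>" if "norm (zeta_inv s) \<le> D"
      using that mult_left_mono[OF p, of D] D0 by linarith
    show "norm (zeta_inv s) \<le> D * (1 + \<bar>Im s\<bar>) powr \<epsilon>"
    proof (cases "\<bar>Im s\<bar> \<ge> 2")
      case True
      have "norm (zeta_inv s) \<le> C * (1 + \<bar>Im s\<bar>) powr \<epsilon>"
        using C(2)[OF s True] True by (subst zeta_inv_eq) auto
      also have "\<dots> \<le> D * (1 + \<bar>Im s\<bar>) powr \<epsilon>" by (intro mult_right_mono) (auto simp: D_def)
      finally show ?thesis .
    next
      case False
      show ?thesis
      proof (cases "Re s \<ge> 2")
        case True
        thus ?thesis using K(3)[of s] by (intro le) (subst zeta_inv_eq, auto simp: D_def)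
      next
        case False
        moreover have "- 2 \<le> Im s" "Im s \<le> 2" using \<open>\<not> \<bar>Im s\<bar> \<ge> 2\<close> by linarith+
        ultimately show ?thesis using B[of s] s by (intro le) (auto simp: D_def in_cbox_complex_iff)
      qed
    qed
  qed
qed

lemma zeta_line_bound:
  assumes RH: Riemann_Hypothesis and x: "x > 1/2" "x \<noteq> 1" and \<epsilon>: "\<epsilon> > 0"
  shows "\<exists>C>0. \<forall>t. norm (zeta (Complex x t)) \<le> C * (1 + \<bar>t\<bar>) powr \<epsilon>"
proof -
  \<comment> \<open>Capped at 1/4 only to meet the range of \<delta> in
    \<open>zeta_powr_bound\<close>, since x may be large.\<close>
  define \<delta> where "\<delta> = min (x - 1/2) (1/4)"
  have \<delta>: "0 < \<delta>" "\<delta> < 1/2" "1/2 + \<delta> \<le> x" using x by (auto simp: \<delta>_def min_def)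
  obtain C where C: "C > 0" "\<And>s. 1/2 + \<delta> \<le> Re s \<Longrightarrow> \<bar>Im s\<bar> \<ge> 2 \<Longrightarrow> norm (zeta s) \<le> C * (1 + \<bar>Im s\<bar>) powr \<epsilon>"
    using zeta_powr_bound[OF RH \<delta>(1,2) \<epsilon>] by blast
  have "zeta holomorphic_on cbox (Complex x (-2)) (Complex x 2)"
    by (rule holomorphic_on_subset[OF holomorphic_zeta])
       (use x in \<open>auto simp: in_cbox_complex_iff\<close>)
  from compact_norm_bound[OF compact_cbox this]
  obtain B where B: "\<And>s. s \<in> cbox (Complex x (-2)) (Complex x 2) \<Longrightarrow> norm (zeta s) \<le> B"
    by blast
  show ?thesis
  proof (intro exI[of _ "max C B"] conjI allI)
    show "max C B > 0" using C by simp
    fix t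
    show "norm (zeta (Complex x t)) \<le> max C B * (1 + \<bar>t\<bar>) powr \<epsilon>"
    proof (cases "\<bar>t\<bar> \<ge> 2")
      case True
      have "norm (zeta (Complex x t)) \<le> C * (1 + \<bar>t\<bar>) powr \<epsilon>"
        using C(2)[of "Complex x t"] True \<delta>(3) by simp
      also have "\<dots> \<le> max C B * (1 + \<bar>t\<bar>) powr \<epsilon>" by (intro mult_right_mono) auto
      finally show ?thesis .
    next
      case False
      have "norm (zeta (Complex x t)) \<le> max C B * 1"
      proof -
        have "- 2 \<le> t" "t \<le> 2" using False by linarith+
        thus ?thesis using B[of "Complex x t"] by (auto simp: in_cbox_complex_iff)
      qed
      also have "\<dots> \<le> max C B * (1 + \<bar>t\<bar>) powr \<epsilon>"
        using C \<epsilon> by (intro mult_left_mono ge_one_powr_ge_zero) auto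
      finally show ?thesis .
    qed
  qed
qed

section \<open>Perron's formula\<close>

abbreviation vline :: "real \<Rightarrow> real \<Rightarrow> real \<Rightarrow> complex" where
  "vline x T \<equiv> linepath (Complex x (-T)) (Complex x T)"

lemma closed_segment_vline:
  assumes "T \<ge> 0"
  shows "s \<in> closed_segment (Complex x (-T)) (Complex x T) \<longleftrightarrow> Re s = x \<and> \<bar>Im s\<bar> \<le> T"
  using assms by (auto simp: closed_segment_same_Re closed_segment_eq_real_ivl)

lemma contour_integrable_vline:
  assumes "continuous_on {s. Re s = x \<and> \<bar>Im s\<bar> \<le> T} f" "T \<ge> 0"
  shows "f contour_integrable_on (vline x T)"
  by (rule contour_integrable_continuous_linepath)
     (rule continuous_on_subset[OF assms(1)], use closed_segment_vline[OF assms(2)] in auto)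

lemma Re_pos_nonzero:
  assumes "Re s > 0"
  shows "s \<noteq> 0" "s + 1 \<noteq> 0" "s * (s + 1) \<noteq> 0"
proof -
  show "s \<noteq> 0" using assms by auto
  moreover have "Re (s + 1) \<noteq> 0" using assms by simp
  hence "s + 1 \<noteq> 0" by (metis zero_complex.sel(1))
  ultimately show "s + 1 \<noteq> 0" "s * (s + 1) \<noteq> 0" by auto
qed

lemma has_sum_diff_complex:
  fixes f g :: "_ \<Rightarrow> complex"
  assumes "(f has_sum F) A" "(g has_sum G) A"
  shows "((\<lambda>x. f x - g x) has_sum (F - G)) A"
  using has_sum_add[OF assms(1) has_sum_cmult_right[OF assms(2), of "-1"]] by simp

text \<open>I will be 2 pi i times the sum of the residues passed; the error is the contribution of
  the two horizontal sides.\<close>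

lemma rect_shift:
  assumes T: "T > 0" and x: "x0 < x1"
    and f: "continuous_on (path_image (rectpath (Complex x0 (-T)) (Complex x1 T))) f"
    and I: "(f has_contour_integral I) (rectpath (Complex x0 (-T)) (Complex x1 T))"
    and B: "\<And>s. x0 \<le> Re s \<Longrightarrow> Re s \<le> x1 \<Longrightarrow> \<bar>Im s\<bar> = T \<Longrightarrow> norm (f s) \<le> B"
  shows "norm (contour_integral (vline x1 T) f - contour_integral (vline x0 T) f - I) \<le> 2 * (x1 - x0) * B"
proof -
  define a1 a2 a3 a4 where "a1 = Complex x0 (-T)" and "a2 = Complex x1 (-T)" and
    "a3 = Complex x1 T" and "a4 = Complex x0 T"
  note defs = a1_def a2_def a3_def a4_def
  have rp: "rectpath a1 a3 = linepath a1 a2 +++ linepath a2 a3 +++ linepath a3 a4 +++ linepath a4 a1"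
    by (simp add: rectpath_def Let_def defs)
  have f': "continuous_on (closed_segment p q) f"
    if "closed_segment p q \<subseteq> path_image (rectpath a1 a3)" for p q
    by (rule continuous_on_subset[OF f[folded defs] that])
  have sub: "closed_segment a1 a2 \<subseteq> path_image (rectpath a1 a3)"
    "closed_segment a2 a3 \<subseteq> path_image (rectpath a1 a3)"
    "closed_segment a3 a4 \<subseteq> path_image (rectpath a1 a3)"
    "closed_segment a4 a1 \<subseteq> path_image (rectpath a1 a3)"
    unfolding rp by (auto simp: path_image_join)
  note int = contour_integrable_continuous_linepath[OF f'[OF sub(1)]]
    contour_integrable_continuous_linepath[OF f'[OF sub(2)]]
    contour_integrable_continuous_linepath[OF f'[OF sub(3)]]
    contour_integrable_continuous_linepath[OF f'[OF sub(4)]]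
  have "I = contour_integral (rectpath a1 a3) f"
    using I by (simp add: contour_integral_unique defs)
  also have "\<dots> = contour_integral (linepath a1 a2) f + contour_integral (linepath a2 a3) f
     + contour_integral (linepath a3 a4) f + contour_integral (linepath a4 a1) f"
    unfolding rp using int by simp
  also have "contour_integral (linepath a4 a1) f = - contour_integral (linepath a1 a4) f"
    by (metis contour_integral_reversepath reversepath_linepath valid_path_linepath)
  finally have eq: "contour_integral (linepath a2 a3) f - contour_integral (linepath a1 a4) f - I
     = - (contour_integral (linepath a1 a2) f + contour_integral (linepath a3 a4) f)" by simp
  have B0: "B \<ge> 0" using order_trans[OF norm_ge_zero B[of a1]] x T by (auto simp: defs)
  have n12: "norm (a2 - a1) = x1 - x0"
  proof -
    have "a2 - a1 = of_real (x1 - x0)" by (simp add: defs complex_eq_iff)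
    thus ?thesis using x by (simp del: of_real_diff)
  qed
  have n34: "norm (a4 - a3) = x1 - x0"
  proof -
    have "a4 - a3 = of_real (x0 - x1)" by (simp add: defs complex_eq_iff)
    thus ?thesis using x by (simp del: of_real_diff)
  qed
  have "norm (contour_integral (linepath a1 a2) f) \<le> B * norm (a2 - a1)"
  proof (rule contour_integral_bound_linepath[OF int(1) B0])
    fix s assume "s \<in> closed_segment a1 a2"
    thus "norm (f s) \<le> B" using x T unfolding defs
      by (intro B) (auto simp: closed_segment_same_Im closed_segment_eq_real_ivl)
  qed
  moreover have "norm (contour_integral (linepath a3 a4) f) \<le> B * norm (a4 - a3)"
  proof (rule contour_integral_bound_linepath[OF int(3) B0])
    fix s assume "s \<in> closed_segment a3 a4"
    thus "norm (f s) \<le> B" using x T unfolding defs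
      by (intro B) (auto simp: closed_segment_same_Im closed_segment_eq_real_ivl)
  qed
  ultimately have "norm (contour_integral (linepath a1 a2) f + contour_integral (linepath a3 a4) f) \<le> 2 * (x1 - x0) * B"
    using norm_triangle_ineq[of "contour_integral (linepath a1 a2) f" "contour_integral (linepath a3 a4) f"]
    by (simp add: n12 n34 algebra_simps)
  thus ?thesis unfolding defs [symmetric] eq norm_minus_cancel .
qed

lemma rectpath_subset_strip:
  assumes "x0 \<le> x1" "T \<ge> 0" "s \<in> path_image (rectpath (Complex x0 (-T)) (Complex x1 T))"
  shows "x0 \<le> Re s" "Re s \<le> x1"
proof -
  have "path_image (rectpath (Complex x0 (-T)) (Complex x1 T)) \<subseteq> cbox (Complex x0 (-T)) (Complex x1 T)"
    by (rule path_image_rectpath_subset_cbox) (use assms in auto)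
  with assms show "x0 \<le> Re s" "Re s \<le> x1" by (auto simp: in_cbox_complex_iff)
qed

lemma rect_cauchy:
  assumes T: "T > \<bar>Im p\<bar>" and x: "x0 < Re p" "Re p < x1"
    and f: "f holomorphic_on re_gt c" "c < x0"
  shows "((\<lambda>s. f s / (s - p)) has_contour_integral 2 * of_real pi * \<i> * f p) (rectpath (Complex x0 (-T)) (Complex x1 T))"
proof -
  have inbox: "p \<in> box (Complex x0 (-T)) (Complex x1 T)"
    using T x by (auto simp: in_box_complex_iff)
  have w: "((\<lambda>s. f s / (s - p)) has_contour_integral
      (of_real (2 * pi) * \<i> * winding_number (rectpath (Complex x0 (-T)) (Complex x1 T)) p * f p)) (rectpath (Complex x0 (-T)) (Complex x1 T))"
  proof (rule Cauchy_integral_formula_convex_simple[OF convex_re_gt f(1)])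
    show "p \<in> interior (re_gt c)" using x f(2) by (simp add: interior_open open_re_gt)
    have img: "path_image (rectpath (Complex x0 (-T)) (Complex x1 T)) =
       cbox (Complex x0 (-T)) (Complex x1 T) - box (Complex x0 (-T)) (Complex x1 T)"
      by (rule path_image_rectpath_cbox_minus_box) (use T x in auto)
    show "path_image (rectpath (Complex x0 (-T)) (Complex x1 T)) \<subseteq> re_gt c - {p}"
    proof
      fix s assume "s \<in> path_image (rectpath (Complex x0 (-T)) (Complex x1 T))"
      hence "s \<in> cbox (Complex x0 (-T)) (Complex x1 T)" "s \<notin> box (Complex x0 (-T)) (Complex x1 T)"
        unfolding img by blast+
      thus "s \<in> re_gt c - {p}" using inbox f(2) by (force simp: in_cbox_complex_iff)
    qed
  qed auto
  have "of_real (2 * pi) * \<i> * winding_number (rectpath (Complex x0 (-T)) (Complex x1 T)) p * f p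
      = 2 * of_real pi * \<i> * f p"
    unfolding winding_number_rectpath[OF inbox] by simp
  with w show ?thesis by (simp only:)
qed

lemma rect_cauchy_zero:
  assumes "T \<ge> 0" "x0 \<le> x1" and f: "f holomorphic_on re_gt c" "c < x0"
  shows "(f has_contour_integral 0) (rectpath (Complex x0 (-T)) (Complex x1 T))"
proof (rule Cauchy_theorem_convex_simple[OF f(1) convex_re_gt])
  show "path_image (rectpath (Complex x0 (-T)) (Complex x1 T)) \<subseteq> re_gt c"
    using rectpath_subset_strip[OF assms(2,1)] f(2) by fastforce
qed auto

lemma Re_Im_bounds:
  fixes s :: complex
  shows "\<bar>Im s\<bar> = T \<Longrightarrow> T \<le> norm s" "\<bar>Im s\<bar> = T \<Longrightarrow> T \<le> norm (s + 1)" "Re s \<le> norm s"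
    "Re s \<le> norm (s + 1)" "- Re s \<le> norm s" "- Re s - 1 \<le> norm (s + 1)"
  using abs_Im_le_cmod[of s] abs_Im_le_cmod[of "s + 1"] abs_Re_le_cmod[of s] abs_Re_le_cmod[of "s + 1"]
  by auto

text \<open>For u > 1 the value comes from the residues 1 at s = 0 and -1/u at s = -1; for u \<le> 1
  no pole is passed. The line is moved to the side where |u^s| does not exceed u^c, and so far that
  |s| and |s + 1| are at least T on the three new sides. Their total length is at most 6T.\<close>

lemma perron_base:
  fixes u c T :: real
  assumes u: "u > 0" and c: "c > 0" and T: "T \<ge> 1 + c"
  shows "norm (contour_integral (vline c T) (\<lambda>s. of_real u powr s / (s * (s + 1)))
           - 2 * of_real pi * \<i> * of_real (max 0 (1 - 1 / u))) \<le> 6 * u powr c / T"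
proof -
  define f where "f = (\<lambda>s::complex. of_real u powr s / (s * (s + 1)))"
  have T0: "T > 1" using T c by simp
  have hol: "(\<lambda>s. of_real u powr s) holomorphic_on S" for S
    using u by (intro holomorphic_intros) (auto simp: complex_nonpos_Reals_iff)
  have fbound: "norm (f s) \<le> u powr c / T ^ 2"
    if "u powr Re s \<le> u powr c" "T \<le> norm s" "T \<le> norm (s + 1)" for s
  proof -
    have "norm (f s) = u powr Re s / (norm s * norm (s + 1))"
      using u by (simp add: f_def norm_divide norm_mult norm_powr_real_powr)
    also have "\<dots> \<le> u powr c / (T * T)"
      using that T0 by (intro frac_le mult_mono) auto
    finally show ?thesis by (simp add: power2_eq_square)
  qed
  have vbound: "norm (contour_integral (vline x T) f) \<le> u powr c / T ^ 2 * (2 * T)"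
    if "u powr x \<le> u powr c" "x \<ge> T \<or> x \<le> - T - 1" for x
  proof -
    have *: "T \<le> norm s \<and> T \<le> norm (s + 1)" if "Re s = x" for s
      using Re_Im_bounds(3-6)[of s] \<open>x \<ge> T \<or> x \<le> - T - 1\<close> that T0 by auto
    have nz: "s \<noteq> 0 \<and> s + 1 \<noteq> 0" if "Re s = x" for s
      using *[OF that] T0 by auto
    have "norm (contour_integral (vline x T) f) \<le> u powr c / T ^ 2 * norm (Complex x T - Complex x (-T))"
    proof (rule contour_integral_bound_linepath)
      show "f contour_integrable_on (vline x T)"
        unfolding f_def using T0 nz
        by (intro contour_integrable_vline continuous_intros holomorphic_on_imp_continuous_on[OF hol]) auto
      show "norm (f s) \<le> u powr c / T ^ 2" if "s \<in> closed_segment (Complex x (-T)) (Complex x T)" for s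
        using that T0 \<open>u powr x \<le> u powr c\<close> closed_segment_vline[of T s x] * by (intro fbound) auto
    qed (use T0 in auto)
    also have "Complex x T - Complex x (-T) = of_real (2 * T) * \<i>" by (simp add: complex_eq_iff)
    finally show ?thesis using T0 by (simp add: norm_mult)
  qed
  show ?thesis
  proof (cases "u \<le> 1")
    case True
    define x where "x = c + T"
    have pw: "u powr y \<le> u powr c" if "y \<ge> c" for y
      using that True u by (intro powr_mono') auto
    have holf: "f holomorphic_on re_gt 0"
      unfolding f_def using Re_pos_nonzero(3) by (intro holomorphic_intros hol) simp
    have "norm (contour_integral (vline x T) f - contour_integral (vline c T) f - 0) \<le> 2 * (x - c) * (u powr c / T ^ 2)"
    proof (rule rect_shift)
      show "continuous_on (path_image (rectpath (Complex c (- T)) (Complex x T))) f"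
      proof (rule holomorphic_on_imp_continuous_on[OF holomorphic_on_subset[OF holf]])
        show "path_image (rectpath (Complex c (- T)) (Complex x T)) \<subseteq> re_gt 0"
          using rectpath_subset_strip[of c x T] c T0 by (fastforce simp: x_def)
      qed
      show "(f has_contour_integral 0) (rectpath (Complex c (- T)) (Complex x T))"
        by (rule rect_cauchy_zero[OF _ _ holf c]) (use T0 in \<open>auto simp: x_def\<close>)
      show "norm (f s) \<le> u powr c / T ^ 2" if "c \<le> Re s" "\<bar>Im s\<bar> = T" for s
        by (rule fbound) (use that pw Re_Im_bounds(1,2)[of s T] in auto)
    qed (use T0 in \<open>auto simp: x_def\<close>)
    moreover have "norm (contour_integral (vline x T) f) \<le> u powr c / T ^ 2 * (2 * T)"
      by (rule vbound) (use T0 c pw in \<open>auto simp: x_def\<close>)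
    ultimately have "norm (contour_integral (vline c T) f) \<le> 2 * (x - c) * (u powr c / T ^ 2) + u powr c / T ^ 2 * (2 * T)"
      using norm_triangle_ineq4[of "contour_integral (vline x T) f" "contour_integral (vline x T) f - contour_integral (vline c T) f"]
      by simp
    also have "\<dots> = 4 * (u powr c / T)" using T0 by (simp add: x_def power2_eq_square)
    also have "\<dots> \<le> 6 * (u powr c / T)" using T0 by (intro mult_right_mono) auto
    finally have "norm (contour_integral (vline c T) f) \<le> 6 * u powr c / T" by simp
    moreover have "max 0 (1 - 1 / u) = 0"
      using True u by (intro max_absorb1) (simp add: field_simps)
    ultimately show ?thesis by (simp add: f_def)
  next
    case False
    define x where "x = - T - 1"
    have pw: "u powr y \<le> u powr c" if "y \<le> c" for y
      using that False by (intro powr_mono) auto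
    have xc: "x < c" using c T0 by (simp add: x_def)
    have split: "f s = of_real u powr s / (s - 0) - of_real u powr s / (s - (-1))"
      if "s \<noteq> 0" "s \<noteq> -1" for s
    proof -
      have "s + 1 \<noteq> 0" using that(2) by (simp add: eq_neg_iff_add_eq_0)
      thus ?thesis using that by (simp add: f_def field_simps)
    qed
    have hols: "(\<lambda>s. of_real u powr s) holomorphic_on re_gt (x - 1)" by (rule hol)
    have img: "path_image (rectpath (Complex x (-T)) (Complex c T)) =
       cbox (Complex x (-T)) (Complex c T) - box (Complex x (-T)) (Complex c T)"
      by (rule path_image_rectpath_cbox_minus_box) (use T0 xc in auto)
    have nz: "s \<noteq> 0 \<and> s \<noteq> -1 \<and> s + 1 \<noteq> 0" if "s \<in> path_image (rectpath (Complex x (-T)) (Complex c T))" for s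
    proof -
      have "s \<noteq> 0 \<and> s \<noteq> -1"
        using that T0 c unfolding img by (auto simp: in_cbox_complex_iff in_box_complex_iff x_def)
      thus ?thesis using eq_neg_iff_add_eq_0 by blast
    qed
    have "((\<lambda>s. of_real u powr s / (s - 0) - of_real u powr s / (s - (-1))) has_contour_integral
       2 * of_real pi * \<i> * (of_real u powr 0) - 2 * of_real pi * \<i> * (of_real u powr (-1))) (rectpath (Complex x (-T)) (Complex c T))"
      by (intro has_contour_integral_diff rect_cauchy[OF _ _ _ hols]) (use T0 c in \<open>auto simp: x_def\<close>)
    hence I: "(f has_contour_integral
       2 * of_real pi * \<i> * (of_real u powr 0) - 2 * of_real pi * \<i> * (of_real u powr (-1))) (rectpath (Complex x (-T)) (Complex c T))"
      by (rule has_contour_integral_eq) (use nz split in auto)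
    have "norm (contour_integral (vline c T) f - contour_integral (vline x T) f -
       (2 * of_real pi * \<i> * (of_real u powr 0) - 2 * of_real pi * \<i> * (of_real u powr (-1)))) \<le> 2 * (c - x) * (u powr c / T ^ 2)"
    proof (rule rect_shift[OF _ _ _ I])
      show "continuous_on (path_image (rectpath (Complex x (- T)) (Complex c T))) f"
        unfolding f_def using nz
        by (intro continuous_intros holomorphic_on_imp_continuous_on[OF hol]) auto
      show "norm (f s) \<le> u powr c / T ^ 2" if "Re s \<le> c" "\<bar>Im s\<bar> = T" for s
        by (rule fbound) (use that pw Re_Im_bounds(1,2)[of s T] in auto)
    qed (use T0 xc in auto)
    moreover have "norm (contour_integral (vline x T) f) \<le> u powr c / T ^ 2 * (2 * T)"
      by (rule vbound) (use T0 c pw[of x] xc in \<open>auto simp: x_def\<close>)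
    moreover have "2 * of_real pi * \<i> * (of_real u powr 0) - 2 * of_real pi * \<i> * (of_real u powr (-1))
       = 2 * of_real pi * \<i> * of_real (max 0 (1 - 1 / u))"
      using False u by (simp add: max_def powr_minus field_simps)
    ultimately have "norm (contour_integral (vline c T) f - 2 * of_real pi * \<i> * of_real (max 0 (1 - 1 / u)))
       \<le> 2 * (c - x) * (u powr c / T ^ 2) + u powr c / T ^ 2 * (2 * T)"
      using norm_triangle_ineq[of "contour_integral (vline c T) f - contour_integral (vline x T) f -
        2 * of_real pi * \<i> * of_real (max 0 (1 - 1 / u))" "contour_integral (vline x T) f"]
      by (simp add: algebra_simps)
    also have "\<dots> \<le> 2 * (2 * T) * (u powr c / T ^ 2) + u powr c / T ^ 2 * (2 * T)"
      using T by (intro add_mono mult_right_mono mult_left_mono) (auto simp: x_def)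
    also have "\<dots> = 6 * u powr c / T" using T0 by (simp add: power2_eq_square)
    finally show ?thesis by (simp add: f_def)
  qed
qed

text \<open>Averaging \<open>u \<mapsto> \<Sum>\<^sub>n\<^sub>\<le>\<^sub>u c\<^sub>n\<close> over \<open>[N, N + 1]\<close> does not change its value at \<open>N\<close>, but replaces the
  kernel \<open>N\<^sup>s / s\<close> of Perron's formula by the following absolutely integrable one.\<close>

definition perron_ker :: "nat \<Rightarrow> complex \<Rightarrow> complex" where
  "perron_ker N s = (of_nat (N + 1) powr (s + 1) - of_nat N powr (s + 1)) / (s * (s + 1))"

lemma holomorphic_perron_ker:
  assumes "N > 0"
  shows "perron_ker N holomorphic_on re_gt 0"
proof -
  have "s * (s + 1) \<noteq> 0" if "s \<in> re_gt 0" for s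
    using that Re_pos_nonzero(3)[of s] by simp
  thus ?thesis unfolding perron_ker_def [abs_def]
    using assms by (intro holomorphic_intros) auto
qed

text \<open>The kernel is a difference of two integrands of \<open>perron_base\<close>, at M = N + 1
  and M = N, each weighted with M. The corresponding values max(0, M - n) differ by exactly the
  indicator of n \<le> N, also for n = N + 1, so no special term arises for n close to N.\<close>

lemma perron_single:
  fixes n N :: nat
  assumes "n > 0" "N > 0" "c > 0" "T \<ge> 1 + c"
  shows "norm (contour_integral (vline c T) (\<lambda>s. of_nat n powr (-s) * perron_ker N s)
     - 2 * of_real pi * \<i> * (if n \<le> N then 1 else 0))
     \<le> 12 * real (N + 1) powr (c + 1) * real n powr (-c) / T"
proof -
  define h where "h = (\<lambda>M::nat. \<lambda>s::complex. of_real (real M / real n) powr s / (s * (s + 1)))"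
  have cont: "continuous_on {s. Re s = c \<and> \<bar>Im s\<bar> \<le> T} (h M)" if "M > 0" for M
  proof -
    have "s * (s + 1) \<noteq> 0" if "s \<in> {s. Re s = c \<and> \<bar>Im s\<bar> \<le> T}" for s
      using that assms(3) Re_pos_nonzero(3)[of s] by simp
    moreover have "(\<lambda>s. of_real (real M / real n) powr s) holomorphic_on UNIV"
      using that assms by (auto intro!: holomorphic_intros simp: complex_nonpos_Reals_iff)
    ultimately show ?thesis unfolding h_def
      by (intro continuous_intros continuous_on_subset[OF holomorphic_on_imp_continuous_on]) auto
  qed
  have eq: "of_nat n powr (-s) * perron_ker N s = of_nat (N + 1) * h (N + 1) s - of_nat N * h N s" for s
  proof -
    have "of_real (real M / real n) powr s = (of_nat M powr s * of_nat n powr (-s) :: complex)" if "M > 0" for M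
    proof -
      have "of_real (real M / real n) * of_nat n = (of_nat M :: complex)" using assms(1) by simp
      hence "of_nat M powr s = (of_real (real M / real n) powr s * of_nat n powr s :: complex)"
        using powr_times_real[of "of_real (real M / real n)" "of_nat n" s] by simp
      moreover have "of_nat n powr (-s) * of_nat n powr s = (1 :: complex)"
        using assms(1) by (simp flip: powr_add)
      ultimately show ?thesis by (simp add: mult.assoc mult.commute)
    qed
    moreover have "of_nat M powr (s + 1) = (of_nat M * of_nat M powr s :: complex)" if "M > 0" for M
      using that by (simp add: powr_add)
    ultimately show ?thesis
      using assms(2) by (simp add: perron_ker_def h_def diff_divide_distrib right_diff_distrib mult_ac del: of_nat_Suc)
  qed
  have int: "h M contour_integrable_on (vline c T)" if "M > 0" for M
    using cont[OF that] assms by (intro contour_integrable_vline) auto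
  have CI: "contour_integral (vline c T) (\<lambda>s. of_nat n powr (-s) * perron_ker N s) =
      of_nat (N + 1) * contour_integral (vline c T) (h (N + 1)) - of_nat N * contour_integral (vline c T) (h N)"
    unfolding eq using int[of N] int[of "N + 1"] assms(2)
    by (simp add: contour_integral_diff contour_integral_lmul contour_integrable_lmul del: of_nat_Suc of_nat_add)
  have W: "(if n \<le> N then 1 else 0 :: complex) =
     of_nat (N + 1) * of_real (max 0 (1 - 1 / (real (N + 1) / real n))) - of_nat N * of_real (max 0 (1 - 1 / (real N / real n)))"
  proof -
    have *: "real M * max 0 (1 - 1 / (real M / real n)) = max 0 (real M - real n)" if "M > 0" for M
      using that by (simp add: max_def field_simps)
    have "(if n \<le> N then 1 else 0) = real (N + 1) * max 0 (1 - 1 / (real (N + 1) / real n)) - real N * max 0 (1 - 1 / (real N / real n))"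
      using *[of N] *[of "N + 1"] assms(2) by auto
    hence "complex_of_real (if n \<le> N then 1 else 0) = of_real (real (N + 1) * max 0 (1 - 1 / (real (N + 1) / real n)) - real N * max 0 (1 - 1 / (real N / real n)))"
      by (rule arg_cong)
    moreover have "complex_of_real (if n \<le> N then 1 else 0) = (if n \<le> N then 1 else 0)" by simp
    ultimately show ?thesis by (simp only: of_real_diff of_real_mult of_real_of_nat_eq)
  qed
  define E where "E = (\<lambda>M::nat. contour_integral (vline c T) (h M) - 2 * of_real pi * \<i> * of_real (max 0 (1 - 1 / (real M / real n))))"
  have E: "norm (of_nat M * E M) \<le> 6 * real (N + 1) powr (c + 1) * real n powr (-c) / T" if "M > 0" "M \<le> N + 1" for M
  proof -
    have "norm (E M) \<le> 6 * (real M / real n) powr c / T"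
      unfolding E_def h_def by (rule perron_base) (use that assms in auto)
    also have "(real M / real n) powr c = real M powr c * real n powr (-c)"
      using that assms by (simp add: powr_divide powr_minus_divide)
    finally have "real M * norm (E M) \<le> real M * (6 * (real M powr c * real n powr (-c)) / T)"
      by (intro mult_left_mono) auto
    also have "\<dots> = 6 * real M powr (c + 1) * real n powr (-c) / T"
      using that by (simp add: powr_add)
    also have "\<dots> \<le> 6 * real (N + 1) powr (c + 1) * real n powr (-c) / T"
      using that assms by (intro divide_right_mono mult_right_mono mult_left_mono powr_mono2) auto
    finally show ?thesis by (simp add: norm_mult)
  qed
  have "contour_integral (vline c T) (\<lambda>s. of_nat n powr (-s) * perron_ker N s)
     - 2 * of_real pi * \<i> * (if n \<le> N then 1 else 0) = of_nat (N + 1) * E (N + 1) - of_nat N * E N"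
    unfolding CI W E_def by (simp add: algebra_simps)
  also have "norm \<dots> \<le> 6 * real (N + 1) powr (c + 1) * real n powr (-c) / T + 6 * real (N + 1) powr (c + 1) * real n powr (-c) / T"
    by (intro order_trans[OF norm_triangle_ineq4] add_mono E) (use assms in auto)
  also have "\<dots> = 12 * real (N + 1) powr (c + 1) * real n powr (-c) / T" by simp
  finally show ?thesis .
qed

text \<open>The index set is arbitrary so that the formula applies directly to triples, without
  collecting the coefficients of a Dirichlet series. Summing the errors of
  \<open>perron_single\<close> leaves O(1/T) because of the absolute convergence on Re s =
  c.\<close>

lemma perron_formula:
  fixes w :: "'i \<Rightarrow> complex" and l :: "'i \<Rightarrow> nat"
  assumes N: "N > 0" and c: "c > 0" and l: "\<And>i. i \<in> I \<Longrightarrow> l i > 0"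
    and sm: "(\<lambda>i. norm (w i) * real (l i) powr (-c)) summable_on I"
    and \<Phi>: "\<And>s. Re s = c \<Longrightarrow> ((\<lambda>i. w i * of_nat (l i) powr (-s)) has_sum \<Phi> s) I"
  shows "((\<lambda>T. contour_integral (vline c T) (\<lambda>s. \<Phi> s * perron_ker N s)) \<longlongrightarrow>
           2 * of_real pi * \<i> * (\<Sum>\<^sub>\<infinity>i\<in>I. if l i \<le> N then w i else 0)) at_top"
proof -
  define S where "S = (\<Sum>\<^sub>\<infinity>i\<in>I. norm (w i) * real (l i) powr (-c))"
  define F where "F = (\<lambda>T i. contour_integral (vline c T) (\<lambda>s. of_nat (l i) powr (-s) * perron_ker N s))"
  have kcont: "continuous_on {s. Re s = c \<and> \<bar>Im s\<bar> \<le> T} (perron_ker N)" for T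
    by (intro holomorphic_on_imp_continuous_on holomorphic_on_subset[OF holomorphic_perron_ker[OF N]]) (use c in auto)
  have wsum: "(\<lambda>i. if l i \<le> N then w i else 0) summable_on I"
  proof (rule abs_summable_summable, rule Infinite_Sum.abs_summable_on_comparison_test'[OF summable_on_cmult_right[OF sm, of "real N powr c"]])
    fix i assume i: "i \<in> I"
    show "norm (if l i \<le> N then w i else 0) \<le> real N powr c * (norm (w i) * real (l i) powr - c)"
    proof (cases "l i \<le> N")
      case True
      have "1 \<le> (real N / real (l i)) powr c"
        using True l[OF i] c by (intro ge_one_powr_ge_zero) auto
      also have "\<dots> = real N powr c * real (l i) powr (-c)"
        using l[OF i] by (simp add: powr_divide powr_minus_divide)
      finally have "norm (w i) * 1 \<le> norm (w i) * (real N powr c * real (l i) powr (-c))"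
        by (intro mult_left_mono) auto
      thus ?thesis using True by (simp add: mult_ac)
    qed auto
  qed
  have main: "norm (contour_integral (vline c T) (\<lambda>s. \<Phi> s * perron_ker N s)
      - 2 * of_real pi * \<i> * (\<Sum>\<^sub>\<infinity>i\<in>I. if l i \<le> N then w i else 0)) \<le> 12 * real (N + 1) powr (c + 1) * S / T"
    if T: "T \<ge> 1 + c" for T
  proof -
    have T0: "T > 0" using T c by simp
    have "compact {s. Re s = c \<and> \<bar>Im s\<bar> \<le> T}"
    proof -
      have "{s. Re s = c \<and> \<bar>Im s\<bar> \<le> T} = closed_segment (Complex c (-T)) (Complex c T)"
        using closed_segment_vline[of T] T0 by auto
      thus ?thesis by simp
    qed
    from compact_imp_bounded[OF compact_continuous_image[OF kcont this]]
    obtain B where B: "\<And>s. Re s = c \<Longrightarrow> \<bar>Im s\<bar> \<le> T \<Longrightarrow> norm (perron_ker N s) \<le> B"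
      unfolding bounded_iff by blast
    have B0: "B \<ge> 0" using order_trans[OF norm_ge_zero B[of "Complex c 0"]] T0 by simp
    have pathim: "path_image (vline c T) = {s. Re s = c \<and> \<bar>Im s\<bar> \<le> T}"
      using closed_segment_vline[of T] T0 by auto
    have term_cont: "continuous_on {s. Re s = c \<and> \<bar>Im s\<bar> \<le> T} (\<lambda>s. of_nat (l i) powr (-s) * perron_ker N s)" if "i \<in> I" for i
    proof -
      have "(\<lambda>s. of_nat (l i) powr (-s)) holomorphic_on UNIV"
        using l[OF that] by (intro holomorphic_intros) auto
      thus ?thesis
        by (intro continuous_intros kcont continuous_on_subset[OF holomorphic_on_imp_continuous_on]) auto
    qed
    \<comment> \<open>On the compact segment the kernel is bounded, so the series converges
      uniformly there and may be integrated termwise.\<close>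
    have ul: "uniform_limit (path_image (vline c T)) (\<lambda>J s. \<Sum>i\<in>J. w i * (of_nat (l i) powr (-s) * perron_ker N s))
       (\<lambda>s. \<Phi> s * perron_ker N s) (finite_subsets_at_top I)"
    proof (rule Weierstrass_m_test_general')
      show "norm (w i * (of_nat (l i) powr (-s) * perron_ker N s)) \<le> norm (w i) * real (l i) powr (-c) * B"
        if "i \<in> I" "s \<in> path_image (vline c T)" for i s
        using that l[OF that(1)] B[of s] unfolding pathim
        by (auto simp: norm_mult norm_nat_powr mult.assoc intro!: mult_left_mono)
      show "((\<lambda>i. w i * (of_nat (l i) powr (-s) * perron_ker N s)) has_sum \<Phi> s * perron_ker N s) I"
        if "s \<in> path_image (vline c T)" for s
        using has_sum_cmult_left[OF \<Phi>[of s], of "perron_ker N s"] that unfolding pathim by (simp add: mult.assoc)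
      show "(\<lambda>i. norm (w i) * real (l i) powr (-c) * B) summable_on I"
        by (intro summable_on_cmult_left sm)
    qed
    have int1: "(\<lambda>s. of_nat (l i) powr (-s) * perron_ker N s) contour_integrable_on vline c T" if "i \<in> I" for i
      by (intro contour_integrable_vline term_cont that) (use T0 in auto)
    have CIsum: "contour_integral (vline c T) (\<lambda>s. \<Sum>i\<in>J. w i * (of_nat (l i) powr (-s) * perron_ker N s))
       = (\<Sum>i\<in>J. w i * F T i)" if "finite J" "J \<subseteq> I" for J
      using that int1 by (subst contour_integral_sum)
        (auto simp: F_def contour_integral_lmul contour_integrable_lmul subset_iff intro!: sum.cong)
    have ev: "eventually (\<lambda>J. finite J \<and> J \<subseteq> I) (finite_subsets_at_top I)"
      by (simp add: eventually_finite_subsets_at_top_weakI)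
    have "((\<lambda>J. contour_integral (vline c T) (\<lambda>s. \<Sum>i\<in>J. w i * (of_nat (l i) powr (-s) * perron_ker N s))) \<longlongrightarrow>
      contour_integral (vline c T) (\<lambda>s. \<Phi> s * perron_ker N s)) (finite_subsets_at_top I)"
    proof (rule contour_integral_uniform_limit(2)[OF _ ul])
      show "\<forall>\<^sub>F J in finite_subsets_at_top I. (\<lambda>s. \<Sum>i\<in>J. w i * (of_nat (l i) powr (-s) * perron_ker N s)) contour_integrable_on vline c T"
        using ev by eventually_elim (use int1 in \<open>auto intro!: contour_integrable_sum contour_integrable_lmul\<close>)
      show "norm (vector_derivative (vline c T) (at t)) \<le> norm (Complex c T - Complex c (-T))" for t
        by simp
    qed auto
    hence "((\<lambda>J. \<Sum>i\<in>J. w i * F T i) \<longlongrightarrow> contour_integral (vline c T) (\<lambda>s. \<Phi> s * perron_ker N s)) (finite_subsets_at_top I)"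
      by (rule Lim_transform_eventually) (use ev in eventually_elim, use CIsum in auto)
    hence hs1: "((\<lambda>i. w i * F T i) has_sum contour_integral (vline c T) (\<lambda>s. \<Phi> s * perron_ker N s)) I"
      by (simp add: has_sum_def)
    have hs2: "((\<lambda>i. 2 * of_real pi * \<i> * (if l i \<le> N then w i else 0)) has_sum
        2 * of_real pi * \<i> * (\<Sum>\<^sub>\<infinity>i\<in>I. if l i \<le> N then w i else 0)) I"
      by (intro has_sum_cmult_right has_sum_infsum wsum)
    have hs3: "((\<lambda>i. 12 * real (N + 1) powr (c + 1) / T * (norm (w i) * real (l i) powr (-c))) has_sum
        12 * real (N + 1) powr (c + 1) / T * S) I"
      unfolding S_def by (intro has_sum_cmult_right has_sum_infsum sm)
    have "norm (contour_integral (vline c T) (\<lambda>s. \<Phi> s * perron_ker N s) - 2 * of_real pi * \<i> * (\<Sum>\<^sub>\<infinity>i\<in>I. if l i \<le> N then w i else 0))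
       \<le> 12 * real (N + 1) powr (c + 1) / T * S"
    proof (rule norm_infsum_le[OF has_sum_diff_complex[OF hs1 hs2] hs3])
      fix i assume i: "i \<in> I"
      have "w i * F T i - 2 * of_real pi * \<i> * (if l i \<le> N then w i else 0) =
         w i * (F T i - 2 * of_real pi * \<i> * (if l i \<le> N then 1 else 0))" by (simp add: algebra_simps)
      also have "norm \<dots> \<le> norm (w i) * (12 * real (N + 1) powr (c + 1) * real (l i) powr (-c) / T)"
        unfolding norm_mult F_def by (intro mult_left_mono perron_single l[OF i] N c T) auto
      finally show "norm (w i * F T i - 2 * of_real pi * \<i> * (if l i \<le> N then w i else 0)) \<le>
          12 * real (N + 1) powr (c + 1) / T * (norm (w i) * real (l i) powr (-c))" by (simp add: mult_ac)
    qed
    thus ?thesis by simp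
  qed
  have "((\<lambda>T. contour_integral (vline c T) (\<lambda>s. \<Phi> s * perron_ker N s)
      - 2 * of_real pi * \<i> * (\<Sum>\<^sub>\<infinity>i\<in>I. if l i \<le> N then w i else 0)) \<longlongrightarrow> 0) at_top"
  proof (rule Lim_null_comparison)
    show "\<forall>\<^sub>F T in at_top. norm (contour_integral (vline c T) (\<lambda>s. \<Phi> s * perron_ker N s)
      - 2 * of_real pi * \<i> * (\<Sum>\<^sub>\<infinity>i\<in>I. if l i \<le> N then w i else 0)) \<le> 12 * real (N + 1) powr (c + 1) * S / T"
      using eventually_ge_at_top[of "1 + c"] by eventually_elim (rule main)
    show "((\<lambda>T. 12 * real (N + 1) powr (c + 1) * S / T) \<longlongrightarrow> 0) at_top"
      by (intro tendsto_divide_0[OF tendsto_const] filterlim_at_top_imp_at_infinity filterlim_ident)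
  qed
  thus ?thesis by (simp add: LIM_zero_iff)
qed

section \<open>Tails of the Moebius series\<close>

text \<open>Two regimes: the mean value inequality on [N, N + 1] saves a factor N but leaves one
  power of |s| in the denominator; estimating the two powers separately leaves two.\<close>

lemma perron_ker_bounds:
  assumes N: "N > 0" and s: "Re s > 0"
  shows "norm (perron_ker N s) \<le> real (N + 1) powr Re s / norm s"
    and "norm (perron_ker N s) \<le> 2 * real (N + 1) powr (Re s + 1) / norm s ^ 2"
proof -
  note nz = Re_pos_nonzero[OF s]
  define S where "S = closed_segment (of_nat N) (of_nat (N + 1) :: complex)"
  have S: "\<exists>y. x = of_real y \<and> real N \<le> y \<and> y \<le> real (N + 1)" if "x \<in> S" for x
  proof -
    have "x \<in> of_real ` closed_segment (real N) (real (N + 1))"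
      using that unfolding S_def by (metis closed_segment_of_real of_real_of_nat_eq)
    thus ?thesis by (auto simp: closed_segment_eq_real_ivl)
  qed
  have "norm (of_nat (N + 1) powr (s + 1) - of_nat N powr (s + 1) :: complex)
      \<le> (norm (s + 1) * real (N + 1) powr Re s) * norm (of_nat (N + 1) - of_nat N :: complex)"
  proof (rule field_differentiable_bound[where S = S and f' = "\<lambda>x. (s + 1) * x powr (s + 1 - 1)"])
    fix x assume x: "x \<in> S"
    then obtain y where y: "x = of_real y" "y \<ge> real N" "y \<le> real (N + 1)" using S by blast
    hence "x \<notin> \<real>\<^sub>\<le>\<^sub>0" using N by (auto simp: complex_nonpos_Reals_iff)
    thus "((\<lambda>x. x powr (s + 1)) has_field_derivative (s + 1) * x powr (s + 1 - 1)) (at x within S)"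
      by (intro has_field_derivative_at_within[OF has_field_derivative_powr])
    have "norm (x powr (s + 1 - 1)) = y powr Re s"
      using y N by (simp add: norm_powr_real_powr)
    also have "\<dots> \<le> real (N + 1) powr Re s" using y N s by (intro powr_mono2) auto
    finally show "norm ((s + 1) * x powr (s + 1 - 1)) \<le> norm (s + 1) * real (N + 1) powr Re s"
      unfolding norm_mult by (intro mult_left_mono) auto
  qed (auto simp: S_def)
  also have "\<dots> = norm (s + 1) * real (N + 1) powr Re s" by simp
  finally have "norm (perron_ker N s) \<le> norm (s + 1) * real (N + 1) powr Re s / (norm s * norm (s + 1))"
    unfolding perron_ker_def norm_divide norm_mult by (intro divide_right_mono) auto
  also have "\<dots> = real (N + 1) powr Re s / norm s" using nz by simp
  finally show "norm (perron_ker N s) \<le> real (N + 1) powr Re s / norm s" .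
  have "norm (of_nat (N + 1) powr (s + 1) - of_nat N powr (s + 1) :: complex) \<le>
     norm (of_nat (N + 1) powr (s + 1) :: complex) + norm (of_nat N powr (s + 1) :: complex)"
    by (rule norm_triangle_ineq4)
  also have "\<dots> = real (N + 1) powr (Re s + 1) + real N powr (Re s + 1)"
    using N by (subst (1 2) norm_nat_powr) auto
  also have "real N powr (Re s + 1) \<le> real (N + 1) powr (Re s + 1)" using s by (intro powr_mono2) auto
  finally have 1: "norm (of_nat (N + 1) powr (s + 1) - of_nat N powr (s + 1) :: complex) \<le> 2 * real (N + 1) powr (Re s + 1)"
    by simp
  have "norm s ^ 2 \<le> norm (s + 1) ^ 2" unfolding cmod_power2 using s by (simp add: power2_eq_square algebra_simps)
  hence "norm s \<le> norm (s + 1)" by (rule power2_le_imp_le) simp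
  hence "norm s * norm s \<le> norm s * norm (s + 1)" by (intro mult_left_mono) auto
  with 1 show "norm (perron_ker N s) \<le> 2 * real (N + 1) powr (Re s + 1) / norm s ^ 2"
    unfolding perron_ker_def norm_divide norm_mult power2_eq_square
    using nz by (intro frac_le) auto
qed

text \<open>Weighted geometric mean, with exponents 1 - \<theta> and \<theta>, of the bounds in
  \<open>perron_ker_bounds\<close>: just enough decay in t for absolute convergence, at the price of
  N^\<theta>.\<close>

lemma perron_ker_line_bound:
  fixes \<sigma> \<theta> :: real
  assumes \<sigma>: "\<sigma> > 0" and \<theta>: "0 < \<theta>" "\<theta> \<le> 1"
  shows "\<exists>C>0. \<forall>N>0. \<forall>t. norm (perron_ker N (Complex \<sigma> t)) \<le> C * real N powr (\<sigma> + \<theta>) * (1 + \<bar>t\<bar>) powr (-1 - \<theta>)"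
proof -
  \<comment> \<open>Chosen so that |s| \<ge> m (1 + |t|) on the line: the imaginary part gives this
    for |t| \<ge> 1, the real part \<sigma> for small t.\<close>
  define m where "m = min \<sigma> 1 / 2"
  have m: "m > 0" "2 * m \<le> \<sigma>" "2 * m \<le> 1" using \<sigma> by (auto simp: m_def)
  show ?thesis
  proof (intro exI[of _ "2 * 2 powr (\<sigma> + \<theta>) * m powr (-1 - \<theta>)"] conjI allI impI)
    show "2 * 2 powr (\<sigma> + \<theta>) * m powr (-1 - \<theta>) > 0" using m by simp
    fix N :: nat and t :: real assume N: "N > 0"
    define s where "s = Complex \<sigma> t"
    define k where "k = norm (perron_ker N s)"
    define A where "A = real (N + 1) powr \<sigma> / norm s"
    define B where "B = 2 * real (N + 1) powr (\<sigma> + 1) / norm s ^ 2"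
    have s: "Re s > 0" "Re s = \<sigma>" "Im s = t" using \<sigma> by (auto simp: s_def)
    have ns: "norm s \<ge> m * (1 + \<bar>t\<bar>)"
    proof (cases "\<bar>t\<bar> \<ge> 1")
      case True
      have "m * (1 + \<bar>t\<bar>) \<le> m * (2 * \<bar>t\<bar>)" using True m by (intro mult_left_mono) auto
      also have "\<dots> \<le> 1 * \<bar>t\<bar>" using m mult_right_mono[of "2 * m" 1 "\<bar>t\<bar>"] by (simp add: mult_ac)
      also have "\<dots> \<le> norm s" using abs_Im_le_cmod[of s] s by simp
      finally show ?thesis .
    next
      case False
      have "m * (1 + \<bar>t\<bar>) \<le> m * 2" using False m by (intro mult_left_mono) auto
      also have "\<dots> \<le> \<sigma>" using m by simp
      also have "\<dots> \<le> norm s" using complex_Re_le_cmod[of s] s by simp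
      finally show ?thesis .
    qed
    have mt: "m * (1 + \<bar>t\<bar>) > 0" using m by simp
    hence s0: "norm s > 0" using ns by linarith
    have kA: "k \<le> A" and kB: "k \<le> B"
      using perron_ker_bounds[OF N s(1)] s by (auto simp: k_def A_def B_def)
    have k0: "k \<ge> 0" by (simp add: k_def)
    have "k = k powr (1 - \<theta>) * k powr \<theta>"
      using k0 by (cases "k = 0") (auto simp flip: powr_add)
    also have "\<dots> \<le> A powr (1 - \<theta>) * B powr \<theta>"
      using kA kB k0 \<theta> by (intro mult_mono powr_mono2) auto
    also have "\<dots> = 2 powr \<theta> * real (N + 1) powr (\<sigma> + \<theta>) * norm s powr (-1 - \<theta>)"
    proof -
      have "A powr (1 - \<theta>) = real (N + 1) powr (\<sigma> * (1 - \<theta>)) * norm s powr (- (1 - \<theta>))"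
        using s0 powr_minus_divide[of "norm s" "1 - \<theta>"] by (simp add: A_def powr_divide powr_powr del: of_nat_Suc of_nat_add)
      moreover have "B powr \<theta> = 2 powr \<theta> * real (N + 1) powr ((\<sigma> + 1) * \<theta>) * norm s powr (- (2 * \<theta>))"
        using s0 by (simp add: B_def powr_divide powr_mult powr_powr powr_minus_divide power2_eq_square powr_add [symmetric] del: of_nat_Suc of_nat_add)
      ultimately have "A powr (1 - \<theta>) * B powr \<theta> = 2 powr \<theta> * (real (N + 1) powr (\<sigma> * (1 - \<theta>)) * real (N + 1) powr ((\<sigma> + 1) * \<theta>))
         * (norm s powr (- (1 - \<theta>)) * norm s powr (- (2 * \<theta>)))" by (simp only: mult_ac)
      also have "real (N + 1) powr (\<sigma> * (1 - \<theta>)) * real (N + 1) powr ((\<sigma> + 1) * \<theta>) = real (N + 1) powr (\<sigma> + \<theta>)"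
        by (simp add: powr_add [symmetric] algebra_simps)
      also have "norm s powr (- (1 - \<theta>)) * norm s powr (- (2 * \<theta>)) = norm s powr (-1 - \<theta>)"
        by (simp add: powr_add [symmetric] algebra_simps)
      finally show ?thesis .
    qed
    also have "\<dots> \<le> 2 powr 1 * (2 powr (\<sigma> + \<theta>) * real N powr (\<sigma> + \<theta>)) * (m powr (-1 - \<theta>) * (1 + \<bar>t\<bar>) powr (-1 - \<theta>))"
    proof (intro mult_mono)
      have "real (N + 1) powr (\<sigma> + \<theta>) \<le> (2 * real N) powr (\<sigma> + \<theta>)"
        using N \<sigma> \<theta> by (intro powr_mono2) auto
      thus "real (N + 1) powr (\<sigma> + \<theta>) \<le> 2 powr (\<sigma> + \<theta>) * real N powr (\<sigma> + \<theta>)"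
        by (simp add: powr_mult)
      have "norm s powr (-1 - \<theta>) \<le> (m * (1 + \<bar>t\<bar>)) powr (-1 - \<theta>)"
        using ns mt \<theta> by (intro powr_mono2') auto
      thus "norm s powr (-1 - \<theta>) \<le> m powr (-1 - \<theta>) * (1 + \<bar>t\<bar>) powr (-1 - \<theta>)"
        using m by (subst powr_mult [symmetric]) auto
    qed (use \<theta> powr_mono[of \<theta> 1 2] in auto)
    finally show "norm (perron_ker N (Complex \<sigma> t)) \<le>
       2 * 2 powr (\<sigma> + \<theta>) * m powr (-1 - \<theta>) * real N powr (\<sigma> + \<theta>) * (1 + \<bar>t\<bar>) powr (-1 - \<theta>)"
      by (simp add: k_def s_def mult_ac)
  qed
qed

section \<open>Integrals over vertical lines and the shift of the line of integration\<close>

lemma half_vline_bound: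
  fixes f :: "complex \<Rightarrow> complex"
  assumes T: "T \<ge> 0" and e: "e > 0" and y: "\<bar>y\<bar> = 1" and B: "B \<ge> 0"
    and cont: "f contour_integrable_on linepath (Complex x 0) (Complex x (y * T))"
    and f: "\<And>t. norm (f (Complex x t)) \<le> B * (1 + \<bar>t\<bar>) powr (-1 - e)"
  shows "norm (contour_integral (linepath (Complex x 0) (Complex x (y * T))) f) \<le> B / e"
proof -
  \<comment> \<open>A primitive of the bound for the integrand along the path; its increment is at
    most B / e, whatever T is.\<close>
  define g where "g = (\<lambda>u. - (B / e) * (1 + T * u) powr (-e))"
  have d: "Complex x (y * T) - Complex x 0 = of_real (y * T) * \<i>" by (simp add: complex_eq_iff)
  have FTC: "((\<lambda>u. B * T * (1 + T * u) powr (-1 - e)) has_integral (g 1 - g 0)) {0..1}"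
  proof (rule fundamental_theorem_of_calculus)
    fix u :: real assume u: "u \<in> {0..1}"
    have "1 + T * u > 0" using T u by (smt (verit) atLeastAtMost_iff mult_nonneg_nonneg)
    hence pw: "((\<lambda>z. z powr (-e)) has_real_derivative - e * (1 + T * u) powr (-e - 1)) (at (1 + T * u))"
      by (rule has_real_derivative_powr)
    have lin: "((\<lambda>u. 1 + T * u) has_real_derivative T) (at u within {0..1})"
      by (auto intro!: derivative_eq_intros)
    from DERIV_cmult[OF DERIV_chain2[where g = "\<lambda>u. 1 + T * u", OF pw lin], of "- (B / e)"]
    have "((\<lambda>u. - (B / e) * (1 + T * u) powr (-e)) has_real_derivative
        - (B / e) * (- e * (1 + T * u) powr (-e - 1) * T)) (at u within {0..1})" .
    moreover have "- (B / e) * (- e * (1 + T * u) powr (-e - 1) * T) = B * T * (1 + T * u) powr (-1 - e)"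
    proof -
      have "-e - 1 = -1 - e" by simp
      thus ?thesis using e by (simp only:) simp
    qed
    ultimately have "(g has_real_derivative B * T * (1 + T * u) powr (-1 - e)) (at u within {0..1})"
      unfolding g_def by (simp only:)
    thus "(g has_vector_derivative B * T * (1 + T * u) powr (-1 - e)) (at u within {0..1})"
      by (simp add: has_real_derivative_iff_has_vector_derivative)
  qed auto
  have lp: "linepath (Complex x 0) (Complex x (y * T)) u = Complex x (y * T * u)" for u
    by (simp add: linepath_def complex_eq_iff algebra_simps)
  have int: "((\<lambda>u. f (linepath (Complex x 0) (Complex x (y * T)) u) * (Complex x (y * T) - Complex x 0)) has_integral
      contour_integral (linepath (Complex x 0) (Complex x (y * T))) f) {0..1}"
    using has_contour_integral_integral[OF cont] by (simp only: has_contour_integral_linepath)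
  have "norm (integral {0..1} (\<lambda>u. f (linepath (Complex x 0) (Complex x (y * T)) u) * (Complex x (y * T) - Complex x 0)))
     \<le> integral {0..1} (\<lambda>u. B * T * (1 + T * u) powr (-1 - e))"
  proof (rule integral_norm_bound_integral)
    fix u :: real assume u: "u \<in> {0..1}"
    have "norm (f (Complex x (y * T * u)) * (of_real (y * T) * \<i>)) = norm (f (Complex x (y * T * u))) * T"
      using y T by (simp add: norm_mult abs_mult)
    also have "\<dots> \<le> B * (1 + \<bar>y * T * u\<bar>) powr (-1 - e) * T" using T by (intro mult_right_mono f) auto
    also have "\<bar>y * T * u\<bar> = T * u" using y T u by (simp add: abs_mult)
    finally show "norm (f (linepath (Complex x 0) (Complex x (y * T)) u) * (Complex x (y * T) - Complex x 0)) \<le> B * T * (1 + T * u) powr (-1 - e)"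
      unfolding lp d by (simp add: mult_ac)
  qed (use int FTC in \<open>auto simp: has_integral_iff\<close>)
  also have "\<dots> = g 1 - g 0" using FTC by (simp add: has_integral_iff)
  also have "\<dots> \<le> B / e" using B e by (simp add: g_def)
  finally show ?thesis using int by (simp add: has_integral_iff)
qed

lemma vline_bound:
  fixes f :: "complex \<Rightarrow> complex"
  assumes T: "T \<ge> 0" and e: "e > 0" and B: "B \<ge> 0"
    and cont: "continuous_on {s. Re s = x \<and> \<bar>Im s\<bar> \<le> T} f"
    and f: "\<And>t. norm (f (Complex x t)) \<le> B * (1 + \<bar>t\<bar>) powr (-1 - e)"
  shows "norm (contour_integral (vline x T) f) \<le> 2 * B / e"
proof -
  have seg: "closed_segment (Complex x (-T)) (Complex x T) = {s. Re s = x \<and> \<bar>Im s\<bar> \<le> T}"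
    using closed_segment_vline[OF T] by auto
  have int: "f contour_integrable_on linepath (Complex x p) (Complex x q)" if "\<bar>p\<bar> \<le> T" "\<bar>q\<bar> \<le> T" for p q
  proof (rule contour_integrable_continuous_linepath[OF continuous_on_subset[OF cont]])
    show "closed_segment (Complex x p) (Complex x q) \<subseteq> {s. Re s = x \<and> \<bar>Im s\<bar> \<le> T}"
      using that by (auto simp: closed_segment_same_Re closed_segment_eq_real_ivl split: if_splits)
  qed
  have "contour_integral (vline x T) f = contour_integral (linepath (Complex x (-T)) (Complex x 0)) f +
     contour_integral (linepath (Complex x 0) (Complex x T)) f"
    by (rule contour_integral_split_linepath) (use cont T in \<open>auto simp: seg\<close>)
  also have "contour_integral (linepath (Complex x (-T)) (Complex x 0)) f = - contour_integral (linepath (Complex x 0) (Complex x (-1 * T))) f"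
    by (metis contour_integral_reversepath mult_minus1 reversepath_linepath valid_path_linepath)
  finally have "norm (contour_integral (vline x T) f) \<le> norm (contour_integral (linepath (Complex x 0) (Complex x (-1 * T))) f)
     + norm (contour_integral (linepath (Complex x 0) (Complex x (1 * T))) f)"
    by (metis mult_1 norm_minus_cancel norm_triangle_ineq)
  also have "\<dots> \<le> B / e + B / e"
    by (intro add_mono half_vline_bound[OF T e _ B _ f] int) (use T in auto)
  finally show ?thesis by simp
qed

text \<open>The horizontal sides disappear as T grows because of the decay 1/|Im s|, and the line at
  x0 has a bound independent of T. The exceptional points P lie on the real axis strictly between
  the lines, hence never on the boundary of a rectangle.\<close>

lemma vline_shift_limit:
  fixes f :: "complex \<Rightarrow> complex"
  assumes x: "x0 < x1" and e: "e > 0" and B: "B \<ge> 0" and H: "H \<ge> 0"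
    and cont: "continuous_on {s. x0 \<le> Re s \<and> Re s \<le> x1 \<and> s \<notin> P} f"
    and P: "\<And>s. s \<in> P \<Longrightarrow> x0 < Re s \<and> Re s < x1 \<and> Im s = 0"
    and I: "\<And>T. T > 0 \<Longrightarrow> (f has_contour_integral I) (rectpath (Complex x0 (-T)) (Complex x1 T))"
    and hor: "\<And>s. x0 \<le> Re s \<Longrightarrow> Re s \<le> x1 \<Longrightarrow> \<bar>Im s\<bar> \<ge> 2 \<Longrightarrow> norm (f s) \<le> H / \<bar>Im s\<bar>"
    and ver: "\<And>t. norm (f (Complex x0 t)) \<le> B * (1 + \<bar>t\<bar>) powr (-1 - e)"
    and lim: "((\<lambda>T. contour_integral (vline x1 T) f) \<longlongrightarrow> L) at_top"
  shows "norm (L - I) \<le> 2 * B / e"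
proof (rule tendsto_le)
  show "((\<lambda>T. norm (contour_integral (vline x1 T) f - I)) \<longlongrightarrow> norm (L - I)) at_top"
    by (intro tendsto_intros lim)
  have "((\<lambda>T. 2 * (x1 - x0) * H / T) \<longlongrightarrow> 0) at_top"
    by (intro tendsto_divide_0[OF tendsto_const] filterlim_at_top_imp_at_infinity filterlim_ident)
  from tendsto_add[OF tendsto_const this, of "2 * B / e"]
  show "((\<lambda>T. 2 * B / e + 2 * (x1 - x0) * H / T) \<longlongrightarrow> 2 * B / e) at_top" by simp
  show "eventually (\<lambda>T. norm (contour_integral (vline x1 T) f - I) \<le> 2 * B / e + 2 * (x1 - x0) * H / T) at_top"
    using eventually_ge_at_top[of 2]
  proof eventually_elim
    case (elim T)
    have img: "path_image (rectpath (Complex x0 (-T)) (Complex x1 T)) =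
       cbox (Complex x0 (-T)) (Complex x1 T) - box (Complex x0 (-T)) (Complex x1 T)"
      by (rule path_image_rectpath_cbox_minus_box) (use elim x in auto)
    have "norm (contour_integral (vline x1 T) f - contour_integral (vline x0 T) f - I) \<le> 2 * (x1 - x0) * (H / T)"
    proof (rule rect_shift[OF _ x _ I])
      show "continuous_on (path_image (rectpath (Complex x0 (- T)) (Complex x1 T))) f"
      proof (rule continuous_on_subset[OF cont], rule subsetI)
        fix s assume s: "s \<in> path_image (rectpath (Complex x0 (- T)) (Complex x1 T))"
        thus "s \<in> {s. x0 \<le> Re s \<and> Re s \<le> x1 \<and> s \<notin> P}"
          using P[of s] elim unfolding img by (auto simp: in_cbox_complex_iff in_box_complex_iff)
      qed
      show "norm (f s) \<le> H / T" if "x0 \<le> Re s" "Re s \<le> x1" "\<bar>Im s\<bar> = T" for s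
        using hor[of s] that elim by auto
    qed (use elim in auto)
    moreover have "norm (contour_integral (vline x0 T) f) \<le> 2 * B / e"
    proof (rule vline_bound[OF _ e B _ ver])
      show "continuous_on {s. Re s = x0 \<and> \<bar>Im s\<bar> \<le> T} f"
        by (rule continuous_on_subset[OF cont]) (use x P in auto)
    qed (use elim in auto)
    moreover have "norm (contour_integral (vline x1 T) f - I) \<le>
        norm (contour_integral (vline x1 T) f - contour_integral (vline x0 T) f - I) + norm (contour_integral (vline x0 T) f)"
      using norm_triangle_ineq[of "contour_integral (vline x1 T) f - contour_integral (vline x0 T) f - I" "contour_integral (vline x0 T) f"]
      by (simp add: algebra_simps)
    ultimately show ?case unfolding times_divide_eq_right by linarith
  qed
qed auto

text \<open>Perron's formula for 1/zeta(s + it), moved from Re s = 2 to Re s = 1/2 + \<delta>; no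
  pole is passed. The twist m^(-it) and the explicit dependence on t are needed later to control f_Y
  along a whole vertical line.\<close>

lemma moebius_twisted_sum_bound:
  fixes \<delta> e :: real
  assumes RH: Riemann_Hypothesis and \<delta>: "0 < \<delta>" "\<delta> < 1/2" and e: "0 < e" "e \<le> 1/2"
  shows "\<exists>C>0. \<forall>N>0. \<forall>t. norm (\<Sum>m\<in>{1..N}. of_real (moebius_mu m) * of_nat m powr (- (\<i> * of_real t)))
     \<le> C * (1 + \<bar>t\<bar>) powr e * real N powr (1/2 + \<delta> + 2 * e)"
proof -
  define x0 where "x0 = 1/2 + \<delta>"
  have x0: "1/2 < x0" "x0 < 2" using \<delta> by (auto simp: x0_def)
  obtain C1 where C1: "C1 > 0" "\<And>s. 1/2 + \<delta> \<le> Re s \<Longrightarrow> norm (zeta_inv s) \<le> C1 * (1 + \<bar>Im s\<bar>) powr e"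
    using zeta_inv_bound[OF RH \<delta> e(1)] by blast
  \<comment> \<open>The kernel gets decay exponent -1 - 2e, since one e is consumed by the growth of
    1/zeta.\<close>
  obtain C2 where C2: "C2 > 0" "\<And>N t. N > 0 \<Longrightarrow> norm (perron_ker N (Complex x0 t)) \<le> C2 * real N powr (x0 + 2 * e) * (1 + \<bar>t\<bar>) powr (-1 - 2 * e)"
    using perron_ker_line_bound[of x0 "2 * e"] x0 e by force
  show ?thesis
  proof (intro exI[of _ "C1 * C2 / e"] conjI allI impI)
    show "C1 * C2 / e > 0" using C1 C2 e by simp
    fix N :: nat and t :: real assume N: "N > 0"
    define f where "f = (\<lambda>s. zeta_inv (\<i> * of_real t + s) * perron_ker N s)"
    define w where "w = (\<lambda>m::nat. of_real (moebius_mu m) * of_nat m powr (- (\<i> * of_real t)) :: complex)"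
    define S where "S = (\<Sum>m\<in>{1..N}. w m)"
    define B where "B = C1 * C2 * (1 + \<bar>t\<bar>) powr e * real N powr (x0 + 2 * e)"
    \<comment> \<open>Separates the twist t from the variable of integration v, so that the power of
      1 + |t| can be taken out of the integral.\<close>
    have split: "(1 + \<bar>t + v\<bar>) powr e \<le> (1 + \<bar>t\<bar>) powr e * (1 + \<bar>v\<bar>) powr e" for v
    proof -
      have "(1 + \<bar>t\<bar>) * (1 + \<bar>v\<bar>) = 1 + \<bar>t\<bar> + \<bar>v\<bar> + \<bar>t\<bar> * \<bar>v\<bar>" by (simp add: algebra_simps)
      moreover have "\<bar>t\<bar> * \<bar>v\<bar> \<ge> 0" by simp
      ultimately have "1 + \<bar>t + v\<bar> \<le> (1 + \<bar>t\<bar>) * (1 + \<bar>v\<bar>)" by linarith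
      hence "(1 + \<bar>t + v\<bar>) powr e \<le> ((1 + \<bar>t\<bar>) * (1 + \<bar>v\<bar>)) powr e" using e by (intro powr_mono2) auto
      thus ?thesis by (simp add: powr_mult)
    qed
    have holf: "f holomorphic_on re_gt (1/2)"
    proof -
      have "(zeta_inv \<circ> (\<lambda>s. \<i> * of_real t + s)) holomorphic_on re_gt (1/2)"
        by (intro holomorphic_on_compose_gen[OF _ holomorphic_zeta_inv[OF RH]] holomorphic_intros) auto
      moreover have "perron_ker N holomorphic_on re_gt (1/2)"
        by (rule holomorphic_on_subset[OF holomorphic_perron_ker[OF N]]) auto
      ultimately show ?thesis unfolding f_def by (intro holomorphic_intros) (simp_all add: o_def)
    qed
    have hs: "((\<lambda>m. w m * of_nat m powr (-s)) has_sum zeta_inv (\<i> * of_real t + s)) {0<..}" if "Re s = 2" for s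
    proof -
      have r: "Re (\<i> * of_real t + s) = 2" using that by simp
      have "\<i> * of_real t + s \<noteq> 1"
      proof
        assume eq: "\<i> * of_real t + s = 1"
        show False using r unfolding eq by simp
      qed
      hence "((\<lambda>m. of_real (moebius_mu m) * of_nat m powr (-(\<i> * of_real t + s))) has_sum zeta_inv (\<i> * of_real t + s)) {0<..}"
        using moebius_mu_has_sum[of "\<i> * of_real t + s"] r by (simp add: zeta_inv_eq)
      thus ?thesis by (simp add: w_def powr_add mult.assoc powr_diff powr_minus divide_inverse)
    qed
    have norm_w: "norm (w m) \<le> 1" if "m > 0" for m
      using that abs_moebius_mu_le[of m] by (simp add: w_def norm_mult norm_nat_powr)
    have "((\<lambda>T. contour_integral (vline 2 T) (\<lambda>s. zeta_inv (\<i> * of_real t + s) * perron_ker N s)) \<longlongrightarrow>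
           2 * of_real pi * \<i> * (\<Sum>\<^sub>\<infinity>m\<in>{0<..}. if m \<le> N then w m else 0)) at_top"
    proof (rule perron_formula[OF N, where w = w and l = "\<lambda>m. m"])
      have "(\<lambda>m. norm (w m) * real m powr (-2)) abs_summable_on {0<..}"
        by (rule Infinite_Sum.abs_summable_on_comparison_test'[OF summable_on_powr_pos[of 2]])
           (use norm_w in \<open>auto intro!: mult_left_le_one_le simp: abs_mult\<close>)
      thus "(\<lambda>m. norm (w m) * real m powr (-2)) summable_on {0<..}"
        by (rule abs_summable_summable)
    qed (use hs in auto)
    also have "(\<Sum>\<^sub>\<infinity>m\<in>{0<..}. if m \<le> N then w m else 0) = (\<Sum>\<^sub>\<infinity>m\<in>{1..N}. w m)"
      by (rule infsum_cong_neutral) auto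
    also have "\<dots> = S" by (simp add: S_def)
    finally have lim: "((\<lambda>T. contour_integral (vline 2 T) f) \<longlongrightarrow> 2 * of_real pi * \<i> * S) at_top"
      by (simp add: f_def)
    \<comment> \<open>A crude constant for the horizontal sides. It may depend on N and t, since
      only the limit of large height matters there.\<close>
    define H where "H = C1 * (1 + \<bar>t\<bar>) powr e * 2 * (2 * real (N + 1) powr 3)"
    have "norm (2 * of_real pi * \<i> * S - 0) \<le> 2 * B / e"
    proof (rule vline_shift_limit[where P = "{}" and H = H, OF x0(2) e(1)])
      show "B \<ge> 0" "H \<ge> 0" using C1 C2 by (auto simp: B_def H_def)
      show "continuous_on {s. x0 \<le> Re s \<and> Re s \<le> 2 \<and> s \<notin> {}} f"
        by (rule holomorphic_on_imp_continuous_on[OF holomorphic_on_subset[OF holf]]) (use x0 in auto)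
      show "(f has_contour_integral 0) (rectpath (Complex x0 (- T)) (Complex 2 T))" if "T > 0" for T
        by (rule rect_cauchy_zero[OF _ _ holf]) (use that x0 in auto)
      show "norm (f s) \<le> H / \<bar>Im s\<bar>" if s: "x0 \<le> Re s" "Re s \<le> 2" "\<bar>Im s\<bar> \<ge> 2" for s
      proof -
        have p1: "(1 + \<bar>Im s\<bar>) powr e \<le> 2 * \<bar>Im s\<bar>"
        proof -
          have "(1 + \<bar>Im s\<bar>) powr e \<le> (1 + \<bar>Im s\<bar>) powr 1" using e by (intro powr_mono) auto
          also have "\<dots> \<le> 2 * \<bar>Im s\<bar>" using s by simp
          finally show ?thesis .
        qed
        have "norm (zeta_inv (\<i> * of_real t + s)) \<le> C1 * (1 + \<bar>Im (\<i> * of_real t + s)\<bar>) powr e"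
          by (rule C1(2)) (use s in \<open>simp add: x0_def\<close>)
        also have "\<dots> \<le> C1 * ((1 + \<bar>t\<bar>) powr e * (1 + \<bar>Im s\<bar>) powr e)"
          using split[of "Im s"] C1(1) by (intro mult_left_mono) auto
        also have "\<dots> \<le> C1 * ((1 + \<bar>t\<bar>) powr e * (2 * \<bar>Im s\<bar>))"
          using C1(1) p1 by (intro mult_left_mono) auto
        finally have 1: "norm (zeta_inv (\<i> * of_real t + s)) \<le> C1 * ((1 + \<bar>t\<bar>) powr e * (2 * \<bar>Im s\<bar>))" .
        have "norm (perron_ker N s) \<le> 2 * real (N + 1) powr (Re s + 1) / norm s ^ 2"
          by (rule perron_ker_bounds(2)[OF N]) (use s x0 in auto)
        also have "\<dots> \<le> 2 * real (N + 1) powr 3 / \<bar>Im s\<bar> ^ 2"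
          using s abs_Im_le_cmod[of s] by (intro frac_le mult_left_mono powr_mono power_mono) auto
        finally have 2: "norm (perron_ker N s) \<le> 2 * real (N + 1) powr 3 / \<bar>Im s\<bar> ^ 2" .
        have "norm (f s) \<le> (C1 * ((1 + \<bar>t\<bar>) powr e * (2 * \<bar>Im s\<bar>))) * (2 * real (N + 1) powr 3 / \<bar>Im s\<bar> ^ 2)"
          unfolding f_def norm_mult by (intro mult_mono 1 2) (use C1 in auto)
        also have "\<dots> = H / \<bar>Im s\<bar>" using s by (simp add: H_def power2_eq_square field_simps)
        finally show ?thesis .
      qed
      show "norm (f (Complex x0 v)) \<le> B * (1 + \<bar>v\<bar>) powr (-1 - e)" for v
      proof -
        have "norm (zeta_inv (\<i> * of_real t + Complex x0 v)) \<le> C1 * (1 + \<bar>Im (\<i> * of_real t + Complex x0 v)\<bar>) powr e"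
          by (rule C1(2)) (simp add: x0_def)
        also have "\<dots> \<le> C1 * ((1 + \<bar>t\<bar>) powr e * (1 + \<bar>v\<bar>) powr e)"
          using split[of v] C1(1) by (intro mult_left_mono) auto
        finally have "norm (f (Complex x0 v)) \<le> C1 * ((1 + \<bar>t\<bar>) powr e * (1 + \<bar>v\<bar>) powr e) *
           (C2 * real N powr (x0 + 2 * e) * (1 + \<bar>v\<bar>) powr (-1 - 2 * e))"
          unfolding f_def norm_mult by (intro mult_mono C2(2) N) (use C1 in auto)
        also have "\<dots> = B * ((1 + \<bar>v\<bar>) powr e * (1 + \<bar>v\<bar>) powr (-1 - 2 * e))"
          by (simp add: B_def mult_ac)
        also have "(1 + \<bar>v\<bar>) powr e * (1 + \<bar>v\<bar>) powr (-1 - 2 * e) = (1 + \<bar>v\<bar>) powr (-1 - e)"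
        proof -
          have "e + (-1 - 2 * e) = -1 - e" by simp
          thus ?thesis by (simp only: powr_add [symmetric])
        qed
        finally show ?thesis .
      qed
    qed (use lim in auto)
    hence "2 * pi * norm S \<le> 2 * B / e" by (simp add: norm_mult)
    moreover have "2 * norm S \<le> 2 * pi * norm S"
      using pi_ge_two by (intro mult_right_mono) auto
    ultimately have "norm S \<le> B / e" by simp
    also have "B / e = C1 * C2 / e * (1 + \<bar>t\<bar>) powr e * real N powr (1/2 + \<delta> + 2 * e)"
      by (simp add: B_def x0_def)
    finally show "norm (\<Sum>m\<in>{1..N}. of_real (moebius_mu m) * of_nat m powr (- (\<i> * of_real t)))
       \<le> C1 * C2 / e * (1 + \<bar>t\<bar>) powr e * real N powr (1/2 + \<delta> + 2 * e)"
      unfolding S_def w_def .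
  qed
qed

text \<open>The function f_Y of the overview; all properties below are for Re s > 1, where it
  converges absolutely.\<close>

definition moebius_tail :: "nat \<Rightarrow> complex \<Rightarrow> complex" where
  "moebius_tail Y s = (\<Sum>\<^sub>\<infinity>m\<in>{Y<..}. of_real (moebius_mu m) * of_nat m powr (-s))"

lemma moebius_tail_has_sum:
  assumes "Re s > 1"
  shows "((\<lambda>m. of_real (moebius_mu m) * of_nat m powr (-s)) has_sum moebius_tail Y s) {Y<..}"
proof -
  have "{Y<..} \<inter> {0<..} = {Y<..}" by auto
  thus ?thesis unfolding moebius_tail_def
    using moebius_mu_summable[OF assms, of "{Y<..}"] by (intro has_sum_infsum) simp
qed

lemma moebius_tail_eq:
  assumes "Re s > 1"
  shows "1 / zeta s = (\<Sum>m\<in>{1..Y}. of_real (moebius_mu m) * of_nat m powr (-s)) + moebius_tail Y s"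
proof -
  have "((\<lambda>m. of_real (moebius_mu m) * of_nat m powr (-s)) has_sum
     (\<Sum>m\<in>{1..Y}. of_real (moebius_mu m) * of_nat m powr (-s)) + moebius_tail Y s) ({1..Y} \<union> {Y<..})"
    by (intro has_sum_Un_disjoint moebius_tail_has_sum assms) auto
  also have "{1..Y} \<union> {Y<..} = {0<..}" by auto
  finally show ?thesis using moebius_mu_has_sum[OF assms] has_sum_unique by blast
qed

lemma holomorphic_moebius_tail: "moebius_tail Y holomorphic_on re_gt 1"
proof (rule holomorphic_transform)
  show "(\<lambda>s. 1 / zeta s - (\<Sum>m\<in>{1..Y}. of_real (moebius_mu m) * of_nat m powr (-s))) holomorphic_on re_gt 1"
    using zeta_nonzero_gt_1
    by (intro holomorphic_intros holomorphic_on_subset[OF holomorphic_zeta]) auto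
qed (use moebius_tail_eq[of _ Y] in auto)

text \<open>Uniform in Y; it serves where boundedness is enough, as on the horizontal sides and for
  the O(1) deviations of the main terms.\<close>

lemma moebius_tail_trivial_bound:
  assumes "x > 1"
  shows "\<exists>C>0. \<forall>Y s. Re s \<ge> x \<longrightarrow> norm (moebius_tail Y s) \<le> C"
proof -
  define K where "K = (\<Sum>\<^sub>\<infinity>n\<in>{0<..}. real n powr (-x))"
  have K0: "K \<ge> 0" unfolding K_def by (rule infsum_nonneg) auto
  have "norm (moebius_tail Y s) \<le> K" if s: "Re s \<ge> x" for Y s
  proof -
    have sm: "(\<lambda>n. real n powr (-x)) summable_on {Y<..}"
      by (rule summable_on_subset_banach[OF summable_on_powr_pos[OF assms]]) auto
    have "norm (moebius_tail Y s) \<le> (\<Sum>\<^sub>\<infinity>n\<in>{Y<..}. real n powr (-x))"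
    proof (rule norm_infsum_le[OF moebius_tail_has_sum has_sum_infsum[OF sm]])
      show "norm (of_real (moebius_mu n) * of_nat n powr (-s)) \<le> real n powr (-x)" if "n \<in> {Y<..}" for n
      proof -
        have "\<bar>moebius_mu n\<bar> * norm (of_nat n powr (-s)) \<le> 1 * real n powr (-x)"
          using that s by (intro mult_mono abs_moebius_mu_le) (auto simp: norm_nat_powr intro!: powr_mono)
        thus ?thesis by (simp add: norm_mult)
      qed
    qed (use s assms in auto)
    also have "\<dots> \<le> K" unfolding K_def
      by (intro infsum_mono_neutral sm summable_on_powr_pos assms) auto
    finally show ?thesis .
  qed
  thus ?thesis using K0 by (intro exI[of _ "K + 1"]) (fastforce intro: add_increasing2)
qed

text \<open>In partial summation the upper bound controls the increments of the weights, and the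
  lower bound turns the result back into a telescoping difference.\<close>

lemma powr_diff_mvt:
  fixes a :: real
  assumes "a > 0" "m > 0"
  shows "m powr (-a) - (m + 1) powr (-a) \<le> a * m powr (-a - 1)"
    and "a * (m + 1) powr (-a - 1) \<le> m powr (-a) - (m + 1) powr (-a)"
proof -
  have "\<exists>z>m. z < m + 1 \<and> (m + 1) powr (-a) - m powr (-a) = (m + 1 - m) * (- a * z powr (-a - 1))"
    by (rule MVT2) (use assms in \<open>auto intro!: derivative_eq_intros simp: powr_diff field_simps\<close>)
  then obtain z where z: "m < z" "z < m + 1" "m powr (-a) - (m + 1) powr (-a) = a * z powr (-a - 1)" by auto
  show "m powr (-a) - (m + 1) powr (-a) \<le> a * m powr (-a - 1)"
    unfolding z(3) using z assms by (intro mult_left_mono powr_mono2') auto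
  show "a * (m + 1) powr (-a - 1) \<le> m powr (-a) - (m + 1) powr (-a)"
    unfolding z(3) using z assms by (intro mult_left_mono powr_mono2') auto
qed

text \<open>Abel summation. Rather than comparing the resulting series with an integral, each of its
  terms is bounded by a multiple of an increment of m^(\<kappa>-\<beta>), so that the sum
  telescopes.\<close>

lemma partial_summation_tail:
  fixes a :: "nat \<Rightarrow> complex" and \<kappa> \<beta> D :: real
  assumes \<kappa>: "0 < \<kappa>" "\<kappa> < \<beta>" and Y: "Y > 0" and D: "D \<ge> 0"
    and A: "\<And>n. n > 0 \<Longrightarrow> norm (\<Sum>m\<in>{1..n}. a m) \<le> D * real n powr \<kappa>"
    and S: "((\<lambda>m. a m * of_real (real m powr (-\<beta>))) has_sum S) {Y<..}"
  shows "norm S \<le> D * (2 + \<beta> * 2 powr (\<beta> - \<kappa> + 1) / (\<beta> - \<kappa>)) * real Y powr (\<kappa> - \<beta>)"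
proof -
  define \<theta> where "\<theta> = \<beta> - \<kappa>"
  \<comment> \<open>Chosen so that \<beta> m^(-\<theta>-1) = q \<theta> (2m)^(-\<theta>-1); because
    2m \<ge> m + 1, the right side is at most q times an increment of m^(-\<theta>).\<close>
  define q where "q = \<beta> * 2 powr (\<theta> + 1) / \<theta>"
  have \<theta>: "\<theta> > 0" and \<beta>: "\<beta> > 0" using \<kappa> by (auto simp: \<theta>_def)
  define g where "g = (\<lambda>m. real m powr (-\<beta>))"
  define AA where "AA = (\<lambda>n. \<Sum>m\<in>{1..n}. a m)"
  have AASuc: "AA (Suc n) = AA n + a (Suc n)" for n by (simp add: AA_def)
  have eq: "(\<Sum>n<k. a (Suc (Y + n)) * of_real (g (Suc (Y + n)))) =
      AA (Y + k) * of_real (g (Suc (Y + k))) - AA Y * of_real (g (Suc Y))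
       + (\<Sum>n<k. AA (Suc (Y + n)) * of_real (g (Suc (Y + n)) - g (Suc (Suc (Y + n)))))" for k
    by (induction k) (auto simp: AASuc algebra_simps)
  have q0: "q > 0" using \<theta> \<beta> by (simp add: q_def)
  have step: "real m powr \<kappa> * (g m - g (Suc m)) \<le> q * (real m powr (-\<theta>) - real (Suc m) powr (-\<theta>))" if m: "m > 0" for m
  proof -
    have "real m powr \<kappa> * (g m - g (Suc m)) \<le> real m powr \<kappa> * (\<beta> * real m powr (-\<beta> - 1))"
      unfolding g_def using powr_diff_mvt(1)[OF \<beta>, of "real m"] m by (intro mult_left_mono) (auto simp: add.commute)
    also have "\<dots> = \<beta> * real m powr (-\<theta> - 1)"
    proof -
      have "real m powr \<kappa> * real m powr (-\<beta> - 1) = real m powr (-\<theta> - 1)"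
      proof -
        have "\<kappa> + (-\<beta> - 1) = -\<theta> - 1" by (simp add: \<theta>_def)
        thus ?thesis by (simp only: powr_add [symmetric])
      qed
      thus ?thesis by (simp only: mult.left_commute)
    qed
    also have "\<dots> = q * (\<theta> * (2 * real m) powr (-\<theta> - 1))"
      using \<theta> by (simp add: q_def powr_mult powr_add [symmetric])
    also have "\<dots> \<le> q * (\<theta> * (real m + 1) powr (-\<theta> - 1))"
      using q0 \<theta> m by (intro mult_left_mono powr_mono2') auto
    also have "\<dots> \<le> q * (real m powr (-\<theta>) - (real m + 1) powr (-\<theta>))"
      using powr_diff_mvt(2)[OF \<theta>, of "real m"] m q0 by (intro mult_left_mono) auto
    finally show ?thesis by (simp add: add.commute)
  qed
  have gmono: "g (Suc m) \<le> g m" if "m > 0" for m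
    unfolding g_def using that \<beta> by (intro powr_mono2') auto
  have bd: "norm (\<Sum>n<k. a (Suc (Y + n)) * of_real (g (Suc (Y + n)))) \<le> D * (2 + q) * real Y powr (-\<theta>)" for k
  proof -
    have e1: "norm (AA n * of_real (g (Suc n))) \<le> D * real Y powr (-\<theta>)" if "n \<ge> Y" for n
    proof -
      have "norm (AA n * of_real (g (Suc n))) \<le> (D * real n powr \<kappa>) * g n"
        unfolding norm_mult using A[of n] that Y gmono[of n] D
        by (intro mult_mono) (auto simp: AA_def g_def)
      also have "\<dots> = D * real n powr (-\<theta>)" using that Y by (simp add: g_def \<theta>_def powr_add [symmetric])
      also have "\<dots> \<le> D * real Y powr (-\<theta>)" using that Y \<theta> D by (intro mult_left_mono powr_mono2') auto
      finally show ?thesis .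
    qed
    have "norm (\<Sum>n<k. AA (Suc (Y + n)) * of_real (g (Suc (Y + n)) - g (Suc (Suc (Y + n)))))
       \<le> (\<Sum>n<k. D * (q * (real (Suc (Y + n)) powr (-\<theta>) - real (Suc (Suc (Y + n))) powr (-\<theta>))))"
    proof (rule sum_norm_le)
      fix n
      have "norm (AA (Suc (Y + n)) * of_real (g (Suc (Y + n)) - g (Suc (Suc (Y + n)))))
        \<le> (D * real (Suc (Y + n)) powr \<kappa>) * (g (Suc (Y + n)) - g (Suc (Suc (Y + n))))"
        unfolding norm_mult norm_of_real using A[of "Suc (Y + n)"] gmono[of "Suc (Y + n)"] D
        by (intro mult_mono) (auto simp: AA_def)
      also have "\<dots> \<le> D * (q * (real (Suc (Y + n)) powr (-\<theta>) - real (Suc (Suc (Y + n))) powr (-\<theta>)))"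
        unfolding mult.assoc using step[of "Suc (Y + n)"] D by (intro mult_left_mono) auto
      finally show "norm (AA (Suc (Y + n)) * of_real (g (Suc (Y + n)) - g (Suc (Suc (Y + n)))))
         \<le> D * (q * (real (Suc (Y + n)) powr (-\<theta>) - real (Suc (Suc (Y + n))) powr (-\<theta>)))" .
    qed
    also have "\<dots> = D * (q * (real (Suc Y) powr (-\<theta>) - real (Suc (Y + k)) powr (-\<theta>)))"
      unfolding sum_distrib_left [symmetric]
      using sum_lessThan_telescope'[of "\<lambda>n. real (Suc (Y + n)) powr (-\<theta>)" k] by simp
    also have "\<dots> \<le> D * (q * real Y powr (-\<theta>))"
    proof -
      have "real (Suc Y) powr (-\<theta>) \<le> real Y powr (-\<theta>)" using Y \<theta> by (intro powr_mono2') auto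
      moreover have "real (Suc (Y + k)) powr (-\<theta>) \<ge> 0" by simp
      ultimately show ?thesis using D q0 by (intro mult_left_mono) linarith+
    qed
    finally have e2: "norm (\<Sum>n<k. AA (Suc (Y + n)) * of_real (g (Suc (Y + n)) - g (Suc (Suc (Y + n))))) \<le> D * (q * real Y powr (-\<theta>))" .
    show ?thesis unfolding eq
      using e1[of "Y + k"] e1[of Y] e2 norm_triangle_ineq4[of "AA (Y + k) * of_real (g (Suc (Y + k)))" "AA Y * of_real (g (Suc Y))"]
        norm_triangle_ineq[of "AA (Y + k) * of_real (g (Suc (Y + k))) - AA Y * of_real (g (Suc Y))"
          "\<Sum>n<k. AA (Suc (Y + n)) * of_real (g (Suc (Y + n)) - g (Suc (Suc (Y + n))))"]
      by (simp add: algebra_simps)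
  qed
  have "((\<lambda>n. a (Suc (Y + n)) * of_real (g (Suc (Y + n)))) has_sum S) UNIV"
  proof -
    have "((\<lambda>n. a (Suc (Y + n)) * of_real (g (Suc (Y + n)))) has_sum S) UNIV \<longleftrightarrow>
       ((\<lambda>m. a m * of_real (g m)) has_sum S) {Y<..}"
      by (rule has_sum_reindex_bij_witness[of _ "\<lambda>m. m - Suc Y" "\<lambda>n. Suc (Y + n)"]) auto
    thus ?thesis using S by (simp add: g_def)
  qed
  hence "(\<lambda>k. \<Sum>n<k. a (Suc (Y + n)) * of_real (g (Suc (Y + n)))) \<longlonglongrightarrow> S"
    by (auto dest!: has_sum_imp_sums simp: sums_def)
  from tendsto_norm[OF this] have "norm S \<le> D * (2 + q) * real Y powr (-\<theta>)"
    by (rule tendsto_upperbound) (use bd in auto)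
  thus ?thesis by (simp add: q_def \<theta>_def)
qed

text \<open>The factor m^(-it) is kept with the Moebius function, and only the real power
  m^(-\<beta>) acts as the weight in the partial summation.\<close>

lemma moebius_tail_bound:
  fixes \<delta> e \<beta> :: real
  assumes RH: Riemann_Hypothesis and \<delta>: "0 < \<delta>" "\<delta> < 1/2" and e: "0 < e" "e \<le> 1/2"
    and \<beta>: "\<beta> > 1" "1/2 + \<delta> + 2 * e < \<beta>"
  shows "\<exists>C>0. \<forall>Y>0. \<forall>t. norm (moebius_tail Y (Complex \<beta> t)) \<le> C * (1 + \<bar>t\<bar>) powr e * real Y powr (1/2 + \<delta> + 2 * e - \<beta>)"
proof -
  obtain C where C: "C > 0" "\<And>N t. N > 0 \<Longrightarrow> norm (\<Sum>m\<in>{1..N}. of_real (moebius_mu m) * of_nat m powr (- (\<i> * of_real t)))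
     \<le> C * (1 + \<bar>t\<bar>) powr e * real N powr (1/2 + \<delta> + 2 * e)"
    using moebius_twisted_sum_bound[OF RH \<delta> e] by blast
  define \<kappa> where "\<kappa> = 1/2 + \<delta> + 2 * e"
  define Q where "Q = 2 + \<beta> * 2 powr (\<beta> - \<kappa> + 1) / (\<beta> - \<kappa>)"
  have \<kappa>: "0 < \<kappa>" "\<kappa> < \<beta>" using \<delta> e \<beta> by (auto simp: \<kappa>_def)
  have "\<beta> * 2 powr (\<beta> - \<kappa> + 1) / (\<beta> - \<kappa>) > 0" using \<kappa> by simp
  hence Q: "Q > 0" unfolding Q_def by linarith
  show ?thesis
  proof (intro exI[of _ "C * Q"] conjI allI impI)
    show "C * Q > 0" using C Q by simp
    fix Y :: nat and t :: real assume Y: "Y > 0"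
    have "norm (moebius_tail Y (Complex \<beta> t)) \<le> C * (1 + \<bar>t\<bar>) powr e * Q * real Y powr (\<kappa> - \<beta>)"
      unfolding Q_def
    proof (rule partial_summation_tail[OF \<kappa> Y])
      show "norm (\<Sum>m\<in>{1..n}. of_real (moebius_mu m) * of_nat m powr (- (\<i> * of_real t))) \<le> C * (1 + \<bar>t\<bar>) powr e * real n powr \<kappa>" if "n > 0" for n
        using C(2)[OF that] by (simp add: \<kappa>_def)
      have "((\<lambda>m. of_real (moebius_mu m) * of_nat m powr (- Complex \<beta> t)) has_sum moebius_tail Y (Complex \<beta> t)) {Y<..}"
        by (rule moebius_tail_has_sum) (use \<beta> in auto)
      also have "?this \<longleftrightarrow> ((\<lambda>m. of_real (moebius_mu m) * of_nat m powr (- (\<i> * of_real t)) * of_real (real m powr (-\<beta>))) has_sum moebius_tail Y (Complex \<beta> t)) {Y<..}"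
      proof (rule has_sum_cong)
        fix m :: nat assume "m \<in> {Y<..}"
        have "- Complex \<beta> t = - (\<i> * of_real t) + of_real (-\<beta>)" by (simp add: complex_eq_iff)
        hence "of_nat m powr (- Complex \<beta> t) = of_nat m powr (- (\<i> * of_real t)) * (of_nat m powr (of_real (-\<beta>)) :: complex)"
          by (simp only: powr_add)
        also have "of_nat m powr (of_real (-\<beta>)) = complex_of_real (real m powr (-\<beta>))"
          by (metis of_nat_0_le_iff of_real_of_nat_eq powr_of_real)
        finally show "of_real (moebius_mu m) * of_nat m powr (- Complex \<beta> t) = of_real (moebius_mu m) * of_nat m powr (- (\<i> * of_real t)) * of_real (real m powr (-\<beta>))"
          by (simp only: mult.assoc)
      qed
      finally show "((\<lambda>m. of_real (moebius_mu m) * of_nat m powr (- (\<i> * of_real t)) * of_real (real m powr (-\<beta>))) has_sum moebius_tail Y (Complex \<beta> t)) {Y<..}" .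
    qed (use C in auto)
    thus "norm (moebius_tail Y (Complex \<beta> t)) \<le> C * Q * (1 + \<bar>t\<bar>) powr e * real Y powr (1/2 + \<delta> + 2 * e - \<beta>)"
      by (simp add: \<kappa>_def mult_ac)
  qed
qed

section \<open>Combinatorics of generalized square-full integers\<close>

lemma multiplicity_mult_powers:
  fixes m k :: nat
  assumes "prime p" "m > 0" "k > 0"
  shows "multiplicity p (m ^ a * k ^ b) = a * multiplicity p m + b * multiplicity p k"
  using assms by (simp add: prime_elem_multiplicity_mult_distrib prime_elem_multiplicity_power_distrib)

lemma squarefree_pos_nat: "squarefree (k::nat) \<Longrightarrow> k > 0"
  by (rule Nat.gr0I) auto

lemma squarefree_multiplicity_le: "squarefree (k::nat) \<Longrightarrow> prime p \<Longrightarrow> multiplicity p k \<le> 1"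
  using squarefree_factorial_semiring''[of k] squarefree_pos_nat[of k] by auto

text \<open>At each prime the exponent is ai + bj with j = 0 or j = 1. As a does not divide b,
  divisibility of the exponent by a determines j, and then i. In terms of Dirichlet series this is
  zeta(as) times the series of squarefree k^(-bs).\<close>

lemma bij_betw_gen_square_full:
  assumes a: "a > 0" and nd: "\<not> a dvd b"
  shows "bij_betw (\<lambda>(m, k). m ^ a * k ^ b) {(m, k). m > 0 \<and> squarefree k} (gen_square_full a b)"
proof (rule bij_betw_imageI)
  show "inj_on (\<lambda>(m, k). m ^ a * k ^ b) {(m, k). m > 0 \<and> squarefree (k::nat)}"
  proof (rule inj_onI, clarsimp)
    fix m k m' k' :: nat
    assume m: "m > 0" "m' > 0" and k: "squarefree k" "squarefree k'" and eq: "m ^ a * k ^ b = m' ^ a * k' ^ b"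
    note k0 = squarefree_pos_nat[OF k(1)] squarefree_pos_nat[OF k(2)]
    have "multiplicity p k = multiplicity p k' \<and> multiplicity p m = multiplicity p m'" if p: "prime p" for p
    proof -
      define i i' j j' where "i = multiplicity p m" "i' = multiplicity p m'" "j = multiplicity p k" "j' = multiplicity p k'"
      have e: "a * i + b * j = a * i' + b * j'"
        using multiplicity_mult_powers[OF p m(1) k0(1), of a b] multiplicity_mult_powers[OF p m(2) k0(2), of a b] eq
        by (simp add: i_i'_j_j'_def)
      have j: "j \<le> 1" "j' \<le> 1" using squarefree_multiplicity_le[OF k(1) p] squarefree_multiplicity_le[OF k(2) p]
        by (auto simp: i_i'_j_j'_def)
      have nd': "a * u + b \<noteq> a * v" for u v
        using nd by (metis dvd_add_right_iff dvd_triv_left)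
      have "j = j'"
      proof (rule ccontr)
        assume "j \<noteq> j'"
        hence "j = 0 \<and> j' = 1 \<or> j = 1 \<and> j' = 0" using j by auto
        thus False using e nd'[of i i'] nd'[of i' i] by auto
      qed
      with e a show ?thesis by (auto simp: i_i'_j_j'_def)
    qed
    thus "m = m' \<and> k = k'" using multiplicity_eq_nat m k0 by blast
  qed
next
  show "(\<lambda>(m, k). m ^ a * k ^ b) ` {(m, k). m > 0 \<and> squarefree k} = gen_square_full a b"
  proof (intro equalityI subsetI)
    fix n :: nat assume "n \<in> (\<lambda>(m, k). m ^ a * k ^ b) ` {(m, k). m > 0 \<and> squarefree k}"
    then obtain m k where mk: "n = m ^ a * k ^ b" "m > 0" "squarefree k" by auto
    note k0 = squarefree_pos_nat[OF mk(3)]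
    have "a dvd multiplicity p n \<or> (\<exists>t. multiplicity p n = a * t + b)" if p: "prime p" for p
    proof -
      have "multiplicity p k = 0 \<or> multiplicity p k = 1"
        using squarefree_multiplicity_le[OF mk(3) p] by auto
      thus ?thesis unfolding mk(1) multiplicity_mult_powers[OF p mk(2) k0] by auto
    qed
    thus "n \<in> gen_square_full a b" using mk k0 by (auto simp: gen_square_full_def)
  next
    fix n assume "n \<in> gen_square_full a b"
    hence n: "n > 0" "\<And>p. prime p \<Longrightarrow> p dvd n \<Longrightarrow> a dvd multiplicity p n \<or> (\<exists>t. multiplicity p n = a * t + b)"
      by (auto simp: gen_square_full_def)
    define A where "A = prime_factors n"
    \<comment> \<open>The primes whose exponent needs the summand b; their product is the squarefree
      part k.\<close>
    define J where "J = {p \<in> A. \<not> a dvd multiplicity p n}"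
    define g where "g = (\<lambda>p. (multiplicity p n - (if p \<in> J then b else 0)) div a)"
    define k where "k = (\<Prod>p\<in>J. p ^ 1)"
    define m where "m = (\<Prod>p\<in>A. p ^ g p)"
    have A: "finite A" "\<And>p. p \<in> A \<Longrightarrow> prime p" and J: "finite J" "\<And>p. p \<in> J \<Longrightarrow> prime p"
      by (auto simp: A_def J_def)
    have m0: "m > 0" unfolding m_def using A(2) by (intro prod_pos) (auto intro: prime_gt_0_nat)
    have k0: "k > 0" unfolding k_def using J(2) by (intro prod_pos) (auto intro: prime_gt_0_nat)
    have mk: "multiplicity p k = (if p \<in> J then 1 else 0)" if "prime p" for p
      unfolding k_def by (rule multiplicity_prod_prime_powers) (use J that in auto)
    have mm: "multiplicity p m = (if p \<in> A then g p else 0)" if "prime p" for p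
      unfolding m_def by (rule multiplicity_prod_prime_powers) (use A that in auto)
    have "squarefree k" using mk k0 by (subst squarefree_factorial_semiring'') auto
    moreover have "n = m ^ a * k ^ b"
    proof (rule multiplicity_eq_nat)
      fix p :: nat assume p: "prime p"
      have "multiplicity p n = a * multiplicity p m + b * multiplicity p k"
      proof (cases "p \<in> A")
        case False
        hence "multiplicity p n = 0" using p n(1) by (auto simp: A_def prime_factors_multiplicity)
        moreover have "p \<notin> J" using False by (auto simp: J_def)
        ultimately show ?thesis using False mk[OF p] mm[OF p] by simp
      next
        case True
        hence dvd: "p dvd n" by (auto simp: A_def)
        show ?thesis
        proof (cases "a dvd multiplicity p n")
          case True
          hence "p \<notin> J" by (auto simp: J_def)
          thus ?thesis using True \<open>p \<in> A\<close> mk[OF p] mm[OF p] by (simp add: g_def)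
        next
          case False
          hence "p \<in> J" using \<open>p \<in> A\<close> by (auto simp: J_def)
          moreover obtain t where "multiplicity p n = a * t + b" using n(2)[OF p dvd] False by auto
          ultimately show ?thesis using \<open>p \<in> A\<close> mk[OF p] mm[OF p] a by (simp add: g_def)
        qed
      qed
      thus "multiplicity p n = multiplicity p (m ^ a * k ^ b)"
        using multiplicity_mult_powers[OF p m0 k0] by simp
    qed (use n m0 k0 in auto)
    ultimately show "n \<in> (\<lambda>(m, k). m ^ a * k ^ b) ` {(m, k). m > 0 \<and> squarefree k}"
      using m0 by (intro image_eqI[of _ _ "(m, k)"]) auto
  qed
qed

text \<open>\<open>square_part k\<close> is the largest number whose square divides k, so the sum
  runs over its divisors, and it equals 1 exactly for squarefree k.\<close>

lemma sum_moebius_mu_squares: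
  assumes "k > 0"
  shows "(\<Sum>m | m ^ 2 dvd k. moebius_mu m) = (if squarefree k then 1 else 0)"
proof -
  have sq: "squarefree k \<longleftrightarrow> square_part k = 1"
  proof
    assume "squarefree k"
    thus "square_part k = 1" using squarefreeD[of k "square_part k"] by auto
  next
    assume "square_part k = 1"
    thus "squarefree k" by (intro squarefreeI) (metis dvd_square_part_iff)
  qed
  have "{m. m ^ 2 dvd k} = {m. m dvd square_part k}" by (auto simp: dvd_square_part_iff)
  moreover have "square_part k > 0" using assms by (intro Nat.gr0I) auto
  ultimately show ?thesis using sum_moebius_mu[of "square_part k"] sq by simp
qed

definition triples :: "nat \<Rightarrow> nat \<Rightarrow> nat \<Rightarrow> (nat \<times> nat \<times> nat) set" where
  "triples a b N = {(m1, m2, m). m1 > 0 \<and> m2 > 0 \<and> m > 0 \<and> m1 ^ a * m2 ^ b * m ^ (2 * b) \<le> N}"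

lemma power_factor_le:
  fixes m :: nat
  assumes "m > 0" "c > 0" "m ^ c * r \<le> N" "r > 0"
  shows "m \<le> N"
proof -
  have "m ^ 1 \<le> m ^ c" using assms by (intro power_increasing) auto
  also have "\<dots> \<le> m ^ c * r" using assms by simp
  finally show ?thesis using assms by simp
qed

lemma finite_triples:
  assumes "a > 0" "b > 0"
  shows "finite (triples a b N)"
proof (rule finite_subset)
  show "triples a b N \<subseteq> {..N} \<times> {..N} \<times> {..N}"
  proof (clarsimp simp: triples_def)
    fix m1 m2 m :: nat
    assume p: "0 < m1" "0 < m2" "0 < m" and le: "m1 ^ a * m2 ^ b * m ^ (2 * b) \<le> N"
    have "m1 \<le> N" by (rule power_factor_le[of _ a "m2 ^ b * m ^ (2 * b)"]) (use p le assms in \<open>auto simp: mult_ac\<close>)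
    moreover have "m2 \<le> N" by (rule power_factor_le[of _ b "m1 ^ a * m ^ (2 * b)"]) (use p le assms in \<open>auto simp: mult_ac\<close>)
    moreover have "m \<le> N" by (rule power_factor_le[of _ "2 * b" "m1 ^ a * m2 ^ b"]) (use p le assms in \<open>auto simp: mult_ac\<close>)
    ultimately show "m1 \<le> N \<and> m2 \<le> N \<and> m \<le> N" by simp
  qed
qed auto

lemma finite_div_pairs:
  assumes "a > 0" "b > 0"
  shows "finite {(m1, m2). 0 < m1 \<and> 0 < m2 \<and> m1 ^ a * m2 ^ b \<le> (M::nat)}"
proof (rule finite_subset)
  show "{(m1, m2). 0 < m1 \<and> 0 < m2 \<and> m1 ^ a * m2 ^ b \<le> M} \<subseteq> {..M} \<times> {..M}"
  proof clarsimp
    fix m k :: nat assume p: "0 < m" "0 < k" and le: "m ^ a * k ^ b \<le> M"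
    have "m \<le> M" by (rule power_factor_le[of _ a "k ^ b"]) (use p le assms in auto)
    moreover have "k \<le> M" by (rule power_factor_le[of _ b "m ^ a"]) (use p le assms in \<open>auto simp: mult_ac\<close>)
    ultimately show "m \<le> M \<and> k \<le> M" by simp
  qed
qed auto

text \<open>The indicator of squarefree k in the parametrization m1^a k^b is expanded over the
  square divisors m^2 of k, and k is written as m2 m^2.\<close>

lemma sum_gen_square_full:
  assumes a: "a > 0" and b: "b > 0" and nd: "\<not> a dvd b"
  shows "(\<Sum>n | 0 < n \<and> n \<le> N. gen_square_full_char a b n) = (\<Sum>(m1, m2, m)\<in>triples a b N. moebius_mu m)"
proof -
  define Q where "Q = {(m1, k). m1 > 0 \<and> k > 0 \<and> m1 ^ a * k ^ b \<le> N}"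
  have Q: "finite Q" unfolding Q_def by (rule finite_div_pairs[OF a b])
  have "(\<Sum>n | 0 < n \<and> n \<le> N. gen_square_full_char a b n) = (\<Sum>n\<in>gen_square_full a b \<inter> {..N}. 1)"
    unfolding gen_square_full_char_def
  proof (rule sum.mono_neutral_cong_right)
    have pos: "n > 0" if "n \<in> gen_square_full a b" for n
      using that by (simp add: gen_square_full_def)
    thus "gen_square_full a b \<inter> {..N} \<subseteq> {n. 0 < n \<and> n \<le> N}" by auto
  qed (auto intro: finite_subset[of _ "{..N}"] simp: indicator_def split: if_splits)
  also have "\<dots> = (\<Sum>(m, k)\<in>{(m, k). m > 0 \<and> squarefree k \<and> m ^ a * k ^ b \<le> N}. 1)"
  proof -
    define h :: "nat \<times> nat \<Rightarrow> nat" where "h = (\<lambda>(m, k). m ^ a * k ^ b)"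
    define A :: "(nat \<times> nat) set" where "A = {(m, k). m > 0 \<and> squarefree k}"
    have bij: "bij_betw h A (gen_square_full a b)"
      unfolding h_def A_def by (rule bij_betw_gen_square_full[OF a nd])
    have "bij_betw h {p \<in> A. h p \<le> N} (gen_square_full a b \<inter> {..N})"
    proof (rule bij_betw_subset[OF bij])
      have "h ` {p \<in> A. h p \<le> N} = h ` A \<inter> {..N}" by blast
      thus "h ` {p \<in> A. h p \<le> N} = gen_square_full a b \<inter> {..N}"
        using bij_betw_imp_surj_on[OF bij] by simp
    qed auto
    moreover have "{p \<in> A. h p \<le> N} = {(m, k). m > 0 \<and> squarefree k \<and> m ^ a * k ^ b \<le> N}"
      by (auto simp: A_def h_def)
    ultimately have "bij_betw h {(m, k). m > 0 \<and> squarefree k \<and> m ^ a * k ^ b \<le> N} (gen_square_full a b \<inter> {..N})"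
      by (simp only:)
    from sum.reindex_bij_betw[OF this, of "\<lambda>_. 1::real"] show ?thesis
      by (simp add: case_prod_unfold)
  qed
  also have "\<dots> = (\<Sum>(m1, k)\<in>Q. if squarefree k then 1 else 0)"
    by (rule sum.mono_neutral_cong_left[OF Q]) (auto simp: Q_def squarefree_pos_nat split: if_splits)
  also have "\<dots> = (\<Sum>(m1, k)\<in>Q. \<Sum>m | m ^ 2 dvd k. moebius_mu m)"
    by (intro sum.cong) (auto simp: Q_def sum_moebius_mu_squares)
  also have "\<dots> = (\<Sum>((m1, k), m)\<in>(SIGMA p:Q. {m. m ^ 2 dvd snd p}). moebius_mu m)"
    unfolding case_prod_unfold
  proof (subst sum.Sigma[OF Q])
    show "\<forall>p\<in>Q. finite {m. m ^ 2 dvd snd p}"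
    proof
      fix p assume "p \<in> Q"
      hence "square_part (snd p) > 0" by (intro Nat.gr0I) (auto simp: Q_def)
      hence "finite {m. m dvd square_part (snd p)}" by (rule finite_divisors_nat)
      thus "finite {m. m ^ 2 dvd snd p}" by (simp add: dvd_square_part_iff)
    qed
  qed (simp add: case_prod_unfold)
  finally have *: "(\<Sum>n | 0 < n \<and> n \<le> N. gen_square_full_char a b n) = (\<Sum>((m1, k), m)\<in>(SIGMA p:Q. {m. m ^ 2 dvd snd p}). moebius_mu m)" .
  have power_eq: "x * r ^ b * m ^ (2 * b) = x * (r * m ^ 2) ^ b" for x r m :: nat
    unfolding power_mult power_mult_distrib by (simp only: mult.assoc)
  have "(\<Sum>((m1, k), m)\<in>(SIGMA p:Q. {m. m ^ 2 dvd snd p}). moebius_mu m)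
      = (\<Sum>(m1, m2, m)\<in>triples a b N. moebius_mu m)"
  proof (rule sum.reindex_bij_witness[of _ "\<lambda>(m1, m2, m). ((m1, m2 * m ^ 2), m)" "\<lambda>((m1, k), m). (m1, k div m ^ 2, m)"])
    fix p assume "p \<in> (SIGMA p:Q. {m. m ^ 2 dvd snd p})"
    then obtain m1 k m where p: "p = ((m1, k), m)" "m1 > 0" "k > 0" "m1 ^ a * k ^ b \<le> N" "m ^ 2 dvd k"
      by (auto simp: Q_def)
    obtain r where r: "k = m ^ 2 * r" using p(5) by auto
    have mr: "m > 0" "r > 0" using p(3) r by (auto intro!: Nat.gr0I)
    show "(\<lambda>(m1, m2, m). ((m1, m2 * m ^ 2), m)) ((\<lambda>((m1, k), m). (m1, k div m ^ 2, m)) p) = p"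
      using mr by (simp add: p(1) r)
    show "(\<lambda>((m1, k), m). (m1, k div m ^ 2, m)) p \<in> triples a b N"
      using mr p(2,4) by (simp add: p(1) r triples_def power_eq mult.commute[of "m ^ 2" r])
  next
    fix q assume "q \<in> triples a b N"
    then obtain m1 m2 m where q: "q = (m1, m2, m)" "m1 > 0" "m2 > 0" "m > 0" "m1 ^ a * m2 ^ b * m ^ (2 * b) \<le> N"
      by (auto simp: triples_def)
    show "(\<lambda>((m1, k), m). (m1, k div m ^ 2, m)) ((\<lambda>(m1, m2, m). ((m1, m2 * m ^ 2), m)) q) = q"
      using q by simp
    show "(\<lambda>(m1, m2, m). ((m1, m2 * m ^ 2), m)) q \<in> (SIGMA p:Q. {m. m ^ 2 dvd snd p})"
      using q by (simp add: Q_def power_eq)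
  qed auto
  with * show ?thesis by simp
qed

lemma sum_div_count:
  assumes "a > 0" "b > 0"
  shows "(\<Sum>n | 0 < n \<and> real n \<le> u. div_count a b n) = card {(m1, m2). 0 < m1 \<and> 0 < m2 \<and> real (m1 ^ a * m2 ^ b) \<le> u}"
proof -
  define M where "M = nat \<lfloor>u\<rfloor>"
  have le: "real n \<le> u \<longleftrightarrow> n \<le> M" if "n > 0" for n
  proof -
    have "n \<le> nat \<lfloor>u\<rfloor> \<longleftrightarrow> int n \<le> \<lfloor>u\<rfloor>" using that by linarith
    thus ?thesis by (simp add: M_def le_floor_iff)
  qed
  have eq: "{n. 0 < n \<and> real n \<le> u} = {1..M}" using le by auto
  have "(\<Sum>n | 0 < n \<and> real n \<le> u. div_count a b n) = (\<Sum>n\<in>{1..M}. card {(m1, m2). m1 > 0 \<and> m2 > 0 \<and> m1 ^ a * m2 ^ b = n})"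
    unfolding eq div_count_def ..
  also have "\<dots> = card (\<Union>n\<in>{1..M}. {(m1, m2). m1 > 0 \<and> m2 > 0 \<and> m1 ^ a * m2 ^ b = n})"
  proof (rule card_UN_disjoint[symmetric])
    show "\<forall>n\<in>{1..M}. finite {(m1, m2). m1 > 0 \<and> m2 > 0 \<and> m1 ^ a * m2 ^ b = n}"
      by (auto intro!: finite_subset[OF _ finite_div_pairs[OF assms, of M]])
  qed auto
  also have "(\<Union>n\<in>{1..M}. {(m1, m2). m1 > 0 \<and> m2 > 0 \<and> m1 ^ a * m2 ^ b = n}) = {(m1, m2). 0 < m1 \<and> 0 < m2 \<and> real (m1 ^ a * m2 ^ b) \<le> u}"
    using le by (auto simp: Suc_le_eq simp del: of_nat_mult of_nat_power)
  finally show ?thesis .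
qed

text \<open>For fixed m the pairs (m1, m2) are those of the divisor problem at N / m^(2b); through
  this its error term enters.\<close>

lemma sum_triples_le:
  assumes "a > 0" "b > 0"
  shows "(\<Sum>(m1, m2, m)\<in>{(m1, m2, m) \<in> triples a b N. m \<le> Y}. moebius_mu m)
     = (\<Sum>m\<in>{1..Y}. moebius_mu m * (\<Sum>n | 0 < n \<and> real n \<le> real N / real m ^ (2 * b). real (div_count a b n)))"
proof -
  define R where "R = (\<lambda>m. {(m1, m2). 0 < m1 \<and> 0 < m2 \<and> real (m1 ^ a * m2 ^ b) \<le> real N / real m ^ (2 * b)})"
  have R: "(m1, m2) \<in> R m \<longleftrightarrow> 0 < m1 \<and> 0 < m2 \<and> m1 ^ a * m2 ^ b * m ^ (2 * b) \<le> N" if "m > 0" for m1 m2 m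
  proof -
    have "real (m1 ^ a * m2 ^ b) \<le> real N / real m ^ (2 * b) \<longleftrightarrow> real (m1 ^ a * m2 ^ b * m ^ (2 * b)) \<le> real N"
      using that by (simp add: le_divide_eq)
    thus ?thesis unfolding R_def by (simp only: of_nat_le_iff mem_Collect_eq case_prod_conv)
  qed
  have fin: "finite (R m)" if "m \<in> {1..Y}" for m
  proof (rule finite_subset[OF _ finite_div_pairs[OF assms, of N]])
    show "R m \<subseteq> {(m1, m2). 0 < m1 \<and> 0 < m2 \<and> m1 ^ a * m2 ^ b \<le> N}"
    proof
      fix p assume p: "p \<in> R m"
      obtain m1 m2 where [simp]: "p = (m1, m2)" by (cases p)
      have "m1 ^ a * m2 ^ b * 1 \<le> m1 ^ a * m2 ^ b * m ^ (2 * b)"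
        using that by (intro mult_le_mono2) simp
      moreover have *: "0 < m1 \<and> 0 < m2 \<and> m1 ^ a * m2 ^ b * m ^ (2 * b) \<le> N" using p R[of m m1 m2] that by simp
      ultimately have "m1 ^ a * m2 ^ b \<le> N" by linarith
      thus "p \<in> {(m1, m2). 0 < m1 \<and> 0 < m2 \<and> m1 ^ a * m2 ^ b \<le> N}" using * by simp
    qed
  qed
  have "(\<Sum>m\<in>{1..Y}. moebius_mu m * (\<Sum>n | 0 < n \<and> real n \<le> real N / real m ^ (2 * b). real (div_count a b n)))
     = (\<Sum>m\<in>{1..Y}. \<Sum>p\<in>R m. moebius_mu m)"
    using sum_div_count[OF assms] by (intro sum.cong refl) (simp add: R_def of_nat_sum [symmetric] del: of_nat_sum)
  also have "\<dots> = (\<Sum>(m, p)\<in>(SIGMA m:{1..Y}. R m). moebius_mu m)"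
    by (rule sum.Sigma) (use fin in auto)
  also have "\<dots> = (\<Sum>(m1, m2, m)\<in>{(m1, m2, m) \<in> triples a b N. m \<le> Y}. moebius_mu m)"
    by (rule sum.reindex_bij_witness[of _ "\<lambda>(m1, m2, m). (m, (m1, m2))" "\<lambda>(m, (m1, m2)). (m1, m2, m)"])
       (auto simp: triples_def R)
  finally show ?thesis ..
qed

section \<open>The tail of the convolution\<close>

text \<open>Since the exponents 1/a and 1/b are at most 1, moving within a unit interval changes the
  main terms only by O(1).\<close>

lemma powr_diff_le_1:
  fixes x y p :: real
  assumes "1 \<le> y" "y \<le> x" "x \<le> y + 1" "0 < p" "p \<le> 1"
  shows "0 \<le> x powr p - y powr p" "x powr p - y powr p \<le> 1"
proof -
  show "0 \<le> x powr p - y powr p" using assms by (simp add: powr_mono2)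
  show "x powr p - y powr p \<le> 1"
  proof (cases "x = y")
    case False
    have "\<exists>z>y. z < x \<and> x powr p - y powr p = (x - y) * (p * z powr (p - 1))"
    proof (rule MVT2)
      fix z assume "y \<le> z"
      hence "z > 0" using assms by simp
      thus "((\<lambda>z. z powr p) has_real_derivative p * z powr (p - 1)) (at z)"
        by (rule has_real_derivative_powr)
    qed (use assms False in auto)
    then obtain z where z: "y < z" "x powr p - y powr p = (x - y) * (p * z powr (p - 1))" by auto
    have z1: "z \<ge> 1" using z(1) assms by linarith
    have "z powr (p - 1) \<le> z powr 0" using z1 assms by (intro powr_mono) auto
    hence "z powr (p - 1) \<le> 1" using z1 by simp
    hence "p * z powr (p - 1) \<le> 1 * 1" using assms by (intro mult_mono) auto
    hence "(x - y) * (p * z powr (p - 1)) \<le> 1 * 1" using assms by (intro mult_mono) auto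
    thus ?thesis using z(2) by simp
  qed auto
qed

text \<open>p times the kernel is the mean of u^p over [N, N + 1], hence equal to z^p for some z in
  between.\<close>

lemma perron_ker_real:
  assumes N: "N > 0" and p: "0 < p" "p \<le> 1"
  obtains k :: real where "perron_ker N (of_real p) = of_real k" "\<bar>k - real N powr p / p\<bar> \<le> 1 / p"
proof -
  define k where "k = (real (N + 1) powr (p + 1) - real N powr (p + 1)) / (p * (p + 1))"
  have pw: "of_nat M powr (of_real p + 1) = complex_of_real (real M powr (p + 1))" for M
    by (metis of_nat_0_le_iff of_real_1 of_real_add of_real_of_nat_eq powr_of_real)
  have "perron_ker N (of_real p) = of_real k"
    unfolding perron_ker_def pw k_def by simp
  moreover have "\<bar>k - real N powr p / p\<bar> \<le> 1 / p"
  proof -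
    have "\<exists>z>real N. z < real N + 1 \<and> (real N + 1) powr (p + 1) - real N powr (p + 1) = (real N + 1 - real N) * ((p + 1) * z powr p)"
    proof (rule MVT2)
      fix z assume "real N \<le> z"
      hence "z > 0" using N by simp
      thus "((\<lambda>z. z powr (p + 1)) has_real_derivative (p + 1) * z powr p) (at z)"
        using has_real_derivative_powr[of z "p + 1"] by simp
    qed auto
    then obtain z where z: "real N < z" "z < real N + 1" "(real N + 1) powr (p + 1) - real N powr (p + 1) = (p + 1) * z powr p"
      by auto
    have kz: "k = z powr p / p"
      using z(3) p by (simp add: k_def add.commute)
    have "0 \<le> z powr p - real N powr p" "z powr p - real N powr p \<le> 1"
      using powr_diff_le_1[OF _ _ _ p, of "real N" z] z N by auto
    hence u: "z powr p - real N powr p \<le> 1" and l: "z powr p - real N powr p \<ge> 0" by auto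
    have "k - real N powr p / p = (z powr p - real N powr p) / p" by (simp add: kz diff_divide_distrib)
    moreover have "(z powr p - real N powr p) / p \<le> 1 / p" using u p by (intro divide_right_mono) auto
    moreover have "(z powr p - real N powr p) / p \<ge> 0" using l p by simp
    ultimately show ?thesis by simp
  qed
  ultimately show ?thesis by (rule that)
qed

text \<open>This is \<open>zeta (a s) zeta (b s) f\<^sub>Y(2 b s)\<close> with the poles at \<open>1 / a\<close> and \<open>1 / b\<close> split off, so
  that their residues can be read off from Cauchy's integral formula after partial fractions.\<close>

definition tail_series :: "nat \<Rightarrow> nat \<Rightarrow> nat \<Rightarrow> complex \<Rightarrow> complex" where
  "tail_series a b Y s = zeta_reg (of_nat a * s) * zeta_reg (of_nat b * s) * moebius_tail Y (of_nat (2 * b) * s)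
      / (of_nat a * of_nat b) / ((s - 1 / of_nat a) * (s - 1 / of_nat b))"

lemma tail_series_eq:
  assumes "a > 0" "b > 0" "s \<noteq> 1 / of_nat a" "s \<noteq> 1 / of_nat b"
  shows "tail_series a b Y s = zeta (of_nat a * s) * zeta (of_nat b * s) * moebius_tail Y (of_nat (2 * b) * s)"
proof -
  have ne: "of_nat a * s \<noteq> 1" "of_nat b * s \<noteq> 1" using assms by (auto simp: field_simps)
  have "of_nat a * (s - 1 / of_nat a) = of_nat a * s - 1" "of_nat b * (s - 1 / of_nat b) = of_nat b * s - 1"
    using assms by (auto simp: field_simps)
  hence d: "(of_nat a * of_nat b) * ((s - 1 / of_nat a) * (s - 1 / of_nat b)) = (of_nat a * s - 1) * (of_nat b * s - 1)"
    by (metis (no_types, lifting) mult.assoc mult.left_commute)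
  show ?thesis unfolding tail_series_def divide_divide_eq_left d
    using ne by (simp add: zeta_reg_def)
qed

text \<open>Because a and b are at least 2, all three factors converge absolutely on Re s = 1, clear
  of the poles at 1/a and 1/b.\<close>

lemma tail_series_has_sum:
  assumes a: "a \<ge> 2" and b: "b \<ge> 2" and s: "Re s = 1"
  shows "((\<lambda>(m1, m2, m). of_real (moebius_mu m) * of_nat (m1 ^ a * m2 ^ b * m ^ (2 * b)) powr (-s))
     has_sum tail_series a b Y s) ({0<..} \<times> {0<..} \<times> {Y<..})"
proof -
  have re: "Re (of_nat a * s) > 1" "Re (of_nat b * s) > 1" "Re (of_nat (2 * b) * s) > 1"
    using a b s by auto
  have pw: "of_nat (m ^ k) powr (-s) = (of_nat m powr (- (of_nat k * s)) :: complex)" if "m > 0" "k > 0" for m k :: nat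
  proof -
    have Ln: "Ln (of_nat j) = of_real (ln (real j))" if "j > 0" for j
      using that by (metis Ln_of_real of_nat_0_less_iff of_real_of_nat_eq)
    have "Ln (of_nat (m ^ k)) = of_nat k * (Ln (of_nat m) :: complex)"
      using that by (subst (1 2) Ln) (auto simp: ln_realpow)
    thus ?thesis using that by (simp add: powr_def mult_ac del: of_nat_power)
  qed
  have pm: "of_nat (x * y) powr (-s) = (of_nat x powr (-s) * of_nat y powr (-s) :: complex)" for x y
    using powr_times_real[of "of_nat x" "of_nat y" "-s"] by simp
  have "of_nat a * s \<noteq> 1" "of_nat b * s \<noteq> 1"
    using re(1,2) by (metis one_complex.sel(1) less_irrefl)+
  hence ne: "s \<noteq> 1 / of_nat a" "s \<noteq> 1 / of_nat b" using a b by auto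
  have "((\<lambda>(m1, y). of_nat m1 powr (- (of_nat a * s)) * (case y of (m2, m) \<Rightarrow> of_nat m2 powr (- (of_nat b * s)) *
      (of_real (moebius_mu m) * of_nat m powr (- (of_nat (2 * b) * s)))))
      has_sum (zeta (of_nat a * s) * (zeta (of_nat b * s) * moebius_tail Y (of_nat (2 * b) * s)))) ({0<..} \<times> {0<..} \<times> {Y<..})"
    by (rule has_sum_times_complex[OF zeta_has_sum[OF re(1)] has_sum_times_complex[OF zeta_has_sum[OF re(2)] moebius_tail_has_sum[OF re(3)]]])
  also have "?this \<longleftrightarrow> ((\<lambda>(m1, m2, m). of_real (moebius_mu m) * of_nat (m1 ^ a * m2 ^ b * m ^ (2 * b)) powr (-s))
     has_sum (zeta (of_nat a * s) * (zeta (of_nat b * s) * moebius_tail Y (of_nat (2 * b) * s)))) ({0<..} \<times> {0<..} \<times> {Y<..})"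
  proof (rule has_sum_cong)
    fix x :: "nat \<times> nat \<times> nat" assume "x \<in> {0<..} \<times> {0<..} \<times> {Y<..}"
    then obtain m1 m2 m where x: "x = (m1, m2, m)" "m1 > 0" "m2 > 0" "m > 0" by auto
    show "(case x of (m1, y) \<Rightarrow> of_nat m1 powr (- (of_nat a * s)) * (case y of (m2, m) \<Rightarrow> of_nat m2 powr (- (of_nat b * s)) *
      (of_real (moebius_mu m) * of_nat m powr (- (of_nat (2 * b) * s)))))
      = (case x of (m1, m2, m) \<Rightarrow> of_real (moebius_mu m) * of_nat (m1 ^ a * m2 ^ b * m ^ (2 * b)) powr (-s))"
      unfolding x(1) case_prod_conv pm using x a b by (subst (1 2 3) pw) (auto simp: mult_ac)
  qed
  finally show ?thesis using tail_series_eq[of a b s Y] ne a b by (simp add: mult.assoc)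
qed

lemma tail_perron:
  assumes a: "a \<ge> 2" and b: "b \<ge> 2" and N: "N > 0"
  shows "((\<lambda>T. contour_integral (vline 1 T) (\<lambda>s. tail_series a b Y s * perron_ker N s)) \<longlongrightarrow>
     2 * of_real pi * \<i> * of_real (\<Sum>(m1, m2, m)\<in>{(m1, m2, m) \<in> triples a b N. m > Y}. moebius_mu m)) at_top"
proof -
  define I where "I = ({0<..} \<times> {0<..} \<times> {Y<..} :: (nat \<times> nat \<times> nat) set)"
  define w where "w = (\<lambda>(m1::nat, m2::nat, m). complex_of_real (moebius_mu m))"
  define l where "l = (\<lambda>(m1, m2, m). m1 ^ a * m2 ^ b * m ^ (2 * b) :: nat)"
  have hs: "((\<lambda>i. w i * of_nat (l i) powr (-s)) has_sum tail_series a b Y s) I" if "Re s = 1" for s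
    using tail_series_has_sum[OF a b that, of Y] by (simp add: w_def l_def I_def case_prod_unfold)
  have lpos: "l i > 0" if "i \<in> I" for i using that by (auto simp: l_def I_def)
  have "((\<lambda>T. contour_integral (vline 1 T) (\<lambda>s. tail_series a b Y s * perron_ker N s)) \<longlongrightarrow>
           2 * of_real pi * \<i> * (\<Sum>\<^sub>\<infinity>i\<in>I. if l i \<le> N then w i else 0)) at_top"
  proof (rule perron_formula[OF N])
    have "(\<lambda>i. w i * of_nat (l i) powr (-1)) abs_summable_on I"
      by (rule has_sum_imp_abs_summable_complex[OF hs]) simp
    thus "(\<lambda>i. norm (w i) * real (l i) powr (-1)) summable_on I"
      by (rule summable_on_cong[THEN iffD1, rotated])
         (use lpos in \<open>auto simp: norm_mult norm_nat_powr\<close>)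
  qed (use lpos hs in auto)
  also have "(\<Sum>\<^sub>\<infinity>i\<in>I. if l i \<le> N then w i else 0) = (\<Sum>\<^sub>\<infinity>i\<in>{(m1, m2, m) \<in> triples a b N. m > Y}. w i)"
    by (rule infsum_cong_neutral) (auto simp: I_def triples_def l_def)
  also have "\<dots> = (\<Sum>i\<in>{(m1, m2, m) \<in> triples a b N. m > Y}. w i)"
  proof (rule infsum_finite)
    show "finite {(m1, m2, m) \<in> triples a b N. m > Y}"
      by (rule finite_subset[OF _ finite_triples[of a b N]]) (use a b in auto)
  qed
  also have "\<dots> = of_real (\<Sum>(m1, m2, m)\<in>{(m1, m2, m) \<in> triples a b N. m > Y}. moebius_mu m)"
    unfolding of_real_sum by (intro sum.cong) (auto simp: w_def)
  finally show ?thesis .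
qed

text \<open>The residues that are passed: the pole at \<open>1 / b\<close> lies to the right of the line
  \<open>Re s = 1 / (2 a)\<close> only if \<open>b < 2 a\<close>.\<close>

definition tail_main :: "nat \<Rightarrow> nat \<Rightarrow> nat \<Rightarrow> nat \<Rightarrow> complex" where
  "tail_main a b N Y =
     zeta (of_nat b / of_nat a) * moebius_tail Y (2 * of_nat b / of_nat a) * perron_ker N (1 / of_nat a) / of_nat a
     + (if b < 2 * a then zeta (of_nat a / of_nat b) * moebius_tail Y 2 * perron_ker N (1 / of_nat b) / of_nat b else 0)"

text \<open>On the line Re s = \<sigma> the arguments as and bs have real part at least 1/2 +
  \<delta>, and 2bs has real part above 1, so every bound obtained from the Riemann hypothesis
  applies. For b < 2a the assumption \<open>cross\<close> makes \<delta> small enough to keep 1/b to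
  the right of the line; for b > 2a it always lies to the left.\<close>

lemma tail_estimate:
  fixes a b :: nat and \<delta> e \<sigma> :: real
  assumes RH: Riemann_Hypothesis and ab: "2 \<le> a" "a < b" "b \<noteq> 2 * a"
    and \<delta>: "0 < \<delta>" "\<delta> < 1/2" and e: "0 < e" "e \<le> 1/4"
    and \<sigma>_def: "\<sigma> = (1/2 + \<delta>) / real a" and cross: "b < 2 * a \<Longrightarrow> \<sigma> < 1 / real b"
  shows "\<exists>C>0. \<forall>N>0. \<forall>Y>0.
    norm (of_real (\<Sum>(m1, m2, m)\<in>{(m1, m2, m) \<in> triples a b N. m > Y}. moebius_mu m) - tail_main a b N Y)
     \<le> C * real N powr (\<sigma> + 4 * e) * real Y powr (1/2 + \<delta> + 2 * e - 2 * real b * \<sigma>)"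
proof -
  define p q where "p = 1 / real a" and "q = 1 / real b"
  have pos: "real a > 0" "real b > 0" "real a < real b" using ab by auto
  have pq: "0 < q" "q < p" "p \<le> 1/2" "p < 1"
    using ab pos by (auto simp: p_def q_def frac_less2 field_simps)
  have \<sigma>0: "\<sigma> > 0" using \<delta> pos by (simp add: \<sigma>_def)
  have as: "real a * \<sigma> = 1/2 + \<delta>" using pos by (simp add: \<sigma>_def)
  have \<sigma>p: "\<sigma> < p" unfolding \<sigma>_def p_def using \<delta> pos by (intro divide_strict_right_mono) auto
  have bs: "real b * \<sigma> > 1/2 + \<delta>" using as pos \<sigma>0 by (metis mult_strict_right_mono)
  have cq: "1 / (2 * real b) < \<sigma>"
  proof -
    have "1 / (2 * real b) < 1 / (2 * real a)" using pos by (intro divide_strict_left_mono) auto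
    also have "\<dots> \<le> \<sigma>" unfolding \<sigma>_def using \<delta> pos by (simp add: field_simps)
    finally show ?thesis .
  qed
  have noncross: "q < \<sigma>" if "\<not> b < 2 * a"
  proof -
    have "2 * real a < real b" using that ab by linarith
    hence "1 / real b < 1 / (2 * real a)" using pos by (intro divide_strict_left_mono) auto
    also have "\<dots> \<le> \<sigma>" unfolding \<sigma>_def using \<delta> pos by (simp add: field_simps)
    finally show ?thesis by (simp add: q_def)
  qed
  have qs: "q \<noteq> \<sigma>" "b < 2 * a \<longleftrightarrow> \<sigma> < q" using noncross cross by (cases "b < 2 * a"; force simp: q_def)+
  \<comment> \<open>Equivalent to \<sigma> \<noteq> 1/b: the new line must not run through the pole
    of zeta(bs).\<close>
  have bs1: "real b * \<sigma> \<noteq> 1" using qs(1) pos by (auto simp: q_def field_simps)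
  have \<beta>1: "2 * real b * \<sigma> > 1" using bs \<delta> by simp
  obtain Ca where Ca: "Ca > 0" "\<And>t. norm (zeta (Complex (real a * \<sigma>) t)) \<le> Ca * (1 + \<bar>t\<bar>) powr e"
    using zeta_line_bound[OF RH, of "real a * \<sigma>" e] as \<delta> e by auto
  obtain Cb where Cb: "Cb > 0" "\<And>t. norm (zeta (Complex (real b * \<sigma>) t)) \<le> Cb * (1 + \<bar>t\<bar>) powr e"
    using zeta_line_bound[OF RH, of "real b * \<sigma>" e] bs bs1 \<delta> e by auto
  obtain Cm where Cm: "Cm > 0" "\<And>Y t. Y > 0 \<Longrightarrow> norm (moebius_tail Y (Complex (2 * real b * \<sigma>) t)) \<le> Cm * (1 + \<bar>t\<bar>) powr e * real Y powr (1/2 + \<delta> + 2 * e - 2 * real b * \<sigma>)"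
    using moebius_tail_bound[OF RH \<delta>, of e "2 * real b * \<sigma>"] e \<beta>1 bs \<delta> by force
  obtain Ck where Ck: "Ck > 0" "\<And>N t. N > 0 \<Longrightarrow> norm (perron_ker N (Complex \<sigma> t)) \<le> Ck * real N powr (\<sigma> + 4 * e) * (1 + \<bar>t\<bar>) powr (-1 - 4 * e)"
    using perron_ker_line_bound[OF \<sigma>0, of "4 * e"] e by force
  obtain Cz where Cz: "Cz > 0" "\<And>s. 1/2 + \<delta> \<le> Re s \<Longrightarrow> \<bar>Im s\<bar> \<ge> 2 \<Longrightarrow> norm (zeta s) \<le> Cz * (1 + \<bar>Im s\<bar>) powr e"
    using zeta_powr_bound[OF RH \<delta> e(1)] by blast
  obtain Ct where Ct: "Ct > 0" "\<And>Y s. Re s \<ge> 2 * real b * \<sigma> \<Longrightarrow> norm (moebius_tail Y s) \<le> Ct"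
    using moebius_tail_trivial_bound[OF \<beta>1] by blast
  define D where "D = Ca * real a powr e * (Cb * real b powr e) * (Cm * real (2 * b) powr e) * Ck"
  have D: "D > 0" using Ca(1) Cb(1) Cm(1) Ck(1) pos by (simp add: D_def)
  show ?thesis
  proof (intro exI[of _ "2 * D / e"] conjI allI impI)
    show "2 * D / e > 0" using D e by simp
    fix N Y :: nat assume N: "N > 0" and Y: "Y > 0"
    define S where "S = (\<Sum>(m1, m2, m)\<in>{(m1, m2, m) \<in> triples a b N. m > Y}. moebius_mu m)"
    define f where "f = (\<lambda>s. tail_series a b Y s * perron_ker N s)"
    \<comment> \<open>f with both pole factors removed; holomorphic for Re s > 1/(2b), the
      half-plane in which f_Y(2bs) converges absolutely.\<close>
    define h where "h = (\<lambda>s. zeta_reg (of_nat a * s) * zeta_reg (of_nat b * s) * moebius_tail Y (of_nat (2 * b) * s)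
      * perron_ker N s / (of_nat a * of_nat b))"
    define B where "B = D * (real N powr (\<sigma> + 4 * e) * real Y powr (1/2 + \<delta> + 2 * e - 2 * real b * \<sigma>))"
    have scale: "(1 + \<bar>real k * t\<bar>) powr e \<le> real k powr e * (1 + \<bar>t\<bar>) powr e" if "k \<ge> 1" for k :: nat and t
    proof -
      have "1 + \<bar>real k * t\<bar> \<le> real k * (1 + \<bar>t\<bar>)" using that by (simp add: abs_mult algebra_simps)
      hence "(1 + \<bar>real k * t\<bar>) powr e \<le> (real k * (1 + \<bar>t\<bar>)) powr e" using e by (intro powr_mono2) auto
      thus ?thesis by (simp add: powr_mult)
    qed
    have hol_h: "h holomorphic_on re_gt (1 / (2 * real b))"
    proof -
      have 1: "(\<lambda>s. zeta_reg (of_nat k * s)) holomorphic_on S" for k S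
        using holomorphic_on_compose_gen[OF _ holomorphic_zeta_reg, of "\<lambda>s. of_nat k * s" S]
        by (simp add: o_def holomorphic_intros)
      have "(moebius_tail Y \<circ> (\<lambda>s. of_nat (2 * b) * s)) holomorphic_on re_gt (1 / (2 * real b))"
        by (rule holomorphic_on_compose_gen[OF _ holomorphic_moebius_tail])
           (use pos in \<open>auto intro!: holomorphic_intros simp: field_simps\<close>)
      moreover have "perron_ker N holomorphic_on re_gt (1 / (2 * real b))"
        by (rule holomorphic_on_subset[OF holomorphic_perron_ker[OF N]]) (use pos in \<open>auto intro: order.strict_trans[rotated]\<close>)
      ultimately show ?thesis unfolding h_def
        using pos by (intro holomorphic_intros 1) (simp_all add: o_def)
    qed
    have of_pq: "of_real p = (1 / of_nat a :: complex)" "of_real q = (1 / of_nat b :: complex)"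
      by (simp_all add: p_def q_def)
    have f_h: "f s = h s / ((s - of_real p) * (s - of_real q))" for s
      by (simp add: f_def h_def tail_series_def of_pq)
    \<comment> \<open>Only the poles that are passed; 1/b drops out if it lies to the left of the
      new line.\<close>
    define P where "P = {s. (s = of_real p \<or> s = of_real q) \<and> Re s > \<sigma>}"
    have img: "path_image (rectpath (Complex \<sigma> (-T)) (Complex 1 T)) =
       cbox (Complex \<sigma> (-T)) (Complex 1 T) - box (Complex \<sigma> (-T)) (Complex 1 T)" if "T > 0" for T
      by (rule path_image_rectpath_cbox_minus_box) (use that \<sigma>p pq in auto)
    have off: "s \<noteq> of_real p \<and> s \<noteq> of_real q" if "T > 0" "s \<in> path_image (rectpath (Complex \<sigma> (-T)) (Complex 1 T))" for s T
      using that(2) qs(1) pq \<sigma>p that(1) unfolding img[OF that(1)]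
      by (auto simp: in_cbox_complex_iff in_box_complex_iff)
    have pqd: "(1 / of_nat a - 1 / of_nat b :: complex) = (of_nat b - of_nat a) / (of_nat a * of_nat b)"
      using pos by (simp add: field_simps)
    have ba: "(of_nat b - of_nat a :: complex) \<noteq> 0" using ab by simp
    have nz: "(of_nat a :: complex) \<noteq> 0" "(of_nat b :: complex) \<noteq> 0" using ab by auto
    \<comment> \<open>The residue of f at p is h(p) / (p - q), at q it is -h(q) / (p - q). The
      factor b - a coming from \<open>zeta_reg\<close> at b/a or a/b cancels against p - q.\<close>
    have resp: "h (of_real p) / (of_real p - of_real q) =
        zeta (of_nat b / of_nat a) * moebius_tail Y (2 * of_nat b / of_nat a) * perron_ker N (1 / of_nat a) / of_nat a"
    proof -
      have "zeta_reg (of_nat b / of_nat a) = (of_nat b - of_nat a) / of_nat a * zeta (of_nat b / of_nat a)"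
        using nz ba by (simp add: zeta_reg_def field_simps)
      thus ?thesis using nz ba unfolding h_def of_pq pqd by simp
    qed
    have resq: "- h (of_real q) / (of_real p - of_real q) =
        zeta (of_nat a / of_nat b) * moebius_tail Y 2 * perron_ker N (1 / of_nat b) / of_nat b"
    proof -
      have "zeta_reg (of_nat a / of_nat b) = - ((of_nat b - of_nat a) / of_nat b * zeta (of_nat a / of_nat b))"
        using nz ba by (simp add: zeta_reg_def field_simps)
      thus ?thesis using nz ba unfolding h_def of_pq pqd by simp
    qed
    have I: "(f has_contour_integral 2 * of_real pi * \<i> * tail_main a b N Y) (rectpath (Complex \<sigma> (-T)) (Complex 1 T))"
      if T: "T > 0" for T
    proof (cases "b < 2 * a")
      case True
      hence \<sigma>q: "\<sigma> < q" using qs(2) by simp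
      have "((\<lambda>s. (h s / (s - of_real p) - h s / (s - of_real q)) / (of_real p - of_real q)) has_contour_integral
         (2 * of_real pi * \<i> * h (of_real p) - 2 * of_real pi * \<i> * h (of_real q)) / (of_real p - of_real q))
          (rectpath (Complex \<sigma> (-T)) (Complex 1 T))"
        by (intro has_contour_integral_div has_contour_integral_diff rect_cauchy[OF _ _ _ hol_h cq])
           (use T \<sigma>p \<sigma>q pq in auto)
      hence "(f has_contour_integral (2 * of_real pi * \<i> * h (of_real p) - 2 * of_real pi * \<i> * h (of_real q)) / (of_real p - of_real q))
          (rectpath (Complex \<sigma> (-T)) (Complex 1 T))"
      proof (rule has_contour_integral_eq)
        fix s assume "s \<in> path_image (rectpath (Complex \<sigma> (-T)) (Complex 1 T))"
        hence "s - of_real p \<noteq> 0" "s - of_real q \<noteq> 0" using off[OF T] by auto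
        moreover have "complex_of_real p - of_real q \<noteq> 0" using pq by simp
        ultimately show "(h s / (s - of_real p) - h s / (s - of_real q)) / (of_real p - of_real q) = f s"
          unfolding f_h by (simp add: divide_simps) (simp add: algebra_simps)
      qed
      also have "(2 * of_real pi * \<i> * h (of_real p) - 2 * of_real pi * \<i> * h (of_real q)) / (of_real p - of_real q) =
         2 * of_real pi * \<i> * (h (of_real p) / (of_real p - of_real q) + (- h (of_real q) / (of_real p - of_real q)))"
        by (simp add: diff_divide_distrib algebra_simps)
      also have "\<dots> = 2 * of_real pi * \<i> * tail_main a b N Y"
        unfolding resp resq tail_main_def using True by simp
      finally show ?thesis .
    next
      \<comment> \<open>Now h(s) / (s - q) is holomorphic on a half-plane that contains the
        rectangle, so only p contributes.\<close>
      case False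
      have q\<sigma>: "q < \<sigma>" using noncross[OF False] .
      have q0: "1 / (2 * real b) \<le> q" using pos by (simp add: q_def field_simps)
      have "(\<lambda>s. h s / (s - of_real q)) holomorphic_on re_gt q"
        by (intro holomorphic_intros holomorphic_on_subset[OF hol_h]) (use q0 in auto)
      from rect_cauchy[OF _ _ _ this q\<sigma>, of "of_real p" T 1] T \<sigma>p pq
      have "((\<lambda>s. h s / (s - of_real q) / (s - of_real p)) has_contour_integral
          2 * of_real pi * \<i> * (h (of_real p) / (of_real p - of_real q))) (rectpath (Complex \<sigma> (-T)) (Complex 1 T))"
        by simp
      thus ?thesis unfolding resp tail_main_def using False by (simp add: f_h [abs_def] mult.commute)
    qed
    have "norm (2 * of_real pi * \<i> * of_real S - 2 * of_real pi * \<i> * tail_main a b N Y) \<le> 2 * B / e"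
    proof (rule vline_shift_limit[where P = P and f = f and ?x0.0 = \<sigma> and ?x1.0 = 1 and
          H = "Cz * Cz * (2 * real b) * Ct * (2 * real (N + 1) powr 2)"])
      show "\<sigma> < 1" using \<sigma>p pq by simp
      show "B \<ge> 0" using D by (simp add: B_def)
      show "Cz * Cz * (2 * real b) * Ct * (2 * real (N + 1) powr 2) \<ge> 0" using Cz Ct by simp
      show "((\<lambda>T. contour_integral (vline 1 T) f) \<longlongrightarrow> 2 * of_real pi * \<i> * of_real S) at_top"
        unfolding f_def S_def by (rule tail_perron) (use ab N in auto)
      show "\<sigma> < Re s \<and> Re s < 1 \<and> Im s = 0" if "s \<in> P" for s
        using that pq by (auto simp: P_def)
      show "(f has_contour_integral 2 * of_real pi * \<i> * tail_main a b N Y) (rectpath (Complex \<sigma> (- T)) (Complex 1 T))" if "T > 0" for T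
        by (rule I[OF that])
      show "continuous_on {s. \<sigma> \<le> Re s \<and> Re s \<le> 1 \<and> s \<notin> P} f"
        unfolding f_h [abs_def]
      proof (intro continuous_intros)
        show "continuous_on {s. \<sigma> \<le> Re s \<and> Re s \<le> 1 \<and> s \<notin> P} h"
          by (rule holomorphic_on_imp_continuous_on[OF holomorphic_on_subset[OF hol_h]]) (use cq in auto)
        show "\<forall>s\<in>{s. \<sigma> \<le> Re s \<and> Re s \<le> 1 \<and> s \<notin> P}. (s - of_real p) * (s - of_real q) \<noteq> 0"
          using \<sigma>p qs(1) by (auto simp: P_def)
      qed
      show "norm (f s) \<le> Cz * Cz * (2 * real b) * Ct * (2 * real (N + 1) powr 2) / \<bar>Im s\<bar>"
        if s: "\<sigma> \<le> Re s" "Re s \<le> 1" "\<bar>Im s\<bar> \<ge> 2" for s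
      proof -
        have z: "norm (zeta (of_nat k * s)) \<le> Cz * (1 + real b * \<bar>Im s\<bar>) powr e" if k: "a \<le> k" "k \<le> b" for k
        proof -
          have "1/2 + \<delta> \<le> Re (of_nat k * s)"
          proof -
            have "real a * \<sigma> \<le> real k * Re s" using k s \<sigma>0 by (intro mult_mono) auto
            thus ?thesis using as by simp
          qed
          moreover have "1 * 2 \<le> real k * \<bar>Im s\<bar>" using k ab s by (intro mult_mono) auto
          hence "\<bar>Im (of_nat k * s)\<bar> \<ge> 2" by (simp add: abs_mult)
          ultimately have "norm (zeta (of_nat k * s)) \<le> Cz * (1 + \<bar>Im (of_nat k * s)\<bar>) powr e" by (rule Cz(2))
          also have "\<dots> \<le> Cz * (1 + real b * \<bar>Im s\<bar>) powr e"
            using k Cz(1) e by (intro mult_left_mono powr_mono2) (auto simp: abs_mult intro!: mult_right_mono)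
          finally show ?thesis .
        qed
        have m: "norm (moebius_tail Y (of_nat (2 * b) * s)) \<le> Ct"
          by (rule Ct(2)) (use s pos in simp)
        have "norm (perron_ker N s) \<le> 2 * real (N + 1) powr (Re s + 1) / norm s ^ 2"
          by (rule perron_ker_bounds(2)[OF N]) (use s \<sigma>0 in auto)
        also have "\<dots> \<le> 2 * real (N + 1) powr 2 / \<bar>Im s\<bar> ^ 2"
          using s abs_Im_le_cmod[of s] by (intro frac_le mult_left_mono powr_mono power_mono) auto
        finally have k: "norm (perron_ker N s) \<le> 2 * real (N + 1) powr 2 / \<bar>Im s\<bar> ^ 2" .
        define X where "X = 1 + real b * \<bar>Im s\<bar>"
        have X1: "X \<ge> 1" by (simp add: X_def)
        have "X powr e * X powr e = X powr (2 * e)" by (simp flip: powr_add)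
        also have "\<dots> \<le> X powr 1" using e X1 by (intro powr_mono) auto
        also have "\<dots> \<le> 2 * real b * \<bar>Im s\<bar>"
        proof -
          have "1 * 1 \<le> real b * \<bar>Im s\<bar>" using s ab by (intro mult_mono) auto
          thus ?thesis using X1 by (simp add: X_def)
        qed
        finally have XX: "X powr e * X powr e \<le> 2 * real b * \<bar>Im s\<bar>" .
        have "f s = zeta (of_nat a * s) * zeta (of_nat b * s) * moebius_tail Y (of_nat (2 * b) * s) * perron_ker N s"
        proof -
          have "Im s \<noteq> 0" using s by auto
          hence "s \<noteq> of_real p" "s \<noteq> of_real q" by auto
          thus ?thesis unfolding f_def by (subst tail_series_eq) (use ab in \<open>auto simp: of_pq\<close>)
        qed
        hence "norm (f s) \<le> (Cz * X powr e) * (Cz * X powr e) * Ct * (2 * real (N + 1) powr 2 / \<bar>Im s\<bar> ^ 2)"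
          unfolding X_def by (simp only: norm_mult) (intro mult_mono z m k, use ab Cz Ct in auto)
        also have "\<dots> = Cz * Cz * (X powr e * X powr e) * (Ct * (2 * real (N + 1) powr 2 / \<bar>Im s\<bar> ^ 2))"
          by (simp only: mult_ac)
        also have "\<dots> \<le> Cz * Cz * (2 * real b * \<bar>Im s\<bar>) * (Ct * (2 * real (N + 1) powr 2 / \<bar>Im s\<bar> ^ 2))"
          using XX Cz Ct by (intro mult_right_mono mult_left_mono) auto
        also have "\<dots> = Cz * Cz * (2 * real b) * Ct * (2 * real (N + 1) powr 2) / \<bar>Im s\<bar>"
        proof -
          define J where "J = \<bar>Im s\<bar>"
          have "J > 0" using s by (simp add: J_def)
          thus ?thesis unfolding J_def [symmetric] by (simp add: power2_eq_square)
        qed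
        finally show ?thesis .
      qed
      show "norm (f (Complex \<sigma> t)) \<le> B * (1 + \<bar>t\<bar>) powr (-1 - e)" for t
      proof -
        have mc: "of_nat k * Complex \<sigma> t = Complex (real k * \<sigma>) (real k * t)" for k
          by (simp add: complex_eq_iff)
        have "f (Complex \<sigma> t) = zeta (of_nat a * Complex \<sigma> t) * zeta (of_nat b * Complex \<sigma> t) *
           moebius_tail Y (of_nat (2 * b) * Complex \<sigma> t) * perron_ker N (Complex \<sigma> t)"
        proof -
          have "Complex \<sigma> t \<noteq> of_real p" "Complex \<sigma> t \<noteq> of_real q" using \<sigma>p qs(1) by (auto simp: complex_eq_iff)
          thus ?thesis unfolding f_def by (subst tail_series_eq) (use ab in \<open>auto simp: of_pq\<close>)
        qed
        also have "norm \<dots> \<le> (Ca * (real a powr e * (1 + \<bar>t\<bar>) powr e)) * (Cb * (real b powr e * (1 + \<bar>t\<bar>) powr e))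
           * (Cm * (real (2 * b) powr e * (1 + \<bar>t\<bar>) powr e) * real Y powr (1/2 + \<delta> + 2 * e - 2 * real b * \<sigma>))
           * (Ck * real N powr (\<sigma> + 4 * e) * (1 + \<bar>t\<bar>) powr (-1 - 4 * e))"
          unfolding norm_mult mc
        proof (intro mult_mono)
          show "norm (zeta (Complex (real a * \<sigma>) (real a * t))) \<le> Ca * (real a powr e * (1 + \<bar>t\<bar>) powr e)"
            by (rule order_trans[OF Ca(2)]) (use Ca(1) scale[of a t] ab in \<open>auto intro!: mult_left_mono\<close>)
          show "norm (zeta (Complex (real b * \<sigma>) (real b * t))) \<le> Cb * (real b powr e * (1 + \<bar>t\<bar>) powr e)"
            by (rule order_trans[OF Cb(2)]) (use Cb(1) scale[of b t] ab in \<open>auto intro!: mult_left_mono\<close>)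
          have "norm (moebius_tail Y (Complex (2 * real b * \<sigma>) (real (2 * b) * t))) \<le>
              Cm * (1 + \<bar>real (2 * b) * t\<bar>) powr e * real Y powr (1/2 + \<delta> + 2 * e - 2 * real b * \<sigma>)"
            by (rule Cm(2)[OF Y])
          also have "\<dots> \<le> Cm * (real (2 * b) powr e * (1 + \<bar>t\<bar>) powr e) * real Y powr (1/2 + \<delta> + 2 * e - 2 * real b * \<sigma>)"
            by (intro mult_right_mono mult_left_mono scale) (use ab Cm(1) in auto)
          finally show "norm (moebius_tail Y (Complex (real (2 * b) * \<sigma>) (real (2 * b) * t))) \<le>
             Cm * (real (2 * b) powr e * (1 + \<bar>t\<bar>) powr e) * real Y powr (1/2 + \<delta> + 2 * e - 2 * real b * \<sigma>)"
            by simp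
          show "norm (perron_ker N (Complex \<sigma> t)) \<le> Ck * real N powr (\<sigma> + 4 * e) * (1 + \<bar>t\<bar>) powr (-1 - 4 * e)"
            by (rule Ck(2)[OF N])
        qed (use Ca(1) Cb(1) Cm(1) in auto)
        also have "\<dots> = B * ((1 + \<bar>t\<bar>) powr e * (1 + \<bar>t\<bar>) powr e * (1 + \<bar>t\<bar>) powr e * (1 + \<bar>t\<bar>) powr (-1 - 4 * e))"
          unfolding B_def D_def by (simp only: mult_ac)
        \<comment> \<open>The two zeta factors and f_Y each cost one e; the kernel was given -1 - 4e
          so that -1 - e remains.\<close>
        also have "(1 + \<bar>t\<bar>) powr e * (1 + \<bar>t\<bar>) powr e * (1 + \<bar>t\<bar>) powr e * (1 + \<bar>t\<bar>) powr (-1 - 4 * e) = (1 + \<bar>t\<bar>) powr (-1 - e)"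
        proof -
          have "e + e + e + (-1 - 4 * e) = -1 - e" by simp
          thus ?thesis by (simp only: powr_add [symmetric])
        qed
        finally show ?thesis .
      qed
    qed (use e in auto)
    also have "2 * of_real pi * \<i> * of_real S - 2 * of_real pi * \<i> * tail_main a b N Y = 2 * of_real pi * \<i> * (of_real S - tail_main a b N Y)"
      by (simp add: right_diff_distrib)
    also have "norm \<dots> = 2 * pi * norm (of_real S - tail_main a b N Y)" by (simp add: norm_mult)
    finally have "2 * pi * norm (of_real S - tail_main a b N Y) \<le> 2 * B / e" .
    moreover have "1 * norm (of_real S - tail_main a b N Y) \<le> 2 * pi * norm (of_real S - tail_main a b N Y)"
      using pi_ge_two by (intro mult_right_mono) auto
    ultimately have "norm (of_real S - tail_main a b N Y) \<le> 2 * B / e" by simp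
    also have "2 * B / e = 2 * D / e * real N powr (\<sigma> + 4 * e) * real Y powr (1/2 + \<delta> + 2 * e - 2 * real b * \<sigma>)"
      by (simp add: B_def)
    finally show "norm (of_real (\<Sum>(m1, m2, m)\<in>{(m1, m2, m) \<in> triples a b N. m > Y}. moebius_mu m) - tail_main a b N Y)
     \<le> 2 * D / e * real N powr (\<sigma> + 4 * e) * real Y powr (1/2 + \<delta> + 2 * e - 2 * real b * \<sigma>)"
      unfolding S_def .
  qed
qed

section \<open>The asymptotic formula\<close>

text \<open>Induction on Y; by the mean value theorem the new term is at most the increment of the
  right-hand side.\<close>

lemma sum_powr_le:
  fixes \<phi> :: real
  assumes "0 < \<phi>" "\<phi> < 1"
  shows "(\<Sum>m\<in>{1..Y}. real m powr (-\<phi>)) \<le> real Y powr (1 - \<phi>) / (1 - \<phi>)"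
proof (induction Y)
  case (Suc Y)
  have "real (Suc Y) powr (-\<phi>) \<le> (real (Suc Y) powr (1 - \<phi>) - real Y powr (1 - \<phi>)) / (1 - \<phi>)"
  proof (cases "Y = 0")
    case True
    thus ?thesis using assms by (simp add: field_simps)
  next
    case False
    have "\<exists>z>real Y. z < real Y + 1 \<and> (real Y + 1) powr (1 - \<phi>) - real Y powr (1 - \<phi>) = (real Y + 1 - real Y) * ((1 - \<phi>) * z powr (1 - \<phi> - 1))"
    proof (rule MVT2)
      fix z assume "real Y \<le> z"
      hence "z > 0" using False by simp
      thus "((\<lambda>z. z powr (1 - \<phi>)) has_real_derivative (1 - \<phi>) * z powr (1 - \<phi> - 1)) (at z)"
        by (rule has_real_derivative_powr)
    qed auto
    then obtain z where z: "real Y < z" "z < real Y + 1"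
      "(real Y + 1) powr (1 - \<phi>) - real Y powr (1 - \<phi>) = (1 - \<phi>) * z powr (-\<phi>)" by auto
    have "(real Y + 1) powr (-\<phi>) \<le> z powr (-\<phi>)" using z assms by (intro powr_mono2') auto
    also have "\<dots> = ((real Y + 1) powr (1 - \<phi>) - real Y powr (1 - \<phi>)) / (1 - \<phi>)" using z(3) assms by simp
    finally show ?thesis by (simp add: add.commute)
  qed
  with Suc show ?case by (simp add: diff_divide_distrib)
qed auto

text \<open>The O-hypothesis concerns large u only, whereas the arguments N / m^(2b) may come down
  to 1. On the bounded range from 1 to X1 each part of the error is at most its size at X1, which
  gives the constant K.\<close>

lemma div_error_bound:
  fixes a b :: nat and \<gamma> :: real
  assumes ab: "a > 0" "b > 0" and \<gamma>: "\<gamma> > 0" and O: "div_error a b \<in> O[at_top](\<lambda>x. x powr \<gamma>)"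
  shows "\<exists>C>0. \<forall>u\<ge>1. \<bar>div_error a b u\<bar> \<le> C * u powr \<gamma>"
proof -
  obtain c where c: "c > 0" "eventually (\<lambda>x. norm (div_error a b x) \<le> c * norm (x powr \<gamma>)) at_top"
    using landau_o.bigE[OF O] by blast
  then obtain X where X: "\<And>x. x \<ge> X \<Longrightarrow> norm (div_error a b x) \<le> c * norm (x powr \<gamma>)"
    unfolding eventually_at_top_linorder by blast
  define X1 where "X1 = max X 1"
  define za zb where "za = \<bar>zeta_real (real b / real a)\<bar>" and "zb = \<bar>zeta_real (real a / real b)\<bar>"
  define K where "K = (\<Sum>n | 0 < n \<and> real n \<le> X1. real (div_count a b n)) + za * X1 powr (1 / real a) + zb * X1 powr (1 / real b)"
  have fin: "finite {n. 0 < n \<and> real n \<le> u}" for u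
    by (rule finite_subset[of _ "{..nat \<lfloor>u\<rfloor>}"]) (auto simp: le_nat_floor)
  have K: "K \<ge> 0" by (simp add: K_def sum_nonneg za_def zb_def)
  show ?thesis
  proof (intro exI[of _ "c + K"] conjI allI impI)
    show "c + K > 0" using c K by simp
    fix u :: real assume u: "u \<ge> 1"
    have up: "u powr \<gamma> \<ge> 1" using u \<gamma> by (intro ge_one_powr_ge_zero) auto
    show "\<bar>div_error a b u\<bar> \<le> (c + K) * u powr \<gamma>"
    proof (cases "u \<ge> X")
      case True
      have "\<bar>div_error a b u\<bar> \<le> c * u powr \<gamma>" using X[OF True] by simp
      also have "\<dots> \<le> (c + K) * u powr \<gamma>" using K by (intro mult_right_mono) auto
      finally show ?thesis .
    next
      case False
      hence uX: "u \<le> X1" by (simp add: X1_def)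
      have "(\<Sum>n | 0 < n \<and> real n \<le> u. real (div_count a b n)) \<le> (\<Sum>n | 0 < n \<and> real n \<le> X1. real (div_count a b n))"
        using uX by (intro sum_mono2 fin) auto
      moreover have "(\<Sum>n | 0 < n \<and> real n \<le> u. real (div_count a b n)) \<ge> 0" by (intro sum_nonneg) auto
      moreover have "\<bar>zeta_real (real b / real a) * u powr (1 / real a)\<bar> \<le> za * X1 powr (1 / real a)"
        unfolding abs_mult za_def using u uX by (intro mult_mono) (auto intro!: powr_mono2)
      moreover have "\<bar>zeta_real (real a / real b) * u powr (1 / real b)\<bar> \<le> zb * X1 powr (1 / real b)"
        unfolding abs_mult zb_def using u uX by (intro mult_mono) (auto intro!: powr_mono2)
      ultimately have "\<bar>div_error a b u\<bar> \<le> K" unfolding div_error_def K_def by (simp only: of_nat_sum)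
      also have "\<dots> \<le> (c + K) * 1" using c by simp
      also have "\<dots> \<le> (c + K) * u powr \<gamma>" using up c K by (intro mult_left_mono) auto
      finally show ?thesis .
    qed
  qed
qed

lemma of_nat_powr_of_real: "of_nat n powr (of_real x) = complex_of_real (real n powr x)"
  by (metis of_nat_0_le_iff of_real_of_nat_eq powr_of_real)

lemma moebius_tail_of_real:
  assumes "x > 1"
  shows "moebius_tail Y (of_real x) = of_real (Re (moebius_tail Y (of_real x)))"
proof -
  have "((\<lambda>m. Im (of_real (moebius_mu m) * of_nat m powr (- of_real x))) has_sum Im (moebius_tail Y (of_real x))) {Y<..}"
    by (intro has_sum_Im moebius_tail_has_sum) (use assms in auto)
  moreover have "Im (of_real (moebius_mu m) * of_nat m powr (- of_real x)) = 0" for m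
    using of_nat_powr_of_real[of m "-x"] by simp
  ultimately have "((\<lambda>m. 0) has_sum Im (moebius_tail Y (of_real x))) {Y<..}" by (simp only:)
  moreover have "((\<lambda>m::nat. 0 :: real) has_sum 0) {Y<..}" by simp
  ultimately have "Im (moebius_tail Y (of_real x)) = 0" using has_sum_unique by blast
  thus ?thesis by (simp add: complex_eq_iff)
qed

lemma zeta_of_real:
  assumes "x > 1"
  shows "zeta (of_real x) = of_real (zeta_real x)"
proof -
  have "((\<lambda>m. Im (of_nat m powr (- of_real x))) has_sum Im (zeta (of_real x))) {0<..}"
    by (intro has_sum_Im zeta_has_sum) (use assms in auto)
  moreover have "Im (of_nat m powr (- of_real x)) = 0" for m
    using of_nat_powr_of_real[of m "-x"] by simp
  ultimately have "((\<lambda>m. 0) has_sum Im (zeta (of_real x))) {0::nat<..}" by (simp only:)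
  moreover have "((\<lambda>m::nat. 0 :: real) has_sum 0) {0<..}" by simp
  ultimately have "Im (zeta (of_real x)) = 0" using has_sum_unique by blast
  thus ?thesis by (simp add: complex_eq_iff zeta_real_def)
qed

lemma inverse_zeta_real:
  assumes "x > 1"
  shows "1 / zeta_real x = (\<Sum>m\<in>{1..Y}. moebius_mu m * real m powr (-x)) + Re (moebius_tail Y (of_real x))"
proof -
  have "complex_of_real (1 / zeta_real x) = 1 / zeta (of_real x)"
    using zeta_of_real[OF assms] by simp
  also have "\<dots> = (\<Sum>m\<in>{1..Y}. of_real (moebius_mu m) * of_nat m powr (- of_real x)) + moebius_tail Y (of_real x)"
    by (rule moebius_tail_eq) (use assms in simp)
  also have "(\<Sum>m\<in>{1..Y}. of_real (moebius_mu m) * of_nat m powr (- of_real x)) = complex_of_real (\<Sum>m\<in>{1..Y}. moebius_mu m * real m powr (-x))"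
    using of_nat_powr_of_real[of _ "-x"] by simp
  finally have "Re (complex_of_real (1 / zeta_real x)) = Re (complex_of_real (\<Sum>m\<in>{1..Y}. moebius_mu m * real m powr (-x)) + moebius_tail Y (of_real x))"
    by (rule arg_cong)
  thus ?thesis by simp
qed

text \<open>The residue at 1/c carries a factor 1/c, while the kernel there is c N^(1/c) with error
  at most c; together they give N^(1/c) + O(1).\<close>

lemma Re_tail_main:
  assumes ab: "2 \<le> a" "a < b" and N: "N > 0"
  obtains ka kb :: real where "\<bar>ka - real N powr (1 / real a)\<bar> \<le> 1" "\<bar>kb - real N powr (1 / real b)\<bar> \<le> 1"
    "Re (tail_main a b N Y) = zeta_real (real b / real a) * Re (moebius_tail Y (of_real (2 * real b / real a))) * ka
      + (if b < 2 * a then zeta_real (real a / real b) * Re (moebius_tail Y (of_real 2)) * kb else 0)"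
proof -
  have *: "\<exists>k. perron_ker N (1 / of_nat c) / of_nat c = of_real k \<and> \<bar>k - real N powr (1 / real c)\<bar> \<le> 1" if c: "c \<ge> 2" for c :: nat
  proof -
    have c': "0 < 1 / real c" "1 / real c \<le> 1" using c by auto
    obtain k where k: "perron_ker N (of_real (1 / real c)) = of_real k" "\<bar>k - real N powr (1 / real c) / (1 / real c)\<bar> \<le> 1 / (1 / real c)"
      using perron_ker_real[OF N c'] by blast
    have "\<bar>k / real c - real N powr (1 / real c)\<bar> = \<bar>k - real N powr (1 / real c) / (1 / real c)\<bar> / real c"
    proof -
      have "k - real N powr (1 / real c) / (1 / real c) = real c * (k / real c - real N powr (1 / real c))"
        using c by (simp add: field_simps)
      thus ?thesis using c by (simp add: abs_mult)
    qed
    also have "\<dots> \<le> real c / real c" using k(2) c by (intro divide_right_mono) auto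
    finally have "\<bar>k / real c - real N powr (1 / real c)\<bar> \<le> 1" using c by simp
    moreover have "perron_ker N (1 / of_nat c) / of_nat c = of_real (k / real c)" using k(1) by simp
    ultimately show ?thesis by blast
  qed
  obtain ka where ka: "perron_ker N (1 / of_nat a) / of_nat a = of_real ka" "\<bar>ka - real N powr (1 / real a)\<bar> \<le> 1"
    using *[of a] ab by auto
  obtain kb where kb: "perron_ker N (1 / of_nat b) / of_nat b = of_real kb" "\<bar>kb - real N powr (1 / real b)\<bar> \<le> 1"
    using *[of b] ab by auto
  define ma mb where "ma = Re (moebius_tail Y (of_real (2 * real b / real a)))" and "mb = Re (moebius_tail Y (of_real 2))"
  have "2 * real b / real a > 1" using ab by simp
  hence ma: "moebius_tail Y (of_real (2 * real b / real a)) = of_real ma"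
    unfolding ma_def by (rule moebius_tail_of_real)
  have mb: "moebius_tail Y (of_real 2) = of_real mb"
    unfolding mb_def by (rule moebius_tail_of_real) simp
  have "tail_main a b N Y = zeta (of_real (real b / real a)) * (moebius_tail Y (of_real (2 * real b / real a)) * (perron_ker N (1 / of_nat a) / of_nat a))
      + (if b < 2 * a then zeta (of_real (real a / real b)) * (moebius_tail Y (of_real 2) * (perron_ker N (1 / of_nat b) / of_nat b)) else 0)"
    by (simp add: tail_main_def mult.assoc)
  also have "\<dots> = zeta (of_real (real b / real a)) * of_real (ma * ka)
      + (if b < 2 * a then zeta (of_real (real a / real b)) * of_real (mb * kb) else 0)"
    unfolding ma mb ka kb by simp
  finally have "Re (tail_main a b N Y) = zeta_real (real b / real a) * ma * ka
      + (if b < 2 * a then zeta_real (real a / real b) * mb * kb else 0)"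
    by (simp add: zeta_real_def del: of_real_mult of_real_divide)
  with that ka(2) kb(2) show ?thesis unfolding ma_def mb_def by blast
qed

text \<open>An exact identity, obtained by cutting the series of 1/zeta at Y: its finite part arises
  from the divisor problem for m \<le> Y, and its tail is left to be matched with the residues in
  \<open>tail_main\<close>.\<close>

lemma gen_square_full_decomposition:
  fixes a b N Y :: nat
  assumes ab: "2 \<le> a" "a < b" "\<not> a dvd b"
  shows "(\<Sum>n | 0 < n \<and> n \<le> N. gen_square_full_char a b n)
     - (zeta_real (real b / real a) / zeta_real (2 * real b / real a) * real N powr (1 / real a)
        + zeta_real (real a / real b) / zeta_real 2 * real N powr (1 / real b))
    = (\<Sum>m\<in>{1..Y}. moebius_mu m * div_error a b (real N / real m ^ (2 * b)))
      + ((\<Sum>(m1, m2, m)\<in>{(m1, m2, m) \<in> triples a b N. m > Y}. moebius_mu m)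
         - zeta_real (real b / real a) * Re (moebius_tail Y (of_real (2 * real b / real a))) * real N powr (1 / real a)
         - zeta_real (real a / real b) * Re (moebius_tail Y (of_real 2)) * real N powr (1 / real b))"
proof -
  define za zb where "za = zeta_real (real b / real a)" and "zb = zeta_real (real a / real b)"
  define Sa Sb where "Sa = (\<Sum>m\<in>{1..Y}. moebius_mu m * real m powr (- (2 * real b / real a)))"
    and "Sb = (\<Sum>m\<in>{1..Y}. moebius_mu m * real m powr (-2))"
  define Na Nb where "Na = real N powr (1 / real a)" and "Nb = real N powr (1 / real b)"
  define T where "T = (\<Sum>(m1, m2, m)\<in>{(m1, m2, m) \<in> triples a b N. m > Y}. moebius_mu m)"
  define E where "E = (\<Sum>m\<in>{1..Y}. moebius_mu m * div_error a b (real N / real m ^ (2 * b)))"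
  have pos: "a > 0" "b > 0" using ab by auto
  have inv: "1 / zeta_real (2 * real b / real a) = Sa + Re (moebius_tail Y (of_real (2 * real b / real a)))"
    "1 / zeta_real 2 = Sb + Re (moebius_tail Y (of_real 2))"
    unfolding Sa_def Sb_def by (rule inverse_zeta_real; use ab in simp)+
  have fin: "finite (triples a b N)" by (rule finite_triples) (use pos in auto)
  have un: "triples a b N = {(m1, m2, m) \<in> triples a b N. m \<le> Y} \<union> {(m1, m2, m) \<in> triples a b N. m > Y}"
    by auto
  have "(\<Sum>n | 0 < n \<and> n \<le> N. gen_square_full_char a b n) = (\<Sum>(m1, m2, m)\<in>triples a b N. moebius_mu m)"
    by (rule sum_gen_square_full) (use ab pos in auto)
  also have "\<dots> = (\<Sum>(m1, m2, m)\<in>{(m1, m2, m) \<in> triples a b N. m \<le> Y}. moebius_mu m) + T"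
    unfolding T_def by (subst un, rule sum.union_disjoint) (auto intro: finite_subset[OF _ fin])
  also have "(\<Sum>(m1, m2, m)\<in>{(m1, m2, m) \<in> triples a b N. m \<le> Y}. moebius_mu m)
     = (\<Sum>m\<in>{1..Y}. moebius_mu m * (\<Sum>n | 0 < n \<and> real n \<le> real N / real m ^ (2 * b). real (div_count a b n)))"
    by (rule sum_triples_le) (use pos in auto)
  also have "\<dots> = (\<Sum>m\<in>{1..Y}. za * Na * (moebius_mu m * real m powr (- (2 * real b / real a)))
      + zb * Nb * (moebius_mu m * real m powr (-2)) + moebius_mu m * div_error a b (real N / real m ^ (2 * b)))"
  proof (rule sum.cong)
    fix m assume m: "m \<in> {1..Y}"
    have pw: "(real N / real m ^ (2 * b)) powr (1 / real c) = real N powr (1 / real c) * real m powr (- (2 * real b / real c))" if "c > 0" for c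
    proof -
      have "real m ^ (2 * b) = real m powr (real (2 * b))" using m by (subst powr_realpow) auto
      thus ?thesis using m by (simp add: powr_divide powr_powr powr_minus_divide)
    qed
    have "(\<Sum>n | 0 < n \<and> real n \<le> real N / real m ^ (2 * b). real (div_count a b n)) =
      za * (Na * real m powr (- (2 * real b / real a))) + zb * (Nb * real m powr (-2)) + div_error a b (real N / real m ^ (2 * b))"
      using pos by (simp add: div_error_def pw za_def zb_def Na_def Nb_def)
    thus "moebius_mu m * (\<Sum>n | 0 < n \<and> real n \<le> real N / real m ^ (2 * b). real (div_count a b n)) =
      za * Na * (moebius_mu m * real m powr (- (2 * real b / real a)))
      + zb * Nb * (moebius_mu m * real m powr (-2)) + moebius_mu m * div_error a b (real N / real m ^ (2 * b))"
      by (simp add: algebra_simps)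
  qed auto
  also have "\<dots> = za * Na * Sa + zb * Nb * Sb + E"
    by (simp add: sum.distrib sum_distrib_left Sa_def Sb_def E_def)
  finally have main: "(\<Sum>n | 0 < n \<and> n \<le> N. gen_square_full_char a b n) = za * Na * Sa + zb * Nb * Sb + E + T" .
  have "za / zeta_real (2 * real b / real a) = za * (Sa + Re (moebius_tail Y (of_real (2 * real b / real a))))"
    "zb / zeta_real 2 = zb * (Sb + Re (moebius_tail Y (of_real 2)))"
    by (simp_all only: inv [symmetric] times_divide_eq_right mult_1_right)
  thus ?thesis unfolding main za_def [symmetric] zb_def [symmetric] Na_def [symmetric] Nb_def [symmetric]
      T_def [symmetric] E_def [symmetric] by (simp only:) (simp add: algebra_simps)
qed

text \<open>\<open>gen_square_full_decomposition\<close> is applied with Y near N^\<eta>. The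
  divisor errors and the shifted integral then both have exponent E up to \<epsilon>, and replacing
  the kernel values by powers of N costs O(1).\<close>

lemma gen_square_full_nat_bound:
  fixes a b :: nat and \<alpha> \<epsilon> :: real
  assumes RH: Riemann_Hypothesis and ab: "2 \<le> a" "a < b" "\<not> a dvd b"
    and \<alpha>: "0 < \<alpha>" "\<alpha> < 1 / (2 * real b)" and \<epsilon>: "\<epsilon> > 0"
    and O: "div_error a b \<in> O[at_top](\<lambda>x. x powr (\<alpha> + \<epsilon>))"
  shows "\<exists>C>0. \<forall>N\<ge>1.
    \<bar>(\<Sum>n | 0 < n \<and> n \<le> N. gen_square_full_char a b n)
     - (zeta_real (real b / real a) / zeta_real (2 * real b / real a) * real N powr (1 / real a)
        + zeta_real (real a / real b) / zeta_real 2 * real N powr (1 / real b))\<bar>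
     \<le> C * real N powr ((1 - real a * \<alpha>) / (real a + 2 * real b - 4 * real a * real b * \<alpha>) + \<epsilon>)"
proof -
  define za zb where "za = zeta_real (real b / real a)" and "zb = zeta_real (real a / real b)"
  define Dn where "Dn = real a + 2 * real b - 4 * real a * real b * \<alpha>"
  \<comment> \<open>Chosen so that both \<open>E1\<close> and \<open>E2\<close> hold: E is the
    common exponent of the two error sources.\<close>
  define \<eta> where "\<eta> = (1 - 2 * real a * \<alpha>) / Dn"
  define E where "E = (1 - real a * \<alpha>) / Dn"
  \<comment> \<open>The losses in \<open>ex2\<close> are e from \<sigma>, 4e from the kernel and 3e
    from the exponent of Y, whence \<epsilon>/8. The last entry keeps \<sigma> below 1/b when b <
    2a; otherwise it is a placeholder.\<close>
  define e where "e = min (\<epsilon> / 8) (min (1/8) (if b < 2 * a then (real a / real b - 1/2) / 2 else 1))"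
  define \<sigma> where "\<sigma> = (1/2 + e) / real a"
  have pos: "real a > 0" "real b > 0" "real a < real b" "a > 0" "b > 0" using ab by auto
  have b2a: "b \<noteq> 2 * a" using ab by auto
  have b\<alpha>: "2 * real b * \<alpha> < 1" using \<alpha> pos by (simp add: field_simps)
  have a\<alpha>: "2 * real a * \<alpha> < 1"
  proof -
    have "2 * real a * \<alpha> < 2 * real b * \<alpha>" using pos \<alpha> by simp
    thus ?thesis using b\<alpha> by linarith
  qed
  have Dn: "Dn > 0"
  proof -
    have "2 * real a * (2 * real b * \<alpha>) < 2 * real a * 1" using b\<alpha> pos by (intro mult_strict_left_mono) auto
    moreover have "4 * real a * real b * \<alpha> = 2 * real a * (2 * real b * \<alpha>)" by simp
    ultimately show ?thesis using pos unfolding Dn_def by linarith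
  qed
  have \<eta>0: "\<eta> > 0" using a\<alpha> Dn by (simp add: \<eta>_def)
  \<comment> \<open>Guarantees N / m^(2b) \<ge> 1 for all m \<le> Y, the range in which
    \<open>div_error_bound\<close> holds.\<close>
  have \<eta>b: "2 * real b * \<eta> \<le> 1"
    using Dn pos by (simp add: \<eta>_def divide_le_eq) (simp add: Dn_def algebra_simps)
  have \<eta>1: "\<eta> \<le> 1"
  proof -
    have "1 * \<eta> \<le> 2 * real b * \<eta>" using \<eta>0 ab by (intro mult_right_mono) auto
    thus ?thesis using \<eta>b by simp
  qed
  have E1: "E = \<alpha> + \<eta> * (1 - 2 * real b * \<alpha>)"
    using Dn by (simp add: E_def \<eta>_def divide_simps) (simp add: Dn_def algebra_simps)
  have E2: "E = 1 / (2 * real a) - \<eta> * (real b / real a - 1/2)"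
    using Dn pos by (simp add: E_def \<eta>_def divide_simps) (simp add: Dn_def algebra_simps)
  have E0: "E > 0" using E1 \<alpha> \<eta>0 b\<alpha> by (simp add: add_pos_pos)
  have e: "0 < e" "e \<le> 1/8" "8 * e \<le> \<epsilon>" "b < 2 * a \<Longrightarrow> e \<le> (real a / real b - 1/2) / 2"
  proof -
    have "real a / real b - 1/2 > 0" if "b < 2 * a"
    proof -
      have "real b < 2 * real a" using that by linarith
      thus ?thesis using pos by (simp add: field_simps)
    qed
    thus "0 < e" using \<epsilon> by (auto simp: e_def)
    show "e \<le> 1/8" "8 * e \<le> \<epsilon>" by (auto simp: e_def min_def)
    show "e \<le> (real a / real b - 1/2) / 2" if "b < 2 * a"
      unfolding e_def if_P[OF that] by (intro min.coboundedI2 order_refl)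
  qed
  have e2: "e < 1/2" "e \<le> 1/4" "e \<le> 1/2" using e(2) by linarith+
  have cross: "\<sigma> < 1 / real b" if "b < 2 * a"
  proof -
    have "2 * e \<le> real a / real b - 1/2" using e(4)[OF that] by simp
    hence "1/2 + e < real a / real b" using e(1) by linarith
    hence "\<sigma> < (real a / real b) / real a" unfolding \<sigma>_def using pos by (intro divide_strict_right_mono) auto
    thus ?thesis using pos by simp
  qed
  obtain C1 where C1: "C1 > 0" "\<And>u. u \<ge> 1 \<Longrightarrow> \<bar>div_error a b u\<bar> \<le> C1 * u powr (\<alpha> + \<epsilon>)"
    using div_error_bound[OF pos(4,5) _ O] \<alpha> \<epsilon> by auto
  obtain C2 where C2: "C2 > 0" "\<And>N Y. N > 0 \<Longrightarrow> Y > 0 \<Longrightarrow>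
     norm (of_real (\<Sum>(m1, m2, m)\<in>{(m1, m2, m) \<in> triples a b N. m > Y}. moebius_mu m) - tail_main a b N Y)
     \<le> C2 * real N powr (\<sigma> + 4 * e) * real Y powr (1/2 + e + 2 * e - 2 * real b * \<sigma>)"
    using tail_estimate[OF RH ab(1,2) b2a e(1) e2(1) e(1) e2(2) \<sigma>_def cross] by blast
  obtain C3 where C3: "C3 > 0" "\<And>Y s. Re s \<ge> min 2 (2 * real b / real a) \<Longrightarrow> norm (moebius_tail Y s) \<le> C3"
    using moebius_tail_trivial_bound[of "min 2 (2 * real b / real a)"] pos by auto
  have kap: "1/2 + e + 2 * e < 2" using e(2) by linarith
  obtain C4 where C4: "C4 > 0" "\<And>Y t. Y > 0 \<Longrightarrow> norm (moebius_tail Y (Complex 2 t)) \<le> C4 * (1 + \<bar>t\<bar>) powr e * real Y powr (1/2 + e + 2 * e - 2)"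
    using moebius_tail_bound[OF RH e(1) e2(1) e(1) e2(3) _ kap] by auto
  define \<nu> where "\<nu> = 2 * real b * \<sigma> - (1/2 + e + 2 * e)"
  define \<nu>2 where "\<nu>2 = 2 - (1/2 + e + 2 * e)"
  have \<sigma>b: "2 * real b * \<sigma> = real b / real a + 2 * e * (real b / real a)"
    using pos by (simp add: \<sigma>_def field_simps)
  have ba1: "real b / real a > 1" using pos by simp
  have \<nu>_eq: "\<nu> = (real b / real a - 1/2) + (2 * e * (real b / real a) - 3 * e)"
    by (simp add: \<nu>_def \<sigma>b)
  have \<nu>0: "\<nu> > 0"
  proof -
    have "2 * e * (real b / real a) > 0" using e(1) pos by simp
    thus ?thesis using ba1 e(2) unfolding \<nu>_eq by linarith
  qed
  have \<nu>20: "\<nu>2 > 0" using e(2) by (simp add: \<nu>2_def)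
  have ex2: "\<sigma> + 4 * e - \<eta> * \<nu> \<le> E + \<epsilon>"
  proof -
    have "\<sigma> = 1 / (2 * real a) + e / real a" using pos by (simp add: \<sigma>_def field_simps)
    moreover have "e / real a \<le> e" using e(1) ab by (simp add: divide_le_eq)
    moreover have "\<eta> * \<nu> = \<eta> * (real b / real a - 1/2) + \<eta> * (2 * e * (real b / real a)) - 3 * (\<eta> * e)"
      by (simp add: \<nu>_eq algebra_simps)
    moreover have "\<eta> * (2 * e * (real b / real a)) \<ge> 0" using \<eta>0 e(1) pos by simp
    moreover have "\<eta> * e \<le> 1 * e" using \<eta>1 e(1) by (intro mult_right_mono) auto
    ultimately show ?thesis using E2 e(3) by linarith
  qed
  \<comment> \<open>Exponent of the part of the second main term that meets no residue when b > 2a.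
    Both factors of (1/(2a) - 1/b) (1 - 2b\<eta>) are nonnegative, and this rearranges to 1/b -
    3\<eta>/2 \<le> E.\<close>
  have ex4: "1 / real b - \<eta> * \<nu>2 \<le> E + \<epsilon>" if "\<not> b < 2 * a"
  proof -
    have d: "1 / real b \<le> 1 / (2 * real a)"
    proof -
      have "2 * real a \<le> real b" using that by linarith
      thus ?thesis using pos by (intro divide_left_mono) auto
    qed
    have "(1 / (2 * real a) - 1 / real b) * (1 - 2 * real b * \<eta>) \<ge> 0"
      using d \<eta>b by (intro mult_nonneg_nonneg) auto
    hence "1 / (2 * real a) - \<eta> * (real b / real a) - 1 / real b + 2 * \<eta> \<ge> 0"
      using pos by (simp add: algebra_simps)
    moreover have "\<eta> * (real b / real a - 1/2) = \<eta> * (real b / real a) - \<eta> / 2" by (simp add: algebra_simps)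
    moreover have "\<eta> * \<nu>2 = 3/2 * \<eta> - 3 * (\<eta> * e)" by (simp add: \<nu>2_def algebra_simps)
    moreover have "\<eta> * e \<le> 1 * e" using \<eta>1 e(1) by (intro mult_right_mono) auto
    ultimately show ?thesis using E2 e(1,3) by linarith
  qed
  define C where "C = C1 / (1 - 2 * real b * \<alpha>) + C2 * 2 powr \<nu> + \<bar>za\<bar> * C3 + \<bar>zb\<bar> * C3 + \<bar>zb\<bar> * C4 * 2 powr \<nu>2 + 1"
  have C0: "C > 0" unfolding C_def using C1(1) C2(1) C3(1) C4(1) b\<alpha> by (intro add_nonneg_pos add_nonneg_nonneg) auto
  show ?thesis
  proof (intro exI[of _ C] conjI allI impI)
    fix N :: nat assume N: "N \<ge> 1"
    define Y where "Y = nat \<lfloor>real N powr \<eta>\<rfloor>"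
    have N1: "real N \<ge> 1" using N by simp
    have Np: "real N powr \<eta> \<ge> 1" using N1 \<eta>0 by (intro ge_one_powr_ge_zero) auto
    have Y1: "Y \<ge> 1" using Np by (simp add: Y_def le_nat_iff le_floor_iff)
    have Yle: "real Y \<le> real N powr \<eta>" using Np by (simp add: Y_def)
    have Yge: "real N powr \<eta> \<le> 2 * real Y"
    proof -
      have "real N powr \<eta> < real Y + 1" unfolding Y_def using Np by linarith
      thus ?thesis using Y1 by linarith
    qed
    \<comment> \<open>Rounding N^\<eta> down loses at most a factor 2, which negative powers of Y
      turn into 2^x.\<close>
    have Yneg: "real Y powr (-x) \<le> 2 powr x * real N powr (- (\<eta> * x))" if "x > 0" for x
    proof -
      have "real Y powr (-x) \<le> (real N powr \<eta> / 2) powr (-x)"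
        using Yge Np that N by (intro powr_mono2') auto
      also have "\<dots> = 2 powr x * real N powr (- (\<eta> * x))"
        using N1 by (simp add: powr_divide powr_powr powr_minus_divide)
      finally show ?thesis .
    qed
    define W where "W = real N powr (E + \<epsilon>)"
    have W1: "W \<ge> 1" unfolding W_def using N1 E0 \<epsilon> by (intro ge_one_powr_ge_zero) auto
    have WI: "real N powr x \<le> W" if "x \<le> E + \<epsilon>" for x
      unfolding W_def using that N1 by (intro powr_mono) auto
    define Sd where "Sd = (\<Sum>m\<in>{1..Y}. moebius_mu m * div_error a b (real N / real m ^ (2 * b)))"
    define T where "T = (\<Sum>(m1, m2, m)\<in>{(m1, m2, m) \<in> triples a b N. m > Y}. moebius_mu m)"
    define fa fb where "fa = Re (moebius_tail Y (of_real (2 * real b / real a)))" and "fb = Re (moebius_tail Y (of_real 2))"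
    have fa: "\<bar>fa\<bar> \<le> C3" and fb: "\<bar>fb\<bar> \<le> C3"
      unfolding fa_def fb_def by (rule order_trans[OF abs_Re_le_cmod C3(2)]; simp)+
    have Sd: "\<bar>Sd\<bar> \<le> C1 / (1 - 2 * real b * \<alpha>) * W"
    proof -
      have "\<bar>Sd\<bar> \<le> (\<Sum>m\<in>{1..Y}. C1 * real N powr (\<alpha> + \<epsilon>) * real m powr (- (2 * real b * \<alpha>)))"
        unfolding Sd_def
      proof (rule sum_norm_le[where f = "\<lambda>m. moebius_mu m * div_error a b (real N / real m ^ (2 * b))", unfolded real_norm_def])
        fix m assume m: "m \<in> {1..Y}"
        hence m1: "real m \<ge> 1" by simp
        have mp: "real m ^ (2 * b) = real m powr (2 * real b)"
          using m1 by (subst powr_realpow [symmetric]) auto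
        have "real m powr (2 * real b) \<le> (real N powr \<eta>) powr (2 * real b)"
          using m Yle m1 pos by (intro powr_mono2) auto
        also have "\<dots> = real N powr (2 * real b * \<eta>)" by (simp add: powr_powr mult_ac)
        also have "\<dots> \<le> real N powr 1" using \<eta>b N1 by (intro powr_mono) auto
        finally have u1: "real N / real m ^ (2 * b) \<ge> 1" using m1 N1 by (simp add: mp le_divide_eq)
        have "\<bar>moebius_mu m * div_error a b (real N / real m ^ (2 * b))\<bar> \<le> 1 * (C1 * (real N / real m ^ (2 * b)) powr (\<alpha> + \<epsilon>))"
          unfolding abs_mult by (intro mult_mono abs_moebius_mu_le C1(2) u1) auto
        also have "(real N / real m ^ (2 * b)) powr (\<alpha> + \<epsilon>) = real N powr (\<alpha> + \<epsilon>) * real m powr (- (2 * real b * (\<alpha> + \<epsilon>)))"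
          using m1 unfolding mp by (simp add: powr_divide powr_powr powr_minus_divide)
        \<comment> \<open>Dropping \<epsilon> from the exponent of m leaves 2b\<alpha>, which is
          below 1 as \<open>sum_powr_le\<close> requires.\<close>
        also have "\<dots> \<le> real N powr (\<alpha> + \<epsilon>) * real m powr (- (2 * real b * \<alpha>))"
          using m1 \<epsilon> pos by (intro mult_left_mono powr_mono) auto
        finally show "\<bar>moebius_mu m * div_error a b (real N / real m ^ (2 * b))\<bar> \<le> C1 * real N powr (\<alpha> + \<epsilon>) * real m powr (- (2 * real b * \<alpha>))"
          using C1(1) by (simp add: mult_left_mono mult.assoc)
      qed
      also have "\<dots> = C1 * real N powr (\<alpha> + \<epsilon>) * (\<Sum>m\<in>{1..Y}. real m powr (- (2 * real b * \<alpha>)))"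
        by (simp add: sum_distrib_left)
      also have "\<dots> \<le> C1 * real N powr (\<alpha> + \<epsilon>) * (real Y powr (1 - 2 * real b * \<alpha>) / (1 - 2 * real b * \<alpha>))"
        using C1(1) \<alpha>(1) pos b\<alpha> by (intro mult_left_mono sum_powr_le) auto
      also have "\<dots> \<le> C1 * real N powr (\<alpha> + \<epsilon>) * ((real N powr \<eta>) powr (1 - 2 * real b * \<alpha>) / (1 - 2 * real b * \<alpha>))"
        using C1(1) b\<alpha> Yle by (intro mult_left_mono divide_right_mono powr_mono2) auto
      also have "\<dots> = C1 / (1 - 2 * real b * \<alpha>) * (real N powr (\<alpha> + \<epsilon>) * real N powr (\<eta> * (1 - 2 * real b * \<alpha>)))"
        by (simp add: powr_powr)
      also have "real N powr (\<alpha> + \<epsilon>) * real N powr (\<eta> * (1 - 2 * real b * \<alpha>)) = W"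
        unfolding W_def E1 by (simp add: powr_add [symmetric] add_ac)
      finally show ?thesis .
    qed
    obtain ka kb where k: "\<bar>ka - real N powr (1 / real a)\<bar> \<le> 1" "\<bar>kb - real N powr (1 / real b)\<bar> \<le> 1"
      "Re (tail_main a b N Y) = za * fa * ka + (if b < 2 * a then zb * fb * kb else 0)"
      unfolding za_def zb_def fa_def fb_def using Re_tail_main[OF ab(1,2), of N Y] N by auto
    have T: "\<bar>T - Re (tail_main a b N Y)\<bar> \<le> C2 * 2 powr \<nu> * W"
    proof -
      have "\<bar>T - Re (tail_main a b N Y)\<bar> \<le> norm (of_real T - tail_main a b N Y)"
        using abs_Re_le_cmod[of "of_real T - tail_main a b N Y"] by simp
      also have "\<dots> \<le> C2 * real N powr (\<sigma> + 4 * e) * real Y powr (1/2 + e + 2 * e - 2 * real b * \<sigma>)"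
        unfolding T_def by (rule C2(2)) (use N Y1 in auto)
      also have "1/2 + e + 2 * e - 2 * real b * \<sigma> = - \<nu>" by (simp add: \<nu>_def)
      also have "C2 * real N powr (\<sigma> + 4 * e) * real Y powr (- \<nu>) \<le> C2 * real N powr (\<sigma> + 4 * e) * (2 powr \<nu> * real N powr (- (\<eta> * \<nu>)))"
        using C2(1) by (intro mult_left_mono Yneg \<nu>0) auto
      also have "\<dots> = C2 * 2 powr \<nu> * (real N powr (\<sigma> + 4 * e) * real N powr (- (\<eta> * \<nu>)))" by (simp only: mult_ac)
      also have "real N powr (\<sigma> + 4 * e) * real N powr (- (\<eta> * \<nu>)) = real N powr (\<sigma> + 4 * e - \<eta> * \<nu>)"
        by (simp add: powr_add [symmetric])
      also have "C2 * 2 powr \<nu> * real N powr (\<sigma> + 4 * e - \<eta> * \<nu>) \<le> C2 * 2 powr \<nu> * W"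
        using C2(1) by (intro mult_left_mono WI ex2) auto
      finally show ?thesis .
    qed
    have dist: "\<bar>z * f * k - z * f * n\<bar> \<le> \<bar>z\<bar> * C3 * W" if "\<bar>f\<bar> \<le> C3" "\<bar>k - n\<bar> \<le> 1" for z f k n
    proof -
      have "\<bar>z * f * k - z * f * n\<bar> = \<bar>z\<bar> * \<bar>f\<bar> * \<bar>k - n\<bar>" by (simp add: abs_mult [symmetric] algebra_simps)
      also have "\<dots> \<le> \<bar>z\<bar> * C3 * 1" using that C3(1) by (intro mult_mono) auto
      also have "\<dots> \<le> \<bar>z\<bar> * C3 * W" using W1 C3(1) by (intro mult_left_mono) auto
      finally show ?thesis .
    qed
    have A: "\<bar>za * fa * ka - za * fa * real N powr (1 / real a)\<bar> \<le> \<bar>za\<bar> * C3 * W"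
      by (rule dist[OF fa k(1)])
    have B: "\<bar>(if b < 2 * a then zb * fb * kb else 0) - zb * fb * real N powr (1 / real b)\<bar> \<le> \<bar>zb\<bar> * C3 * W + \<bar>zb\<bar> * C4 * 2 powr \<nu>2 * W"
    proof (cases "b < 2 * a")
      case True
      have "\<bar>zb\<bar> * C4 * 2 powr \<nu>2 * W \<ge> 0" using C4(1) W1 by simp
      thus ?thesis using True dist[OF fb k(2), of zb] by simp
    next
      case False
      \<comment> \<open>No residue at 1/b is available here; instead f_Y(2) itself is small under
        the Riemann hypothesis.\<close>
      have "\<bar>fb\<bar> \<le> norm (moebius_tail Y (Complex 2 0))"
        unfolding fb_def using abs_Re_le_cmod[of "moebius_tail Y (of_real 2)"] by (simp add: complex_of_real_def)
      also have "\<dots> \<le> C4 * real Y powr (- \<nu>2)"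
        using C4(2)[of Y 0] Y1 by (simp add: \<nu>2_def)
      also have "\<dots> \<le> C4 * (2 powr \<nu>2 * real N powr (- (\<eta> * \<nu>2)))"
        using C4(1) by (intro mult_left_mono Yneg \<nu>20) auto
      finally have fb': "\<bar>fb\<bar> \<le> C4 * (2 powr \<nu>2 * real N powr (- (\<eta> * \<nu>2)))" .
      have "\<bar>zb * fb * real N powr (1 / real b)\<bar> = \<bar>zb\<bar> * \<bar>fb\<bar> * real N powr (1 / real b)" by (simp add: abs_mult)
      also have "\<dots> \<le> \<bar>zb\<bar> * (C4 * (2 powr \<nu>2 * real N powr (- (\<eta> * \<nu>2)))) * real N powr (1 / real b)"
        by (intro mult_right_mono mult_left_mono fb') auto
      also have "\<dots> = \<bar>zb\<bar> * C4 * 2 powr \<nu>2 * (real N powr (1 / real b) * real N powr (- (\<eta> * \<nu>2)))" by (simp only: mult_ac)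
      also have "real N powr (1 / real b) * real N powr (- (\<eta> * \<nu>2)) = real N powr (1 / real b - \<eta> * \<nu>2)"
        by (simp add: powr_add [symmetric])
      also have "\<bar>zb\<bar> * C4 * 2 powr \<nu>2 * real N powr (1 / real b - \<eta> * \<nu>2) \<le> \<bar>zb\<bar> * C4 * 2 powr \<nu>2 * W"
        using C4(1) by (intro mult_left_mono WI ex4 False) auto
      finally have "\<bar>zb * fb * real N powr (1 / real b)\<bar> \<le> \<bar>zb\<bar> * C4 * 2 powr \<nu>2 * W" .
      moreover have "\<bar>zb\<bar> * C3 * W \<ge> 0" using C3(1) W1 by simp
      ultimately show ?thesis using False by simp
    qed
    have "\<bar>Sd + (T - za * fa * real N powr (1 / real a) - zb * fb * real N powr (1 / real b))\<bar>
      \<le> C1 / (1 - 2 * real b * \<alpha>) * W + C2 * 2 powr \<nu> * W + \<bar>za\<bar> * C3 * W + \<bar>zb\<bar> * C3 * W + \<bar>zb\<bar> * C4 * 2 powr \<nu>2 * W"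
      using Sd T A B k(3) by linarith
    also have "\<dots> \<le> C * W" unfolding C_def using W1 by (simp add: algebra_simps)
    finally show "\<bar>(\<Sum>n | 0 < n \<and> n \<le> N. gen_square_full_char a b n)
     - (zeta_real (real b / real a) / zeta_real (2 * real b / real a) * real N powr (1 / real a)
        + zeta_real (real a / real b) / zeta_real 2 * real N powr (1 / real b))\<bar>
     \<le> C * real N powr ((1 - real a * \<alpha>) / (real a + 2 * real b - 4 * real a * real b * \<alpha>) + \<epsilon>)"
      unfolding gen_square_full_decomposition[OF ab, of N Y]
      by (simp only: Sd_def T_def za_def zb_def fa_def fb_def W_def E_def Dn_def)
  qed (fact C0)
qed

theorem mainTheorem13:
  fixes a b :: nat and \<alpha> :: real
  assumes RH: Riemann_Hypothesis
    and "0 < a" and "a < b" and "\<not> a dvd b"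
    and "0 < \<alpha>" and "\<alpha> < 1 / (real a + real b)"
    and "\<And>\<epsilon>. \<epsilon> > 0 \<Longrightarrow> div_error a b \<in> O[at_top](\<lambda>x. x powr (\<alpha> + \<epsilon>))"
    and "\<alpha> < 1 / (2 * real b)"
  shows "\<forall>\<epsilon>>0.
    (\<lambda>x. (\<Sum>n | 0 < n \<and> real n \<le> x. gen_square_full_char a b n)
         - (zeta_real (real b / real a) / zeta_real (2 * real b / real a) * x powr (1 / real a)
            + zeta_real (real a / real b) / zeta_real 2 * x powr (1 / real b)))
      \<in> O[at_top](\<lambda>x. x powr
          ((1 - real a * \<alpha>) / (real a + 2 * real b - 4 * real a * real b * \<alpha>) + \<epsilon>))"
proof (intro allI impI)
  fix \<epsilon> :: real assume \<epsilon>: "\<epsilon> > 0"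
  \<comment> \<open>a = 1 would divide b. With a \<ge> 2 the line Re s = 1 lies in the region of
    absolute convergence.\<close>
  have a2: "2 \<le> a" using assms(2,4) by (cases "a = 1") auto
  define X where "X = (1 - real a * \<alpha>) / (real a + 2 * real b - 4 * real a * real b * \<alpha>) + \<epsilon>"
  define ca cb where "ca = zeta_real (real b / real a) / zeta_real (2 * real b / real a)"
    and "cb = zeta_real (real a / real b) / zeta_real 2"
  obtain C where C: "C > 0" "\<And>N. N \<ge> 1 \<Longrightarrow> \<bar>(\<Sum>n | 0 < n \<and> n \<le> N. gen_square_full_char a b n)
     - (ca * real N powr (1 / real a) + cb * real N powr (1 / real b))\<bar> \<le> C * real N powr X"
    using gen_square_full_nat_bound[OF RH a2 assms(3,4,5,8) \<epsilon> assms(7)[OF \<epsilon>]]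
    unfolding X_def ca_def cb_def by blast
  \<comment> \<open>Makes x^X at least 1 for x \<ge> 1, so that the O(1) changes of the main terms
    can be absorbed.\<close>
  have X0: "X > 0"
  proof -
    have pos: "real a > 0" "real b > 0" "real a < real b" using assms(2,3) by auto
    have b\<alpha>: "2 * real b * \<alpha> < 1" using assms(8) pos by (simp add: field_simps)
    have "real a * \<alpha> < 2 * real b * \<alpha>" using pos assms(5) by simp
    hence num: "1 - real a * \<alpha> > 0" using b\<alpha> by linarith
    have "2 * real a * (2 * real b * \<alpha>) < 2 * real a * 1" using b\<alpha> pos by (intro mult_strict_left_mono) auto
    moreover have "4 * real a * real b * \<alpha> = 2 * real a * (2 * real b * \<alpha>)" by simp
    ultimately have "real a + 2 * real b - 4 * real a * real b * \<alpha> > 0" using pos by linarith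
    with num show ?thesis unfolding X_def using \<epsilon> by (intro add_pos_pos divide_pos_pos)
  qed
  have "(\<lambda>x. (\<Sum>n | 0 < n \<and> real n \<le> x. gen_square_full_char a b n)
         - (ca * x powr (1 / real a) + cb * x powr (1 / real b))) \<in> O[at_top](\<lambda>x. x powr X)"
  proof (rule bigoI[of _ "C + \<bar>ca\<bar> + \<bar>cb\<bar>"])
    show "\<forall>\<^sub>F x in at_top. norm ((\<Sum>n | 0 < n \<and> real n \<le> x. gen_square_full_char a b n)
         - (ca * x powr (1 / real a) + cb * x powr (1 / real b))) \<le> (C + \<bar>ca\<bar> + \<bar>cb\<bar>) * norm (x powr X)"
      using eventually_ge_at_top[of 1]
    proof eventually_elim
      case (elim x)
      \<comment> \<open>The sum does not change between N and x, and each main term changes by at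
        most its coefficient.\<close>
      define N where "N = nat \<lfloor>x\<rfloor>"
      have N: "N \<ge> 1" "real N \<le> x" "x \<le> real N + 1" using elim unfolding N_def by linarith+
      have set: "{n. 0 < n \<and> real n \<le> x} = {n. 0 < n \<and> n \<le> N}"
        using elim unfolding N_def by (auto simp: le_nat_floor) linarith
      have xX: "x powr X \<ge> 1" using elim X0 by (intro ge_one_powr_ge_zero) auto
      have diff: "\<bar>c * x powr (1 / real k) - c * real N powr (1 / real k)\<bar> \<le> \<bar>c\<bar> * x powr X" if "k \<ge> 2" for c and k :: nat
      proof -
        have "0 \<le> x powr (1 / real k) - real N powr (1 / real k)" "x powr (1 / real k) - real N powr (1 / real k) \<le> 1"
          by (rule powr_diff_le_1; use N that in simp)+
        hence "\<bar>c\<bar> * \<bar>x powr (1 / real k) - real N powr (1 / real k)\<bar> \<le> \<bar>c\<bar> * x powr X"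
          using xX by (intro mult_left_mono) auto
        thus ?thesis by (simp add: abs_mult [symmetric] right_diff_distrib)
      qed
      have "C * real N powr X \<le> C * x powr X"
        using C(1) N X0 by (intro mult_left_mono powr_mono2) auto
      moreover have "2 \<le> b" using a2 assms(3) by simp
      ultimately have "\<bar>(\<Sum>n | 0 < n \<and> n \<le> N. gen_square_full_char a b n)
         - (ca * x powr (1 / real a) + cb * x powr (1 / real b))\<bar> \<le> C * x powr X + \<bar>ca\<bar> * x powr X + \<bar>cb\<bar> * x powr X"
        using C(2)[OF N(1)] diff[OF a2, of ca] diff[of b cb] by linarith
      also have "\<dots> = (C + \<bar>ca\<bar> + \<bar>cb\<bar>) * norm (x powr X)" by (simp add: distrib_right)
      finally show ?case by (simp add: set)
    qed
  qed
  thus "(\<lambda>x. (\<Sum>n | 0 < n \<and> real n \<le> x. gen_square_full_char a b n)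
         - (zeta_real (real b / real a) / zeta_real (2 * real b / real a) * x powr (1 / real a)
            + zeta_real (real a / real b) / zeta_real 2 * x powr (1 / real b)))
      \<in> O[at_top](\<lambda>x. x powr
          ((1 - real a * \<alpha>) / (real a + 2 * real b - 4 * real a * real b * \<alpha>) + \<epsilon>))"
    unfolding ca_def cb_def X_def .
qed

end
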